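(* Let $I\subseteq(0,\alpha]$ be a closed interval of positive length. Then $$\frac{N_t(I)}{\mathbb{E}N_t(I)}\to 1\quad\text{in probability as }t\to\infty.$$
   Context: Fix $\alpha\in(0,1)$, $\sigma=\sqrt{\alpha(1-\alpha)}$ and $\sigma_t=\sigma/\sqrt t$. Let $W$ be a standard one-dimensional Brownian motion on $[0,1]$. The scaled one-dimensional Conga line at time $t$ is $$u_t(x)=\int_0^1W(1-z)\frac{1}{\sqrt{2\pi}}\,\frac{x+\alpha z}{2\sigma_t z^{3/2}}\exp\left(-\frac{(x-\alpha z)^2}{2\sigma_t^2z}\right)dz,\qquad 0<x\le 1 .$$ $N_t(I)$ is the number of critical points of $u_t$ in $I$ (points where $u_t'=0$). *)

theory Defs
  imports "HOL-Probability.Probability"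
begin

locale brownian_motion_01 = prob_space M for M :: "'a measure" +
  fixes W :: "real \<Rightarrow> 'a \<Rightarrow> real"
  assumes BM_measurable: "\<And>s. s \<in> {0..1} \<Longrightarrow> W s \<in> borel_measurable M"
    and BM_zero: "AE \<omega> in M. W 0 \<omega> = 0"
    and BM_indep_increments:
      "\<And>(n :: nat) (\<tau> :: nat \<Rightarrow> real). mono \<tau> \<Longrightarrow> range \<tau> \<subseteq> {0..1} \<Longrightarrow>
         indep_vars (\<lambda>_. borel) (\<lambda>i \<omega>. W (\<tau> (Suc i)) \<omega> - W (\<tau> i) \<omega>) {..<n}"
    and BM_gaussian_increments:
      "\<And>r s. 0 \<le> r \<Longrightarrow> r < s \<Longrightarrow> s \<le> 1 \<Longrightarrow>
         distributed M lborel (\<lambda>\<omega>. W s \<omega> - W r \<omega>) (normal_density 0 (sqrt (s - r)))"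
    and BM_continuous: "AE \<omega> in M. continuous_on {0..1} (\<lambda>s. W s \<omega>)"

definition conga_sigma :: "real \<Rightarrow> real \<Rightarrow> real" where
  "conga_sigma \<alpha> t = sqrt (\<alpha> * (1 - \<alpha>)) / sqrt t"

text \<open>The Conga line driven by the path \<open>w\<close>. It is meaningful for \<open>0 < x \<le> 1\<close> only.\<close>

definition conga :: "real \<Rightarrow> (real \<Rightarrow> real) \<Rightarrow> real \<Rightarrow> real \<Rightarrow> real" where
  "conga \<alpha> w t x =
     (LBINT z:{0..1}. w (1 - z) * (1 / sqrt (2 * pi))
        * ((x + \<alpha> * z) / (2 * conga_sigma \<alpha> t * z powr (3/2)))
        * exp (- ((x - \<alpha> * z)\<^sup>2 / (2 * (conga_sigma \<alpha> t)\<^sup>2 * z))))"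

text \<open>Counting measure is used instead of \<^const>\<open>card\<close> so that an infinite set of critical
  points has count \<open>\<infinity>\<close> rather than \<open>0\<close>.\<close>

definition num_crit :: "real \<Rightarrow> (real \<Rightarrow> real) \<Rightarrow> real \<Rightarrow> real set \<Rightarrow> ennreal" where
  "num_crit \<alpha> w t I =
     emeasure (count_space UNIV) {x \<in> I. (conga \<alpha> w t has_real_derivative 0) (at x)}"

text \<open>Measurability is part of the notion, since \<^const>\<open>measure\<close> is \<open>0\<close> on non-measurable sets.
  Extended values are allowed: a point where \<open>X t\<close> is infinite lies in every deviation event.\<close>

definition tendsto_in_prob ::
    "'a measure \<Rightarrow> ('i \<Rightarrow> 'a \<Rightarrow> ennreal) \<Rightarrow> real \<Rightarrow> 'i filter \<Rightarrow> bool" where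
  "tendsto_in_prob M X c F \<longleftrightarrow>
     (\<forall>\<^sub>F t in F. X t \<in> borel_measurable M) \<and>
     (\<forall>\<epsilon>>0. ((\<lambda>t. measure M {\<omega> \<in> space M. \<bar>enn2ereal (X t \<omega>) - ereal c\<bar> > ereal \<epsilon>})
               \<longlongrightarrow> 0) F)"

end

theory Submission
  imports Defs
begin

text \<open>
Write \<open>s\<close> for the scale \<open>conga_sigma \<alpha> t\<close>. The kernel of the Conga line is a \<open>z\<close>-derivative of
a normal distribution function, so one more derivative in \<open>x\<close> and an integration by parts turn
\<open>u\<^sub>t'(x)\<close>, up to a factor without zeros, into the Wiener integral of
\<open>exp (- (x - \<alpha> z)\<^sup>2 / (2 s\<^sup>2 z)) / sqrt z\<close> against the time-reversed Brownian motion. The critical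
points of \<open>u\<^sub>t\<close> are thus the zeros of a centred Gaussian field. After removal of the factor
\<open>exp (\<alpha> x / s\<^sup>2)\<close>, and in the variable \<open>p = x\<^sup>2\<close>, its covariance at \<open>p\<close> and \<open>q\<close> is
\<open>\<kappa> (p + q)\<close> for a single function \<open>\<kappa>\<close>, a Laplace transform. All estimates reduce to this function.

\<^emph>\<open>Expected number of zeros.\<close> Two jointly Gaussian centred variables with correlation \<open>\<rho>\<close> have
opposite signs with probability \<open>arccos \<rho> / pi\<close> (\<open>gaussian_pair_sign_change\<close>), the angle between them
as vectors of a Hilbert space. The expected number of sign changes of the field along a grid is
therefore \<open>1 / pi\<close> times the length of a polygon inscribed in a curve on the unit sphere, and the
expected number of zeros is \<open>1 / pi\<close> times the length of the curve. Because
\<open>- ln \<rho> = (p - q)\<^sup>2 / 2 * (ln \<kappa>)'' \<xi>\<close>, the arcs are governed by \<open>(ln \<kappa>)''\<close>, a variance that is \<open>O(s\<^sup>-\<^sup>2)\<close> and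
has a derivative that is \<open>O(s\<^sup>-\<^sup>3)\<close> (\<open>log_kappa_curv_bounds\<close>). Hence a grid of mesh \<open>\<eta> s\<close> already sees all
but a fraction of the length that is small with \<open>\<eta>\<close>, uniformly in \<open>s\<close> (\<open>grid_length_refine\<close>). The length
itself is at least of order \<open>1 / s\<close>, since points \<open>K s\<close> apart have correlation at most \<open>1/2\<close>
(\<open>correlation_decay\<close>).

\<^emph>\<open>Concentration.\<close> As sign changes never exceed zeros, the mean distance between the number of zeros and the
number of sign changes on the coarse grid is just the difference of their means. On the coarse grid
the kernels may be cut off outside a window of width \<open>R s\<close>: this changes the sign at a grid point with
a probability that vanishes as \<open>R\<close> grows (\<open>windowed_sign_differs\<close>), and cut-off fields at points further apart
than the windows are independent. The number of sign changes of the cut-off field is then a sum of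
order \<open>1 / s\<close> indicators with dependence of bounded range; its variance is of order \<open>1 / s\<close>, and its
deviation from the mean is negligible against \<open>1 / s\<close> (\<open>windowed_sign_changes_deviation\<close>). Markov's inequality
concludes.

\<^emph>\<open>Measurability.\<close> Almost surely the field has no double zero and no zero on a grid, so the number of zeros
is the limit of the numbers of sign changes on finer and finer grids
(\<open>AE_sign_changes_tendsto_zero_count\<close>); this makes it measurable for the completed measure.
\<close>

section \<open>Independence from characteristic functions\<close>

text \<open>The signed measure with density \<open>Z\<close> becomes a probability measure after a constant is added to \<open>Z\<close> and
the result normalized. Under it \<open>X\<close> has the same characteristic function as under \<open>M\<close>, so Levy's
uniqueness theorem applies.\<close>

lemma (in prob_space) indicator_zero_if_fourier_zero_real:
  fixes Z X :: "'a \<Rightarrow> real"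
  assumes [measurable]: "Z \<in> borel_measurable M" "X \<in> borel_measurable M"
    and bdd: "\<And>\<omega>. \<bar>Z \<omega>\<bar> \<le> C"
    and zero: "\<And>s. (CLINT \<omega>|M. of_real (Z \<omega>) * iexp (s * X \<omega>)) = 0"
    and A [measurable]: "A \<in> sets borel"
  shows "(LINT \<omega>|M. Z \<omega> * indicator A (X \<omega>)) = 0"
proof -
  \<comment> \<open>one more than the bound, so that the density \<open>h\<close> below is nonnegative and \<open>D\<close> may be divided by\<close>
  define D where "D = \<bar>C\<bar> + 1"
  have D: "D > 0" "\<And>\<omega>. \<bar>Z \<omega>\<bar> < D" using bdd unfolding D_def by (auto simp: abs_if intro: le_less_trans) (smt (verit) bdd)+
  define h where "h \<omega> = (Z \<omega> + D) / D" for \<omega>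
  have h0: "h \<omega> \<ge> 0" for \<omega> using D(1) D(2)[of \<omega>] by (auto simp: h_def)
  have hm [measurable]: "h \<in> borel_measurable M" unfolding h_def by measurable
  have intZ: "integrable M Z"
    by (rule integrable_const_bound[where B=D]) (use D in \<open>auto intro: less_imp_le\<close>)
  have "complex_of_real (LINT \<omega>|M. Z \<omega>) = 0" using zero[of 0] by simp
  then have EZ: "(LINT \<omega>|M. Z \<omega>) = 0" by simp
  have inth: "integrable M h" unfolding h_def using intZ by auto
  have Eh: "(LINT \<omega>|M. h \<omega>) = 1" unfolding h_def using intZ EZ D(1) by (simp add: prob_space)
  define N where "N = density M (\<lambda>\<omega>. ennreal (h \<omega>))"
  have "emeasure N (space N) = 1"
    unfolding N_def using inth Eh h0 by (subst emeasure_density) (auto simp: nn_integral_eq_integral cong: nn_integral_cong_simp)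
  then interpret N: prob_space N by (rule prob_spaceI)
  have XN [measurable]: "X \<in> borel_measurable N" by (simp add: N_def)
  have "distr N borel X = distr M borel X"
  proof (rule Levy_uniqueness)
    show "real_distribution (distr N borel X)" by (rule N.real_distribution_distr) simp
    show "real_distribution (distr M borel X)" by (rule real_distribution_distr) simp
    show "char (distr N borel X) = char (distr M borel X)"
    proof
      fix t
      have "char (distr N borel X) t = (CLINT \<omega>|N. iexp (t * X \<omega>))"
        by (simp add: char_def integral_distr)
      also have "\<dots> = (CLINT \<omega>|M. h \<omega> *\<^sub>R iexp (t * X \<omega>))"
        unfolding N_def by (rule integral_density) (use h0 in auto)
      also have "\<dots> = (CLINT \<omega>|M. (of_real (Z \<omega>) * iexp (t * X \<omega>)) / of_real D + iexp (t * X \<omega>))"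
        using D(1) by (intro Bochner_Integration.integral_cong) (auto simp: h_def scaleR_conv_of_real field_simps)
      also have "\<dots> = (CLINT \<omega>|M. (of_real (Z \<omega>) * iexp (t * X \<omega>)) / of_real D) + (CLINT \<omega>|M. iexp (t * X \<omega>))"
      proof (rule Bochner_Integration.integral_add)
        have "integrable M (\<lambda>\<omega>. complex_of_real (Z \<omega>) * iexp (t * X \<omega>))"
          by (rule integrable_const_bound[where B=D]) (use D in \<open>auto intro: less_imp_le simp: norm_mult\<close>)
        then show "integrable M (\<lambda>\<omega>. complex_of_real (Z \<omega>) * iexp (t * X \<omega>) / complex_of_real D)" by simp
        show "integrable M (\<lambda>\<omega>. iexp (t * X \<omega>))" by (rule integrable_const_bound[where B=1]) auto
      qed
      also have "\<dots> = char (distr M borel X) t" using zero[of t] by (simp add: char_def integral_distr)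
      finally show "char (distr N borel X) t = char (distr M borel X) t" .
    qed
  qed
  then have "measure (distr N borel X) A = measure (distr M borel X) A" by simp
  then have eq: "measure N (X -` A \<inter> space M) = measure M (X -` A \<inter> space M)"
    by (simp add: measure_distr) (simp add: N_def)
  have "measure N (X -` A \<inter> space M) = (LINT \<omega>|N. indicator (X -` A \<inter> space M) \<omega>)"
    by (simp add: N_def)
  also have "\<dots> = (LINT \<omega>|M. h \<omega> *\<^sub>R indicator (X -` A \<inter> space M) \<omega>)"
    unfolding N_def by (rule integral_density) (use h0 in auto)
  also have "\<dots> = (LINT \<omega>|M. (Z \<omega> * indicator A (X \<omega>)) / D + indicator (X -` A \<inter> space M) \<omega>)"
    using D(1) by (intro Bochner_Integration.integral_cong) (auto simp: h_def field_simps indicator_def)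
  also have "\<dots> = (LINT \<omega>|M. (Z \<omega> * indicator A (X \<omega>)) / D) + measure M (X -` A \<inter> space M)"
  proof (subst Bochner_Integration.integral_add)
    have "integrable M (\<lambda>\<omega>. Z \<omega> * indicator A (X \<omega>))"
      by (rule integrable_const_bound[where B=D]) (use D in \<open>auto intro: less_imp_le simp: indicator_def\<close>)
    then show "integrable M (\<lambda>\<omega>. Z \<omega> * indicator A (X \<omega>) / D)" by simp
    show "integrable M (indicat_real (X -` A \<inter> space M))" by (rule integrable_const_bound[where B=1]) auto
  qed auto
  finally have "(LINT \<omega>|M. (Z \<omega> * indicator A (X \<omega>)) / D) = 0" using eq by simp
  then show ?thesis using D(1) by simp
qed

lemma (in prob_space) indicator_zero_if_fourier_zero:
  fixes Z :: "'a \<Rightarrow> complex" and X :: "'a \<Rightarrow> real"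
  assumes [measurable]: "Z \<in> borel_measurable M" "X \<in> borel_measurable M"
    and bdd: "\<And>\<omega>. norm (Z \<omega>) \<le> C"
    and zero: "\<And>s. (CLINT \<omega>|M. Z \<omega> * iexp (s * X \<omega>)) = 0"
    and A [measurable]: "A \<in> sets borel"
  shows "(CLINT \<omega>|M. Z \<omega> * indicator A (X \<omega>)) = 0"
proof -
  have cnjm [measurable]: "(\<lambda>\<omega>. cnj (Z \<omega>)) \<in> borel_measurable M"
    by (rule borel_measurable_continuous_on[where f=cnj]) (auto intro: continuous_intros)
  have int: "integrable M (\<lambda>\<omega>. Z \<omega> * iexp (s * X \<omega>))" for s
    by (rule integrable_const_bound[where B=C]) (use bdd in \<open>auto simp: norm_mult\<close>)
  have int': "integrable M (\<lambda>\<omega>. cnj (Z \<omega>) * iexp (s * X \<omega>))" for s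
    by (rule integrable_const_bound[where B=C]) (use bdd in \<open>auto simp: norm_mult\<close>)
  have zc: "(CLINT \<omega>|M. cnj (Z \<omega>) * iexp (s * X \<omega>)) = 0" for s
  proof -
    have "(CLINT \<omega>|M. cnj (Z \<omega>) * iexp (s * X \<omega>)) = (CLINT \<omega>|M. cnj (Z \<omega> * iexp ((-s) * X \<omega>)))"
      by (intro Bochner_Integration.integral_cong) (auto simp: exp_cnj)
    also have "\<dots> = cnj (CLINT \<omega>|M. Z \<omega> * iexp ((-s) * X \<omega>))"
      using Bochner_Integration.integral_cnj[of M "\<lambda>\<omega>. Z \<omega> * iexp ((-s) * X \<omega>)"] by blast
    finally show ?thesis using zero[of "-s"] by simp
  qed
  have Re0: "(CLINT \<omega>|M. of_real (Re (Z \<omega>)) * iexp (s * X \<omega>)) = 0" for s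
  proof -
    have "(CLINT \<omega>|M. of_real (Re (Z \<omega>)) * iexp (s * X \<omega>))
       = (CLINT \<omega>|M. (Z \<omega> * iexp (s * X \<omega>) + cnj (Z \<omega>) * iexp (s * X \<omega>)) / 2)"
      by (intro Bochner_Integration.integral_cong) (auto simp: complex_add_cnj simp flip: distrib_right)
    then show ?thesis using int[of s] int'[of s] zero zc by simp
  qed
  have Im0: "(CLINT \<omega>|M. of_real (Im (Z \<omega>)) * iexp (s * X \<omega>)) = 0" for s
  proof -
    have "(CLINT \<omega>|M. of_real (Im (Z \<omega>)) * iexp (s * X \<omega>))
       = (CLINT \<omega>|M. (Z \<omega> * iexp (s * X \<omega>) - cnj (Z \<omega>) * iexp (s * X \<omega>)) / (2 * \<i>))"
    proof (intro Bochner_Integration.integral_cong refl)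
      fix \<omega>
      have "(Z \<omega> * iexp (s * X \<omega>) - cnj (Z \<omega>) * iexp (s * X \<omega>)) / (2 * \<i>) = (Z \<omega> - cnj (Z \<omega>)) / (2 * \<i>) * iexp (s * X \<omega>)"
        by (simp add: left_diff_distrib diff_divide_distrib)
      also have "(Z \<omega> - cnj (Z \<omega>)) / (2 * \<i>) = of_real (Im (Z \<omega>))" by (simp add: complex_diff_cnj complex_eq_iff)
      finally show "of_real (Im (Z \<omega>)) * iexp (s * X \<omega>) = (Z \<omega> * iexp (s * X \<omega>) - cnj (Z \<omega>) * iexp (s * X \<omega>)) / (2 * \<i>)" ..
    qed
    then show ?thesis using int[of s] int'[of s] zero zc by simp
  qed
  have R: "(LINT \<omega>|M. Re (Z \<omega>) * indicator A (X \<omega>)) = 0"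
    by (rule indicator_zero_if_fourier_zero_real[where C=C]) (use Re0 order_trans[OF abs_Re_le_cmod bdd] in auto)
  have I: "(LINT \<omega>|M. Im (Z \<omega>) * indicator A (X \<omega>)) = 0"
    by (rule indicator_zero_if_fourier_zero_real[where C=C]) (use Im0 order_trans[OF abs_Im_le_cmod bdd] in auto)
  have intA: "integrable M (\<lambda>\<omega>. Z \<omega> * indicator A (X \<omega>))"
    by (rule integrable_const_bound[where B=C]) (use bdd order_trans[OF norm_ge_zero bdd] in \<open>auto simp: norm_mult indicator_def\<close>)
  show ?thesis
  proof (rule complex_eqI)
    show "Re (CLINT \<omega>|M. Z \<omega> * indicator A (X \<omega>)) = Re 0"
      using R intA by (subst integral_Re[symmetric]) (auto simp: indicator_def of_bool_def if_distrib cong: if_cong)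
    show "Im (CLINT \<omega>|M. Z \<omega> * indicator A (X \<omega>)) = Im 0"
      using I intA by (subst integral_Im[symmetric]) (auto simp: indicator_def of_bool_def if_distrib cong: if_cong)
  qed
qed

text \<open>A characteristic function in two variables is inverted one variable at a time: the factor that belongs
to the other variable is absorbed into the bounded weight \<open>Z\<close>.\<close>

lemma (in prob_space) indicators_zero_if_fourier_zero:
  fixes Z :: "'a \<Rightarrow> complex" and X Y :: "'a \<Rightarrow> real"
  assumes [measurable]: "Z \<in> borel_measurable M" "X \<in> borel_measurable M" "Y \<in> borel_measurable M"
    and bdd: "\<And>\<omega>. norm (Z \<omega>) \<le> C"
    and zero: "\<And>s t. (CLINT \<omega>|M. Z \<omega> * iexp (s * X \<omega> + t * Y \<omega>)) = 0"
    and A [measurable]: "A \<in> sets borel" "B \<in> sets borel"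
  shows "(CLINT \<omega>|M. Z \<omega> * (indicator A (X \<omega>) * indicator B (Y \<omega>))) = 0"
proof -
  have 1: "(CLINT \<omega>|M. (Z \<omega> * iexp (t * Y \<omega>)) * indicator A (X \<omega>)) = 0" for t
  proof (rule indicator_zero_if_fourier_zero[where C=C])
    fix s
    have "(CLINT \<omega>|M. (Z \<omega> * iexp (t * Y \<omega>)) * iexp (s * X \<omega>)) = (CLINT \<omega>|M. Z \<omega> * iexp (s * X \<omega> + t * Y \<omega>))"
      by (intro Bochner_Integration.integral_cong) (auto simp: exp_add algebra_simps)
    then show "(CLINT \<omega>|M. (Z \<omega> * iexp (t * Y \<omega>)) * iexp (s * X \<omega>)) = 0" using zero by simp
  qed (use bdd in \<open>auto simp: norm_mult\<close>)
  have C: "C \<ge> 0" using bdd[of undefined] norm_ge_zero order_trans by blast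
  have "(CLINT \<omega>|M. (Z \<omega> * indicator A (X \<omega>)) * indicator B (Y \<omega>)) = 0"
  proof (rule indicator_zero_if_fourier_zero[where C=C])
    fix t
    show "(CLINT \<omega>|M. (Z \<omega> * indicator A (X \<omega>)) * iexp (t * Y \<omega>)) = 0"
      using 1[of t] by (simp add: mult_ac)
  qed (use bdd C in \<open>auto simp: norm_mult indicator_def\<close>)
  then show ?thesis by (simp add: mult.assoc)
qed

text \<open>The exponentials of the first pair are replaced by indicators against the weight
\<open>exp (i (c Y1 + d Y2)) - \<psi> c d\<close>; the resulting identity, read as a statement about \<open>Y1\<close> and \<open>Y2\<close> with the
weight \<open>1 - P\<close>, where \<open>1\<close> is the indicator of the first event and \<open>P\<close> its probability, is inverted in the
same way. This gives independence of vectors with the uniqueness theorem in dimension one only.\<close>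

lemma (in prob_space) pairs_independent_if_char_factorizes:
  fixes X1 X2 Y1 Y2 :: "'a \<Rightarrow> real" and \<phi> \<psi> :: "real \<Rightarrow> real \<Rightarrow> complex"
  assumes [measurable]: "X1 \<in> borel_measurable M" "X2 \<in> borel_measurable M" "Y1 \<in> borel_measurable M" "Y2 \<in> borel_measurable M"
    and ch: "\<And>a b c d. (CLINT \<omega>|M. iexp (a * X1 \<omega> + b * X2 \<omega> + c * Y1 \<omega> + d * Y2 \<omega>)) = \<phi> a b * \<psi> c d"
    and phi0: "\<phi> 0 0 = 1" and psi0: "\<psi> 0 0 = 1"
    and A [measurable]: "A \<in> sets borel" "B \<in> sets borel" "A' \<in> sets borel" "B' \<in> sets borel"
  shows "prob {\<omega>\<in>space M. (X1 \<omega> \<in> A \<and> X2 \<omega> \<in> B) \<and> (Y1 \<omega> \<in> A' \<and> Y2 \<omega> \<in> B')}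
       = prob {\<omega>\<in>space M. X1 \<omega> \<in> A \<and> X2 \<omega> \<in> B} * prob {\<omega>\<in>space M. Y1 \<omega> \<in> A' \<and> Y2 \<omega> \<in> B'}"
proof -
  define E where "E = {\<omega>\<in>space M. X1 \<omega> \<in> A \<and> X2 \<omega> \<in> B}"
  define F where "F = {\<omega>\<in>space M. Y1 \<omega> \<in> A' \<and> Y2 \<omega> \<in> B'}"
  have [measurable]: "E \<in> sets M" "F \<in> sets M" by (auto simp: E_def F_def)
  have chX: "(CLINT \<omega>|M. iexp (a * X1 \<omega> + b * X2 \<omega>)) = \<phi> a b" for a b using ch[of a b 0 0] psi0 by simp
  have chY: "(CLINT \<omega>|M. iexp (c * Y1 \<omega> + d * Y2 \<omega>)) = \<psi> c d" for c d using ch[of 0 0 c d] phi0 by simp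
  have psi_le: "norm (\<psi> c d) \<le> 1" for c d
  proof -
    have "norm (CLINT \<omega>|M. iexp (c * Y1 \<omega> + d * Y2 \<omega>)) \<le> (LINT \<omega>|M. norm (iexp (c * Y1 \<omega> + d * Y2 \<omega>)))"
      by (rule integral_norm_bound)
    then show ?thesis unfolding chY by (simp add: prob_space)
  qed
  have iX: "integrable M (\<lambda>\<omega>. iexp (a * X1 \<omega> + b * X2 \<omega>))" for a b by (rule integrable_const_bound[where B=1]) auto
  have iY: "integrable M (\<lambda>\<omega>. iexp (a * Y1 \<omega> + b * Y2 \<omega>))" for a b by (rule integrable_const_bound[where B=1]) auto
  have iXY: "integrable M (\<lambda>\<omega>. iexp (a * X1 \<omega> + b * X2 \<omega> + c * Y1 \<omega> + d * Y2 \<omega>))" for a b c d by (rule integrable_const_bound[where B=1]) auto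
  have iE: "integrable M (\<lambda>\<omega>. indicator A (X1 \<omega>) * indicator B (X2 \<omega>) * iexp (c * Y1 \<omega> + d * Y2 \<omega>))" for c d
    by (rule integrable_const_bound[where B=1]) (auto simp: norm_mult indicator_def)
  have iE': "integrable M (\<lambda>\<omega>. indicator A (X1 \<omega>) * indicator B (X2 \<omega>) :: complex)"
    by (rule integrable_const_bound[where B=1]) (auto simp: norm_mult indicator_def)
  have PE: "(CLINT \<omega>|M. indicator A (X1 \<omega>) * indicator B (X2 \<omega>)) = of_real (prob E)"
  proof -
    have "(CLINT \<omega>|M. indicator A (X1 \<omega>) * indicator B (X2 \<omega>)) = (CLINT \<omega>|M. of_real (indicator E \<omega>))"
      by (intro Bochner_Integration.integral_cong) (auto simp: indicator_def E_def)
    then show ?thesis by simp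
  qed
  have 1: "(CLINT \<omega>|M. (iexp (c * Y1 \<omega> + d * Y2 \<omega>) - \<psi> c d) * (indicator A (X1 \<omega>) * indicator B (X2 \<omega>))) = 0" for c d
  proof (rule indicators_zero_if_fourier_zero[where C=2])
    show "norm (iexp (c * Y1 \<omega> + d * Y2 \<omega>) - \<psi> c d) \<le> 2" for \<omega>
      using psi_le[of c d] by (intro order_trans[OF norm_triangle_ineq4]) simp
    fix a b
    have "(CLINT \<omega>|M. (iexp (c * Y1 \<omega> + d * Y2 \<omega>) - \<psi> c d) * iexp (a * X1 \<omega> + b * X2 \<omega>))
      = (CLINT \<omega>|M. iexp (a * X1 \<omega> + b * X2 \<omega> + c * Y1 \<omega> + d * Y2 \<omega>) - \<psi> c d * iexp (a * X1 \<omega> + b * X2 \<omega>))"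
      by (intro Bochner_Integration.integral_cong) (auto simp: algebra_simps exp_add)
    also have "\<dots> = 0"
      using iXY[of a b c d] iX[of a b] by (subst Bochner_Integration.integral_diff) (auto simp: ch chX simp del: of_real_add of_real_mult)
    finally show "(CLINT \<omega>|M. (iexp (c * Y1 \<omega> + d * Y2 \<omega>) - \<psi> c d) * iexp (a * X1 \<omega> + b * X2 \<omega>)) = 0" .
  qed auto
  have 2: "(CLINT \<omega>|M. (indicator A (X1 \<omega>) * indicator B (X2 \<omega>) - of_real (prob E)) * (indicator A' (Y1 \<omega>) * indicator B' (Y2 \<omega>))) = 0"
  proof (rule indicators_zero_if_fourier_zero[where C=2])
    show "norm (indicator A (X1 \<omega>) * indicator B (X2 \<omega>) - complex_of_real (prob E)) \<le> 2" for \<omega>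
      by (rule order_trans[OF norm_triangle_ineq4]) (auto simp: norm_mult indicator_def intro: order_trans[OF prob_le_1])
    fix c d
    have "(CLINT \<omega>|M. (iexp (c * Y1 \<omega> + d * Y2 \<omega>) - \<psi> c d) * (indicator A (X1 \<omega>) * indicator B (X2 \<omega>)))
      = (CLINT \<omega>|M. indicator A (X1 \<omega>) * indicator B (X2 \<omega>) * iexp (c * Y1 \<omega> + d * Y2 \<omega>) - \<psi> c d * (indicator A (X1 \<omega>) * indicator B (X2 \<omega>)))"
      by (intro Bochner_Integration.integral_cong) (auto simp: algebra_simps)
    also have "\<dots> = (CLINT \<omega>|M. indicator A (X1 \<omega>) * indicator B (X2 \<omega>) * iexp (c * Y1 \<omega> + d * Y2 \<omega>)) - \<psi> c d * of_real (prob E)"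
      using iE[of c d] iE' PE by (subst Bochner_Integration.integral_diff) auto
    finally have e: "(CLINT \<omega>|M. indicator A (X1 \<omega>) * indicator B (X2 \<omega>) * iexp (c * Y1 \<omega> + d * Y2 \<omega>)) = \<psi> c d * of_real (prob E)"
      using 1[of c d] by simp
    have "(CLINT \<omega>|M. (indicator A (X1 \<omega>) * indicator B (X2 \<omega>) - of_real (prob E)) * iexp (c * Y1 \<omega> + d * Y2 \<omega>))
      = (CLINT \<omega>|M. indicator A (X1 \<omega>) * indicator B (X2 \<omega>) * iexp (c * Y1 \<omega> + d * Y2 \<omega>) - of_real (prob E) * iexp (c * Y1 \<omega> + d * Y2 \<omega>))"
      by (intro Bochner_Integration.integral_cong) (auto simp: algebra_simps)
    also have "\<dots> = 0"
      using iE[of c d] iY[of c d] e by (subst Bochner_Integration.integral_diff) (auto simp: chY simp del: of_real_add of_real_mult)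
    finally show "(CLINT \<omega>|M. (indicator A (X1 \<omega>) * indicator B (X2 \<omega>) - of_real (prob E)) * iexp (c * Y1 \<omega> + d * Y2 \<omega>)) = 0" .
  qed auto
  have "(CLINT \<omega>|M. (indicator A (X1 \<omega>) * indicator B (X2 \<omega>) - of_real (prob E)) * (indicator A' (Y1 \<omega>) * indicator B' (Y2 \<omega>)))
    = (CLINT \<omega>|M. of_real (indicator (E \<inter> F) \<omega> - prob E * indicator F \<omega>))"
    by (intro Bochner_Integration.integral_cong) (auto simp: indicator_def E_def F_def)
  also have "\<dots> = of_real (LINT \<omega>|M. indicator (E \<inter> F) \<omega> - prob E * indicator F \<omega>)" by (rule integral_complex_of_real)
  also have "(LINT \<omega>|M. indicator (E \<inter> F) \<omega> - prob E * indicator F \<omega>) = prob (E \<inter> F) - prob E * prob F"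
    by (subst Bochner_Integration.integral_diff) (auto intro!: integrable_real_indicator simp: emeasure_eq_measure)
  finally have "prob (E \<inter> F) = prob E * prob F" using 2 by (simp del: of_real_diff of_real_mult)
  moreover have "E \<inter> F = {\<omega>\<in>space M. (X1 \<omega> \<in> A \<and> X2 \<omega> \<in> B) \<and> (Y1 \<omega> \<in> A' \<and> Y2 \<omega> \<in> B')}"
    by (auto simp: E_def F_def)
  ultimately show ?thesis by (simp add: E_def F_def)
qed

lemma (in prob_space) sign_changes_independent_if_char_factorizes:
  fixes X1 X2 Y1 Y2 :: "'a \<Rightarrow> real" and \<phi> \<psi> :: "real \<Rightarrow> real \<Rightarrow> complex"
  assumes m [measurable]: "X1 \<in> borel_measurable M" "X2 \<in> borel_measurable M" "Y1 \<in> borel_measurable M" "Y2 \<in> borel_measurable M"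
    and ch: "\<And>a b c d. (CLINT \<omega>|M. iexp (a * X1 \<omega> + b * X2 \<omega> + c * Y1 \<omega> + d * Y2 \<omega>)) = \<phi> a b * \<psi> c d"
    and phi0: "\<phi> 0 0 = 1" and psi0: "\<psi> 0 0 = 1"
  shows "prob {\<omega>\<in>space M. X1 \<omega> * X2 \<omega> < 0 \<and> Y1 \<omega> * Y2 \<omega> < 0}
       = prob {\<omega>\<in>space M. X1 \<omega> * X2 \<omega> < 0} * prob {\<omega>\<in>space M. Y1 \<omega> * Y2 \<omega> < 0}"
proof -
  note rect = pairs_independent_if_char_factorizes[OF m ch phi0 psi0]
  let ?P = "{0<..} :: real set" and ?N = "{..<0} :: real set"
  let ?X = "\<lambda>A B. {\<omega>\<in>space M. X1 \<omega> \<in> A \<and> X2 \<omega> \<in> B}"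
  let ?Y = "\<lambda>A B. {\<omega>\<in>space M. Y1 \<omega> \<in> A \<and> Y2 \<omega> \<in> B}"
  let ?XY = "\<lambda>A B A' B'. {\<omega>\<in>space M. (X1 \<omega> \<in> A \<and> X2 \<omega> \<in> B) \<and> (Y1 \<omega> \<in> A' \<and> Y2 \<omega> \<in> B')}"
  have un: "prob C = prob D + prob E" if "C = D \<union> E" "D \<inter> E = {}" "D \<in> sets M" "E \<in> sets M" for C D E
    using that finite_measure_Union by simp
  have X: "prob {\<omega>\<in>space M. X1 \<omega> * X2 \<omega> < 0} = prob (?X ?P ?N) + prob (?X ?N ?P)"
    by (rule un) (auto simp: mult_less_0_iff)
  have Y: "prob {\<omega>\<in>space M. Y1 \<omega> * Y2 \<omega> < 0} = prob (?Y ?P ?N) + prob (?Y ?N ?P)"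
    by (rule un) (auto simp: mult_less_0_iff)
  define S where "S = {\<omega>\<in>space M. X1 \<omega> \<in> ?P \<and> X2 \<omega> \<in> ?N \<and> Y1 \<omega> * Y2 \<omega> < 0}"
  define T where "T = {\<omega>\<in>space M. X1 \<omega> \<in> ?N \<and> X2 \<omega> \<in> ?P \<and> Y1 \<omega> * Y2 \<omega> < 0}"
  have 0: "prob {\<omega>\<in>space M. X1 \<omega> * X2 \<omega> < 0 \<and> Y1 \<omega> * Y2 \<omega> < 0} = prob S + prob T"
    by (rule un) (auto simp: mult_less_0_iff S_def T_def)
  have 1: "prob S = prob (?XY ?P ?N ?P ?N) + prob (?XY ?P ?N ?N ?P)"
    unfolding S_def by (rule un) (auto simp: mult_less_0_iff)
  have 2: "prob T = prob (?XY ?N ?P ?P ?N) + prob (?XY ?N ?P ?N ?P)"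
    unfolding T_def by (rule un) (auto simp: mult_less_0_iff)
  have PN: "?P \<in> sets borel" "?N \<in> sets borel" by auto
  show ?thesis unfolding 0 1 2 X Y rect[OF PN PN] rect[OF PN PN(2,1)] rect[OF PN(2,1) PN] rect[OF PN(2,1) PN(2,1)]
    by (simp only: distrib_left distrib_right add.assoc add.left_commute add.commute)
qed

section \<open>Sign changes of Gaussian pairs\<close>

text \<open>The substitution \<open>y = x v\<close> reduces the double integral to the tail of a Cauchy distribution: the quotient of
two independent standard normal variables is Cauchy distributed.\<close>

lemma gaussian_half_planes:
  fixes k :: real
  shows "(\<integral>\<^sup>+x. \<integral>\<^sup>+y. ennreal (std_normal_density x) * ennreal (std_normal_density y) * indicator {p. fst p * (k * fst p + snd p) < 0} (x, y) \<partial>lborel \<partial>lborel)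
     = ennreal ((pi / 2 - arctan k) / pi)"
proof -
  have inner: "(\<integral>\<^sup>+y. ennreal (std_normal_density x) * ennreal (std_normal_density y) * indicator {p. fst p * (k * fst p + snd p) < 0} (x, y) \<partial>lborel)
     = (\<integral>\<^sup>+y. ennreal (\<bar>x\<bar> / (2 * pi) * exp (- (x\<^sup>2 * (1 + y\<^sup>2) / 2))) * indicator {..< -k} y \<partial>lborel)" if x: "x \<noteq> 0" for x :: real
  proof -
    have "(\<integral>\<^sup>+y. ennreal (std_normal_density x) * ennreal (std_normal_density y) * indicator {p. fst p * (k * fst p + snd p) < 0} (x, y) \<partial>lborel)
      = \<bar>x\<bar> * (\<integral>\<^sup>+y. ennreal (std_normal_density x) * ennreal (std_normal_density (0 + x * y)) * indicator {p. fst p * (k * fst p + snd p) < 0} (x, 0 + x * y) \<partial>lborel)"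
      by (rule nn_integral_real_affine[OF _ x]) simp
    also have "\<dots> = (\<integral>\<^sup>+y. \<bar>x\<bar> * (ennreal (std_normal_density x) * ennreal (std_normal_density (0 + x * y)) * indicator {p. fst p * (k * fst p + snd p) < 0} (x, 0 + x * y)) \<partial>lborel)"
      by (rule nn_integral_cmult[symmetric]) simp
    also have "\<dots> = (\<integral>\<^sup>+y. ennreal (\<bar>x\<bar> / (2 * pi) * exp (- (x\<^sup>2 * (1 + y\<^sup>2) / 2))) * indicator {..< -k} y \<partial>lborel)"
    proof (rule nn_integral_cong)
      fix y :: real
      have e: "x * (k * x + x * y) = x\<^sup>2 * (k + y)" by (simp add: power2_eq_square algebra_simps)
      have "x * (k * x + x * y) < 0 \<longleftrightarrow> y < - k" unfolding e using x by (auto simp: mult_less_0_iff)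
      moreover have "std_normal_density x * std_normal_density (x * y) = 1 / (2 * pi) * exp (- (x\<^sup>2 * (1 + y\<^sup>2) / 2))"
        by (simp add: std_normal_density_def power_mult_distrib exp_add[symmetric] field_simps)
      ultimately show "\<bar>x\<bar> * (ennreal (std_normal_density x) * ennreal (std_normal_density (0 + x * y)) * indicator {p. fst p * (k * fst p + snd p) < 0} (x, 0 + x * y))
        = ennreal (\<bar>x\<bar> / (2 * pi) * exp (- (x\<^sup>2 * (1 + y\<^sup>2) / 2))) * indicator {..< -k} y"
        by (auto simp: indicator_def ennreal_mult[symmetric])
    qed
    finally show ?thesis .
  qed
  have rad: "(\<integral>\<^sup>+x. ennreal (\<bar>x\<bar> / (2 * pi) * exp (- (x\<^sup>2 * (1 + y\<^sup>2) / 2))) \<partial>lborel) = ennreal (1 / (pi * (1 + y\<^sup>2)))" for y :: real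
  proof -
    define c where "c = sqrt (1 + y\<^sup>2)"
    have c: "c > 0" "c\<^sup>2 = 1 + y\<^sup>2" using sum_power2_gt_zero_iff[of 1 y] by (auto simp: c_def)
    have tilted_moment: "has_bochner_integral lborel (\<lambda>x. std_normal_density x * \<bar>x\<bar>) (sqrt (2/pi))"
      using std_normal_moment_abs_odd[of 0] by simp
    have "has_bochner_integral lborel (\<lambda>x. std_normal_density (0 + c * x) * \<bar>0 + c * x\<bar>) (sqrt (2/pi) /\<^sub>R \<bar>c\<bar>)"
      by (rule lborel_has_bochner_integral_real_affine_iff[THEN iffD1, OF _ tilted_moment]) (use c in simp)
    then have "has_bochner_integral lborel (\<lambda>x. (1 / (c * sqrt (2 * pi))) * (std_normal_density (0 + c * x) * \<bar>0 + c * x\<bar>)) ((1 / (c * sqrt (2 * pi))) * (sqrt (2/pi) /\<^sub>R \<bar>c\<bar>))"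
      by (rule has_bochner_integral_mult_right)
    moreover have "(1 / (c * sqrt (2 * pi))) * (std_normal_density (0 + c * x) * \<bar>0 + c * x\<bar>) = \<bar>x\<bar> / (2 * pi) * exp (- (x\<^sup>2 * (1 + y\<^sup>2) / 2))" for x
      using c by (simp add: std_normal_density_def abs_mult power_mult_distrib field_simps)
    moreover have "(1 / (c * sqrt (2 * pi))) * (sqrt (2/pi) /\<^sub>R \<bar>c\<bar>) = 1 / (pi * (1 + y\<^sup>2))"
    proof -
      have "sqrt (2/pi) = 2 / sqrt (2 * pi)" by (simp add: real_sqrt_divide real_sqrt_mult field_simps)
      then have "(1 / (c * sqrt (2 * pi))) * (sqrt (2/pi) /\<^sub>R \<bar>c\<bar>) = 2 / (c\<^sup>2 * (sqrt (2 * pi))\<^sup>2)"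
        using c(1) by (simp add: power2_eq_square divide_simps del: real_sqrt_mult_self)
      also have "\<dots> = 1 / (pi * (1 + y\<^sup>2))" by (simp add: c(2) mult.commute)
      finally show ?thesis .
    qed
    ultimately have "has_bochner_integral lborel (\<lambda>x. \<bar>x\<bar> / (2 * pi) * exp (- (x\<^sup>2 * (1 + y\<^sup>2) / 2))) (1 / (pi * (1 + y\<^sup>2)))" by simp
    then show ?thesis
      by (intro nn_integral_eq_integral[THEN trans]) (auto simp: has_bochner_integral_iff)
  qed
  have "AE x in lborel. x \<noteq> (0::real)" by (rule AE_lborel_singleton)
  then have "(\<integral>\<^sup>+x. \<integral>\<^sup>+y. ennreal (std_normal_density x) * ennreal (std_normal_density y) * indicator {p. fst p * (k * fst p + snd p) < 0} (x, y) \<partial>lborel \<partial>lborel)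
    = (\<integral>\<^sup>+x. \<integral>\<^sup>+y. ennreal (\<bar>x\<bar> / (2 * pi) * exp (- (x\<^sup>2 * (1 + y\<^sup>2) / 2))) * indicator {..< -k} y \<partial>lborel \<partial>lborel)"
    by (intro nn_integral_cong_AE) (use inner in auto)
  also have "\<dots> = (\<integral>\<^sup>+y. \<integral>\<^sup>+x. ennreal (\<bar>x\<bar> / (2 * pi) * exp (- (x\<^sup>2 * (1 + y\<^sup>2) / 2))) * indicator {..< -k} y \<partial>lborel \<partial>lborel)"
    by (rule lborel_pair.Fubini') simp
  also have "\<dots> = (\<integral>\<^sup>+y. ennreal (1 / (pi * (1 + y\<^sup>2))) * indicator {..< -k} y \<partial>lborel)"
    by (intro nn_integral_cong, subst nn_integral_multc) (simp_all only: rad, simp)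
  also have "\<dots> = ennreal \<bar>-1\<bar> * (\<integral>\<^sup>+y. ennreal (1 / (pi * (1 + (0 + -1 * y)\<^sup>2))) * indicator {..< -k} (0 + -1 * y) \<partial>lborel)"
    by (rule nn_integral_real_affine) auto
  also have "\<dots> = (\<integral>\<^sup>+y. ennreal (1 / (pi * (1 + y\<^sup>2))) * indicator {k..} y \<partial>lborel)"
    using AE_lborel_singleton[of k]
    by simp (auto intro!: nn_integral_cong_AE simp: indicator_def)
  also have "\<dots> = ennreal (pi / 2 / pi - arctan k / pi)"
  proof (rule nn_integral_FTC_atLeast)
    show "((\<lambda>x. arctan x / pi) has_real_derivative 1 / (pi * (1 + x\<^sup>2))) (at x)" for x
      by (auto intro!: derivative_eq_intros simp: field_simps add_nonneg_eq_0_iff)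
    show "((\<lambda>x. arctan x / pi) \<longlongrightarrow> pi / 2 / pi) at_top"
      by (intro tendsto_intros tendsto_arctan_at_top) simp
  qed auto
  finally show ?thesis by (simp add: diff_divide_distrib)
qed

lemma (in prob_space) gaussian_standardized:
  fixes X :: "'a \<Rightarrow> real"
  assumes [measurable]: "X \<in> borel_measurable M" and u: "u > 0"
    and ch: "\<And>a. (CLINT \<omega>|M. iexp (a * X \<omega>)) = of_real (exp (- (a\<^sup>2 * u) / 2))"
  shows "distr M borel (\<lambda>\<omega>. X \<omega> / sqrt u) = std_normal_distribution"
proof (rule Levy_uniqueness)
  show "real_distribution (distr M borel (\<lambda>\<omega>. X \<omega> / sqrt u))" by (rule real_distribution_distr) simp
  show "real_distribution std_normal_distribution" by (rule real_dist_normal_dist)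
  show "char (distr M borel (\<lambda>\<omega>. X \<omega> / sqrt u)) = char std_normal_distribution"
  proof
    fix t
    have "char (distr M borel (\<lambda>\<omega>. X \<omega> / sqrt u)) t = (CLINT \<omega>|M. iexp ((t / sqrt u) * X \<omega>))"
      by (simp add: char_def integral_distr mult.commute)
    also have "\<dots> = char std_normal_distribution t"
      unfolding ch char_std_normal_distribution using u by (simp add: power_divide)
    finally show "char (distr M borel (\<lambda>\<omega>. X \<omega> / sqrt u)) t = char std_normal_distribution t" .
  qed
qed

text \<open>The normal density is at most \<open>1 / sqrt (2 pi u)\<close>, hence at most \<open>1 / (2 sqrt u)\<close>.\<close>

lemma (in prob_space) gaussian_small_ball:
  fixes X :: "'a \<Rightarrow> real"
  assumes [measurable]: "X \<in> borel_measurable M" and u: "u > 0" and e: "e \<ge> 0"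
    and ch: "\<And>a. (CLINT \<omega>|M. iexp (a * X \<omega>)) = of_real (exp (- (a\<^sup>2 * u) / 2))"
  shows "prob {\<omega>\<in>space M. \<bar>X \<omega>\<bar> \<le> e} \<le> e / sqrt u"
proof -
  interpret N: prob_space std_normal_distribution by (rule prob_space_normal_density) simp
  define r where "r = e / sqrt u"
  have r: "r \<ge> 0" using e u by (simp add: r_def)
  have "prob {\<omega>\<in>space M. \<bar>X \<omega>\<bar> \<le> e} = measure (distr M borel (\<lambda>\<omega>. X \<omega> / sqrt u)) {-r..r}"
    using u by (subst measure_distr) (auto intro!: arg_cong[where f=prob] simp: r_def field_simps abs_le_iff)
  also have "\<dots> = measure std_normal_distribution {-r..r}" using gaussian_standardized[OF assms(1) u ch] by simp
  also have "\<dots> \<le> r"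
  proof -
    have "emeasure std_normal_distribution {-r..r} = (\<integral>\<^sup>+x. ennreal (std_normal_density x) * indicator {-r..r} x \<partial>lborel)"
      by (rule emeasure_density) auto
    also have "\<dots> \<le> (\<integral>\<^sup>+x. ennreal (1/2) * indicator {-r..r} x \<partial>lborel)"
    proof (intro nn_integral_mono mult_right_mono ennreal_leI)
      fix x :: real
      have "std_normal_density x \<le> 1 / sqrt (2 * pi)"
        unfolding std_normal_density_def by (intro mult_left_le) auto
      also have "\<dots> \<le> 1 / 2" 
      proof -
        have "2 \<le> sqrt (2 * pi)" using pi_gt3 by (intro real_le_rsqrt) auto
        then show ?thesis by (simp add: field_simps)
      qed
      finally show "std_normal_density x \<le> 1 / 2" .
    qed auto
    also have "\<dots> = ennreal (1/2) * ennreal (2 * r)" using r by (simp add: nn_integral_cmult_indicator)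
    also have "\<dots> = ennreal r" using r by (subst ennreal_mult[symmetric]) auto
    finally show ?thesis using r by (simp add: N.emeasure_eq_measure)
  qed
  finally show ?thesis by (simp add: r_def)
qed

lemma (in prob_space) gaussian_zero_variance:
  fixes X :: "'a \<Rightarrow> real"
  assumes [measurable]: "X \<in> borel_measurable M"
    and ch: "\<And>a. (CLINT \<omega>|M. iexp (a * X \<omega>)) = 1"
  shows "AE \<omega> in M. X \<omega> = 0"
proof -
  have "distr M borel X = return borel 0"
  proof (rule Levy_uniqueness)
    show "real_distribution (distr M borel X)" by (rule real_distribution_distr) simp
    show "real_distribution (return borel (0::real))"
      by (auto simp: real_distribution_def real_distribution_axioms_def intro: prob_space_return)
    show "char (distr M borel X) = char (return borel 0)"
      using ch by (intro ext) (simp add: char_def integral_distr integral_return)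
  qed
  moreover have "AE x in return borel 0. x = (0::real)" by (subst AE_return) auto
  ultimately have "AE x in distr M borel X. x = 0" by metis
  then show ?thesis by (subst (asm) AE_distr_iff) auto
qed

text \<open>A characteristic function is bounded by 1, so the quadratic form in its exponent is nonnegative.\<close>

lemma (in prob_space) gaussian_pair_cauchy_schwarz:
  fixes X Y :: "'a \<Rightarrow> real"
  assumes [measurable]: "X \<in> borel_measurable M" "Y \<in> borel_measurable M" and u: "u > 0" 
    and ch: "\<And>a b. (CLINT \<omega>|M. iexp (a * X \<omega> + b * Y \<omega>)) = of_real (exp (- (a\<^sup>2 * u + 2 * a * b * c + b\<^sup>2 * v) / 2))"
  shows "c\<^sup>2 \<le> u * v"
proof -
  have "norm (CLINT \<omega>|M. iexp (- c * X \<omega> + u * Y \<omega>)) \<le> (LINT \<omega>|M. norm (iexp (- c * X \<omega> + u * Y \<omega>)))"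
    by (rule integral_norm_bound)
  also have "\<dots> = 1" by (simp add: prob_space)
  finally have "0 \<le> u * (u * v - c\<^sup>2)"
    unfolding ch by (simp add: power2_eq_square algebra_simps)
  then show ?thesis using u by (simp add: zero_le_mult_iff)
qed

text \<open>In the orthonormal coordinates \<open>U\<close>, \<open>V\<close> that Gram--Schmidt makes from \<open>X\<close> and \<open>Y\<close>, the event says that
\<open>(U, V)\<close> lies in a double cone whose opening is the angle between \<open>X\<close> and \<open>Y\<close>. When \<open>X\<close> and \<open>Y\<close> are
collinear the coordinate \<open>V\<close> does not exist, and the angle is \<open>0\<close> or \<open>pi\<close>.\<close>

lemma (in prob_space) gaussian_pair_sign_change:
  fixes X Y :: "'a \<Rightarrow> real"
  assumes [measurable]: "X \<in> borel_measurable M" "Y \<in> borel_measurable M" and u: "u > 0" and v: "v > 0"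
    and ch: "\<And>a b. (CLINT \<omega>|M. iexp (a * X \<omega> + b * Y \<omega>)) = of_real (exp (- (a\<^sup>2 * u + 2 * a * b * c + b\<^sup>2 * v) / 2))"
  shows "prob {\<omega>\<in>space M. X \<omega> * Y \<omega> < 0} = arccos (c / sqrt (u * v)) / pi"
proof (cases "c\<^sup>2 = u * v")
  case True
  have chX: "(CLINT \<omega>|M. iexp (a * X \<omega>)) = of_real (exp (- (a\<^sup>2 * u) / 2))" for a
    using ch[of a 0] by simp
  have X0: "AE \<omega> in M. X \<omega> \<noteq> 0"
  proof -
    have "prob {\<omega>\<in>space M. \<bar>X \<omega>\<bar> \<le> 0} \<le> 0 / sqrt u" by (rule gaussian_small_ball[OF _ u _ chX]) auto
    then have "prob {\<omega>\<in>space M. X \<omega> = 0} = 0" by (simp add: measure_le_0_iff)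
    then show ?thesis by (subst (asm) prob_eq_0) auto
  qed
  have "AE \<omega> in M. u * Y \<omega> + (- c) * X \<omega> = 0"
  proof (rule gaussian_zero_variance)
    fix a
    have "(CLINT \<omega>|M. iexp (a * (u * Y \<omega> + (- c) * X \<omega>))) = (CLINT \<omega>|M. iexp ((- a * c) * X \<omega> + (a * u) * Y \<omega>))"
      by (intro Bochner_Integration.integral_cong) (auto simp: algebra_simps)
    also have "\<dots> = of_real (exp (- (a\<^sup>2 * u * (u * v - c\<^sup>2)) / 2))"
      unfolding ch by (simp add: power2_eq_square algebra_simps)
    also have "\<dots> = 1" using True by simp
    finally show "(CLINT \<omega>|M. iexp (a * (u * Y \<omega> + (- c) * X \<omega>))) = 1" .
  qed auto
  with X0 have ae: "AE \<omega> in M. X \<omega> * Y \<omega> < 0 \<longleftrightarrow> c < 0"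
  proof eventually_elim
    case (elim \<omega>)
    then have Y: "Y \<omega> = c / u * X \<omega>" using u by (simp add: field_simps)
    have "X \<omega> * Y \<omega> = c * ((X \<omega>)\<^sup>2 / u)" unfolding Y by (simp add: power2_eq_square)
    moreover have "(X \<omega>)\<^sup>2 / u > 0" using elim u by simp
    ultimately show ?case by (metis mult_less_0_iff not_less_iff_gr_or_eq)
  qed
  have sq: "sqrt (u * v) = \<bar>c\<bar>" using True by (metis real_sqrt_abs)
  have c0: "c \<noteq> 0" using True u v by auto
  have "prob {\<omega>\<in>space M. X \<omega> * Y \<omega> < 0} = prob {\<omega>\<in>space M. c < 0}"
    by (rule prob_eq_AE[OF ae]) auto
  then show ?thesis using c0 by (auto simp: sq prob_space abs_if)
next
  case False
  then have d: "u * v - c\<^sup>2 > 0" using gaussian_pair_cauchy_schwarz[OF assms(1,2) u ch] by simp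
  define g where "g = u * v - c\<^sup>2"
  define U where "U \<omega> = X \<omega> / sqrt u" for \<omega>
  define V where "V \<omega> = (u * Y \<omega> - c * X \<omega>) / sqrt (u * g)" for \<omega>
  have g: "g > 0" using d by (simp add: g_def)
  have [measurable]: "U \<in> borel_measurable M" "V \<in> borel_measurable M" unfolding U_def V_def by measurable
  have chUV: "(CLINT \<omega>|M. iexp (a * U \<omega> + b * V \<omega>)) = of_real (exp (- a\<^sup>2 / 2)) * of_real (exp (- b\<^sup>2 / 2))" for a b
  proof -
    define a' where "a' = a / sqrt u - b * c / sqrt (u * g)"
    define b' where "b' = b * u / sqrt (u * g)"
    have "(CLINT \<omega>|M. iexp (a * U \<omega> + b * V \<omega>)) = (CLINT \<omega>|M. iexp (a' * X \<omega> + b' * Y \<omega>))"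
    proof (intro Bochner_Integration.integral_cong refl)
      fix \<omega>
      have "a * U \<omega> + b * V \<omega> = a' * X \<omega> + b' * Y \<omega>"
        unfolding U_def V_def a'_def b'_def by (simp add: algebra_simps diff_divide_distrib)
      then show "iexp (a * U \<omega> + b * V \<omega>) = iexp (a' * X \<omega> + b' * Y \<omega>)" by simp
    qed
    also have "\<dots> = of_real (exp (- (a'\<^sup>2 * u + 2 * a' * b' * c + b'\<^sup>2 * v) / 2))" by (rule ch)
    also have "a'\<^sup>2 * u + 2 * a' * b' * c + b'\<^sup>2 * v = a\<^sup>2 + b\<^sup>2"
    proof -
      define w where "w = b / sqrt (u * g)"
      define z where "z = a / sqrt u"
      have w2: "w\<^sup>2 * (u * g) = b\<^sup>2" and z2: "z\<^sup>2 * u = a\<^sup>2" using u g by (auto simp: w_def z_def power_divide)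
      have "a'\<^sup>2 * u + 2 * a' * b' * c + b'\<^sup>2 * v = z\<^sup>2 * u + w\<^sup>2 * (u * g)"
      proof -
        have ab: "a' = z - c * w" "b' = u * w" by (auto simp: a'_def b'_def w_def z_def)
        show ?thesis unfolding ab by (simp add: power2_eq_square algebra_simps g_def)
      qed
      then show ?thesis using w2 z2 by simp
    qed
    finally show ?thesis by (simp add: exp_add[symmetric] add_divide_distrib flip: of_real_mult)
  qed
  have chU: "(CLINT \<omega>|M. iexp (a * U \<omega>)) = of_real (exp (- a\<^sup>2 / 2))" for a using chUV[of a 0] by simp
  have chV: "(CLINT \<omega>|M. iexp (a * V \<omega>)) = of_real (exp (- a\<^sup>2 / 2))" for a using chUV[of 0 a] by simp
  have dU: "distr M borel U = std_normal_distribution" using gaussian_standardized[of U 1] chU by simp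
  have dV: "distr M borel V = std_normal_distribution" using gaussian_standardized[of V 1] chV by simp
  have rect: "prob {\<omega>\<in>space M. U \<omega> \<in> A \<and> V \<omega> \<in> B} = prob {\<omega>\<in>space M. U \<omega> \<in> A} * prob {\<omega>\<in>space M. V \<omega> \<in> B}"
    if [measurable]: "A \<in> sets borel" "B \<in> sets borel" for A B
  proof -
    define \<phi> where "\<phi> a b = complex_of_real (exp (- a\<^sup>2 / 2))" for a b :: real
    have "prob {\<omega>\<in>space M. (U \<omega> \<in> A \<and> (0::real) \<in> UNIV) \<and> (V \<omega> \<in> B \<and> (0::real) \<in> UNIV)}
       = prob {\<omega>\<in>space M. U \<omega> \<in> A \<and> (0::real) \<in> UNIV} * prob {\<omega>\<in>space M. V \<omega> \<in> B \<and> (0::real) \<in> UNIV}"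
      by (rule pairs_independent_if_char_factorizes[where \<phi>=\<phi> and \<psi>=\<phi>]) (use chUV in \<open>simp_all add: \<phi>_def\<close>)
    then show ?thesis by simp
  qed
  interpret N: prob_space std_normal_distribution by (rule prob_space_normal_density) simp
  have joint: "std_normal_distribution \<Otimes>\<^sub>M std_normal_distribution = distr M (borel \<Otimes>\<^sub>M borel) (\<lambda>\<omega>. (U \<omega>, V \<omega>))"
  proof (rule pair_measure_eqI)
    show "sigma_finite_measure std_normal_distribution" by unfold_locales
    show "sigma_finite_measure std_normal_distribution" by unfold_locales
    show "sets (std_normal_distribution \<Otimes>\<^sub>M std_normal_distribution) = sets (distr M (borel \<Otimes>\<^sub>M borel) (\<lambda>\<omega>. (U \<omega>, V \<omega>)))"
      by (simp cong: sets_pair_measure_cong)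
    fix A B assume "A \<in> sets std_normal_distribution" "B \<in> sets std_normal_distribution"
    then have [measurable]: "A \<in> sets borel" "B \<in> sets borel" by auto
    have "emeasure std_normal_distribution A = prob {\<omega>\<in>space M. U \<omega> \<in> A}"
      unfolding dU[symmetric] by (subst emeasure_distr) (auto simp: emeasure_eq_measure vimage_def Int_def conj_commute)
    moreover have "emeasure std_normal_distribution B = prob {\<omega>\<in>space M. V \<omega> \<in> B}"
      unfolding dV[symmetric] by (subst emeasure_distr) (auto simp: emeasure_eq_measure vimage_def Int_def conj_commute)
    moreover have "emeasure (distr M (borel \<Otimes>\<^sub>M borel) (\<lambda>\<omega>. (U \<omega>, V \<omega>))) (A \<times> B) = prob {\<omega>\<in>space M. U \<omega> \<in> A \<and> V \<omega> \<in> B}"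
      by (subst emeasure_distr) (auto simp: emeasure_eq_measure vimage_def Int_def conj_commute)
    ultimately show "emeasure std_normal_distribution A * emeasure std_normal_distribution B = emeasure (distr M (borel \<Otimes>\<^sub>M borel) (\<lambda>\<omega>. (U \<omega>, V \<omega>))) (A \<times> B)"
      using rect[of A B] by (simp add: ennreal_mult)
  qed
  define k where "k = c / sqrt g"
  define H where "H = {p::real\<times>real. fst p * (k * fst p + snd p) < 0}"
  have [measurable]: "H \<in> sets (borel \<Otimes>\<^sub>M borel)"
  proof -
    have "{p \<in> space (borel \<Otimes>\<^sub>M borel). fst p * (k * fst p + snd p) < (0::real)} \<in> sets (borel \<Otimes>\<^sub>M borel)" by measurable
    then show ?thesis by (simp add: H_def space_pair_measure)
  qed
  have iff: "X \<omega> * Y \<omega> < 0 \<longleftrightarrow> (U \<omega>, V \<omega>) \<in> H" for \<omega>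
  proof -
    have X: "X \<omega> = sqrt u * U \<omega>" using u by (simp add: U_def)
    have Y: "Y \<omega> = sqrt g / sqrt u * (k * U \<omega> + V \<omega>)"
    proof -
      have "sqrt g / sqrt u * V \<omega> = (u * Y \<omega> - c * X \<omega>) / u" using u g by (simp add: V_def real_sqrt_mult)
      moreover have "sqrt g / sqrt u * (k * U \<omega>) = c * X \<omega> / u" using u g by (simp add: U_def k_def)
      ultimately show ?thesis using u by (simp add: distrib_left diff_divide_distrib)
    qed
    have "X \<omega> * Y \<omega> = sqrt g * (U \<omega> * (k * U \<omega> + V \<omega>))" unfolding Y unfolding X using u by (simp add: algebra_simps)
    then show ?thesis using g by (simp add: H_def mult_less_0_iff)
  qed
  have "ennreal (prob {\<omega>\<in>space M. X \<omega> * Y \<omega> < 0}) = emeasure (distr M (borel \<Otimes>\<^sub>M borel) (\<lambda>\<omega>. (U \<omega>, V \<omega>))) H"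
    by (subst emeasure_distr) (auto simp: iff emeasure_eq_measure vimage_def Int_def conj_commute)
  also have "\<dots> = emeasure (std_normal_distribution \<Otimes>\<^sub>M std_normal_distribution) H" unfolding joint ..
  also have "\<dots> = (\<integral>\<^sup>+x. \<integral>\<^sup>+y. indicator H (x, y) \<partial>std_normal_distribution \<partial>std_normal_distribution)"
    by (rule N.emeasure_pair_measure) (simp cong: sets_pair_measure_cong)
  also have "\<dots> = (\<integral>\<^sup>+x. ennreal (std_normal_density x) * (\<integral>\<^sup>+y. indicator H (x, y) \<partial>std_normal_distribution) \<partial>lborel)"
    by (subst nn_integral_density) (auto intro!: N.borel_measurable_nn_integral)
  also have "\<dots> = (\<integral>\<^sup>+x. ennreal (std_normal_density x) * (\<integral>\<^sup>+y. ennreal (std_normal_density y) * indicator H (x, y) \<partial>lborel) \<partial>lborel)"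
    by (subst nn_integral_density) auto
  also have "\<dots> = (\<integral>\<^sup>+x. \<integral>\<^sup>+y. ennreal (std_normal_density x) * ennreal (std_normal_density y) * indicator H (x, y) \<partial>lborel \<partial>lborel)"
    by (subst nn_integral_cmult[symmetric]) (auto simp: mult.assoc)
  also have "\<dots> = ennreal ((pi / 2 - arctan k) / pi)" unfolding H_def by (rule gaussian_half_planes)
  finally have "prob {\<omega>\<in>space M. X \<omega> * Y \<omega> < 0} = (pi / 2 - arctan k) / pi"
    using arctan_ubound[of k] by (subst (asm) ennreal_inj) auto
  also have "pi / 2 - arctan k = arccos (c / sqrt (u * v))"
  proof -
    define r where "r = c / sqrt (u * v)"
    have r2: "r\<^sup>2 = c\<^sup>2 / (u * v)" using u v by (simp add: r_def power_divide)
    have "r\<^sup>2 < 1" unfolding r2 using u v g by (simp add: g_def)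
    then have r1: "-1 < r" "r < 1" by (auto simp: power2_less_1_iff abs_square_less_1 abs_less_iff)
    have "1 - r\<^sup>2 = g / (u * v)" unfolding r2 using u v by (simp add: g_def field_simps)
    then have "r / sqrt (1 - r\<^sup>2) = k" using u v g by (simp add: r_def k_def real_sqrt_divide)
    then show ?thesis using arccos_arctan[OF r1] by (simp add: r_def)
  qed
  finally show ?thesis .
qed

section \<open>Wiener integrals of smooth kernels\<close>

lemma measurable_completion_AE_eq:
  assumes f: "f \<in> completion M \<rightarrow>\<^sub>M N" and ae: "AE x in completion M. f x = g x"
    and g: "\<And>x. x \<in> space M \<Longrightarrow> g x \<in> space N"
  shows "g \<in> completion M \<rightarrow>\<^sub>M N"
proof (rule measurableI)
  fix A assume A: "A \<in> sets N"
  show "g -` A \<inter> space (completion M) \<in> sets (completion M)"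
  proof (rule completion.in_sets_AE)
    show "AE x in completion M. (x \<in> f -` A \<inter> space (completion M)) = (x \<in> g -` A \<inter> space (completion M))"
      using ae by eventually_elim auto
  qed (use measurable_sets[OF f A] in auto)
qed (use g in auto)

text \<open>On each cell the mean value theorem compares \<open>b (\<xi> n i) * g\<close> with the primitive of \<open>b * g'\<close>; the error is
bounded by the oscillation of \<open>b\<close> over the cell times the length of the cell.\<close>

lemma riemann_stieltjes_sums:
  fixes b g g' :: "real \<Rightarrow> real" and \<xi> :: "nat \<Rightarrow> nat \<Rightarrow> real"
  assumes cb: "continuous_on {0..1} b" and cg: "continuous_on {0..1} g" and cg': "continuous_on {0..1} g'"
    and der: "\<And>z. 0 < z \<Longrightarrow> z < 1 \<Longrightarrow> (g has_real_derivative g' z) (at z)"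
    and tag: "\<And>n i. i < n \<Longrightarrow> \<xi> n i \<in> {real i / n .. real (Suc i) / n}"
  shows "(\<lambda>n. \<Sum>i<n. b (\<xi> n i) * (g (real (Suc i) / n) - g (real i / n))) \<longlonglongrightarrow> integral {0..1} (\<lambda>z. b z * g' z)"
proof (rule LIMSEQ_I)
  fix e :: real assume e: "e > 0"
  have "compact (g' ` {0..1})" using cg' by (intro compact_continuous_image) auto
  then obtain C where C: "\<And>z. z \<in> {0..1} \<Longrightarrow> \<bar>g' z\<bar> \<le> C" 
    using compact_imp_bounded[of "g' ` {0..1}"] unfolding bounded_iff by fastforce
  have C0: "C \<ge> 0" using C[of 0] by auto
  define e' where "e' = e / (2 * (C + 1))"
  have e': "e' > 0" using e C0 by (auto simp: e'_def)
  have "uniformly_continuous_on {0..1} b" using cb by (intro compact_uniformly_continuous) auto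
  then obtain d where d: "d > 0" "\<And>x y. x \<in> {0..1} \<Longrightarrow> y \<in> {0..1} \<Longrightarrow> \<bar>x - y\<bar> < d \<Longrightarrow> \<bar>b x - b y\<bar> < e'"
    using e' unfolding uniformly_continuous_on_def dist_real_def by metis
  define F where "F z = b z * g' z" for z
  have cF: "continuous_on {0..1} F" unfolding F_def using cb cg' by (intro continuous_intros)
  define I where "I x = integral {0..x} F" for x
  have cI: "continuous_on {0..1} I" unfolding I_def using cF by (intro indefinite_integral_continuous_1 integrable_continuous_real)
  have dI: "(I has_real_derivative F z) (at z)" if "0 < z" "z < 1" for z
  proof -
    have "((\<lambda>x. integral {0..x} F) has_real_derivative F z) (at z within {0..1})"
      by (rule integral_has_real_derivative[OF cF]) (use that in auto)
    then have "((\<lambda>x. integral {0..x} F) has_real_derivative F z) (at z within {0<..<1})" by (rule DERIV_subset) auto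
    then show ?thesis unfolding I_def[abs_def] using that by (subst (asm) at_within_open) auto
  qed
  obtain N :: nat where N: "real N > 1 / d" using reals_Archimedean2 by blast
  show "\<exists>no. \<forall>n\<ge>no. norm ((\<Sum>i<n. b (\<xi> n i) * (g (real (Suc i) / n) - g (real i / n))) - integral {0..1} (\<lambda>z. b z * g' z)) < e"
  proof (intro exI allI impI)
    fix n assume n: "n \<ge> Suc N"
    then have n0: "n > 0" by auto
    have nd: "1 / n < d"
    proof -
      have "1 / d < n" using N n by linarith
      then show ?thesis using d n0 by (simp add: field_simps)
    qed
    have cell: "\<bar>b (\<xi> n i) * (g (real (Suc i) / n) - g (real i / n)) - (I (real (Suc i) / n) - I (real i / n))\<bar> \<le> e' * C * (1 / n)" if i: "i < n" for i
    proof -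
      let ?u = "real i / n" and ?v = "real (Suc i) / n"
      have uv: "0 \<le> ?u" "?v \<le> 1" "?u < ?v" using i n0 by (auto simp: field_simps)
      have vu: "?v - ?u = 1 / n" by (simp add: diff_divide_distrib[symmetric])
      define h where "h z = b (\<xi> n i) * g z - I z" for z
      have dh: "(h has_real_derivative (b (\<xi> n i) * g' z - F z)) (at z)" if "0 < z" "z < 1" for z
        unfolding h_def by (auto intro!: derivative_eq_intros der dI that)
      have "\<exists>l z. ?u < z \<and> z < ?v \<and> (h has_real_derivative l) (at z) \<and> h ?v - h ?u = (?v - ?u) * l"
      proof (rule MVT)
        show "continuous_on {?u..?v} h" unfolding h_def
          by (intro continuous_intros continuous_on_subset[OF cg] continuous_on_subset[OF cI]) (use uv in auto)
        fix z assume "?u < z" "z < ?v"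
        then show "h differentiable at z" using dh[of z] uv by (auto simp: real_differentiable_def intro!: exI)
      qed (use uv in auto)
      then obtain l z where z: "?u < z" "z < ?v" "(h has_real_derivative l) (at z)" "h ?v - h ?u = (?v - ?u) * l" by blast
      have z01: "0 < z" "z < 1" using z(1,2) uv(1,2) by linarith+
      have l: "l = (b (\<xi> n i) - b z) * g' z" using DERIV_unique[OF z(3) dh[OF z01]] by (simp add: F_def algebra_simps)
      have xi: "\<xi> n i \<in> {0..1}" using tag[OF i] uv(1,2) unfolding atLeastAtMost_iff by linarith
      have "\<bar>\<xi> n i - z\<bar> < d" using tag[OF i] z vu nd by auto
      then have "\<bar>b (\<xi> n i) - b z\<bar> < e'" using xi z01 by (intro d) auto
      then have "\<bar>l\<bar> \<le> e' * C" unfolding l abs_mult using C[of z] z01 by (intro mult_mono) auto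
      then have "(1 / n) * \<bar>l\<bar> \<le> (1 / n) * (e' * C)" by (intro mult_left_mono) auto
      moreover have "\<bar>h ?v - h ?u\<bar> = (1 / n) * \<bar>l\<bar>" unfolding z(4) vu by (simp add: abs_mult)
      ultimately show ?thesis by (simp add: h_def algebra_simps)
    qed
    have tel: "(\<Sum>i<n. I (real (Suc i) / n) - I (real i / n)) = integral {0..1} F"
      using sum_lessThan_telescope[of "\<lambda>i. I (real i / n)" n] n0 by (simp add: I_def)
    have "\<bar>(\<Sum>i<n. b (\<xi> n i) * (g (real (Suc i) / n) - g (real i / n))) - integral {0..1} F\<bar>
      = \<bar>\<Sum>i<n. b (\<xi> n i) * (g (real (Suc i) / n) - g (real i / n)) - (I (real (Suc i) / n) - I (real i / n))\<bar>"
      unfolding tel[symmetric] by (simp add: sum_subtractf)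
    also have "\<dots> \<le> (\<Sum>i<n. e' * C * (1 / n))" by (rule order_trans[OF sum_abs]) (intro sum_mono cell, simp)
    also have "\<dots> = e' * C" using n0 by simp
    also have "e' * C \<le> e' * (C + 1)" using e' by simp
    also have "\<dots> = e / 2"
    proof -
      have "C + 1 \<noteq> 0" using C0 by simp
      then show ?thesis unfolding e'_def by (metis divide_divide_eq_left nonzero_eq_divide_eq times_divide_eq_left mult.commute)
    qed
    also have "\<dots> < e" using e by simp
    finally show "norm ((\<Sum>i<n. b (\<xi> n i) * (g (real (Suc i) / n) - g (real i / n))) - integral {0..1} (\<lambda>z. b z * g' z)) < e"
      by (simp add: F_def[abs_def])
  qed
qed

text \<open>The path is run backwards in time, as in the Conga line. If \<open>w 0 = 0\<close> and \<open>g 0 = 0\<close>, it is by integration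
by parts the Wiener integral of \<open>- g\<close> against \<open>z \<mapsto> w (1 - z)\<close>, but it makes sense for every continuous
path.\<close>

definition wiener_int :: "(real \<Rightarrow> real) \<Rightarrow> (real \<Rightarrow> real) \<Rightarrow> real" where
  "wiener_int w g' = integral {0..1} (\<lambda>z. w (1 - z) * g' z)"

definition smooth_kernel :: "(real \<Rightarrow> real) \<Rightarrow> (real \<Rightarrow> real) \<Rightarrow> bool" where
  "smooth_kernel g g' \<longleftrightarrow> continuous_on {0..1} g \<and> continuous_on {0..1} g' \<and> g 0 = 0 \<and>
     (\<forall>z. 0 < z \<longrightarrow> z < 1 \<longrightarrow> (g has_real_derivative g' z) (at z))"

lemma smooth_kernel_cmult: "smooth_kernel g g' \<Longrightarrow> smooth_kernel (\<lambda>z. c * g z) (\<lambda>z. c * g' z)"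
  by (auto simp: smooth_kernel_def intro!: continuous_intros derivative_eq_intros)

lemma smooth_kernel_add: "smooth_kernel g g' \<Longrightarrow> smooth_kernel h h' \<Longrightarrow> smooth_kernel (\<lambda>z. g z + h z) (\<lambda>z. g' z + h' z)"
  by (auto simp: smooth_kernel_def intro!: continuous_intros derivative_eq_intros)

lemma continuous_on_reverse: 
  fixes w :: "real \<Rightarrow> real"
  assumes "continuous_on {0..1} w" shows "continuous_on {0..1} (\<lambda>z. w (1 - z))"
  by (rule continuous_on_compose2[OF assms]) (auto intro!: continuous_intros)

lemma wiener_int_integrable:
  assumes "continuous_on {0..1} w" "smooth_kernel g g'"
  shows "(\<lambda>z. w (1 - z) * g' z) integrable_on {0..1}"
  using assms continuous_on_reverse[OF assms(1)]
  by (intro integrable_continuous_real continuous_intros) (auto simp: smooth_kernel_def)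

lemma wiener_int_cmult: "wiener_int w (\<lambda>z. c * g' z) = c * wiener_int w g'"
  unfolding wiener_int_def by (subst integral_mult_right[symmetric]) (simp add: mult_ac)

lemma wiener_int_add:
  assumes "continuous_on {0..1} w" "smooth_kernel g g'" "smooth_kernel h h'"
  shows "wiener_int w (\<lambda>z. g' z + h' z) = wiener_int w g' + wiener_int w h'"
  unfolding wiener_int_def distrib_left
  by (rule integral_add) (use assms wiener_int_integrable in auto)

lemma (in prob_space) char_normal_scaled:
  fixes X :: "'a \<Rightarrow> real"
  assumes X: "distributed M lborel X (normal_density 0 s)" and s: "s > 0"
  shows "char (distr M borel (\<lambda>\<omega>. c * X \<omega>)) t = of_real (exp (- (t * c * s)\<^sup>2 / 2))"
proof -
  have [measurable]: "X \<in> borel_measurable M" using distributed_measurable[OF X] by simp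
  have "distributed M lborel (\<lambda>x. (X x - 0) / s) std_normal_density"
    using X s by (subst normal_standard_normal_convert[symmetric]) auto
  then have d: "distr M lborel (\<lambda>x. X x / s) = std_normal_distribution"
    unfolding distributed_def by simp
  have "distr M borel (\<lambda>x. X x / s) = distr M lborel (\<lambda>x. X x / s)" by (rule distr_cong) auto
  with d have d': "distr M borel (\<lambda>x. X x / s) = std_normal_distribution" by simp
  have e: "t * (c * X \<omega>) = (t * c * s) * (X \<omega> / s)" for \<omega> using s by simp
  have "char (distr M borel (\<lambda>\<omega>. c * X \<omega>)) t = (CLINT \<omega>|M. iexp (t * (c * X \<omega>)))"
    unfolding char_def by (subst integral_distr) auto
  also have "\<dots> = (CLINT \<omega>|M. iexp ((t * c * s) * (X \<omega> / s)))" unfolding e ..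
  also have "\<dots> = char (distr M borel (\<lambda>x. X x / s)) (t * c * s)"
    unfolding char_def by (subst integral_distr) auto
  finally show ?thesis unfolding d' char_std_normal_distribution by simp
qed

context brownian_motion_01 begin

text \<open>The equidistant times are cut off at 1 to obtain a monotone sequence of times in the unit interval.\<close>

lemma increments_char:
  assumes n: "n > 0"
  shows "(CLINT \<omega>|M. iexp (\<Sum>j<n. c j * (W (real (Suc j) / n) \<omega> - W (real j / n) \<omega>))) = of_real (exp (- (\<Sum>j<n. (c j)\<^sup>2) / n / 2))"
proof -
  define \<tau> where "\<tau> i = min 1 (real i / n)" for i
  have m: "mono \<tau>" unfolding \<tau>_def by (intro monoI min.mono divide_right_mono) auto
  have r: "range \<tau> \<subseteq> {0..1}" by (auto simp: \<tau>_def)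
  have tau: "\<tau> i = real i / n" if "i \<le> n" for i using that n by (auto simp: \<tau>_def field_simps)
  have ind: "indep_vars (\<lambda>_. borel) (\<lambda>i \<omega>. W (\<tau> (Suc i)) \<omega> - W (\<tau> i) \<omega>) {..<n}"
    by (rule BM_indep_increments[OF m r])
  have ind': "indep_vars (\<lambda>_. borel) (\<lambda>i \<omega>. c i * (W (\<tau> (Suc i)) \<omega> - W (\<tau> i) \<omega>)) {..<n}"
    by (rule indep_vars_compose2[OF ind, where Y="\<lambda>i x. c i * x"]) auto
  have [measurable]: "(\<lambda>\<omega>. c j * (W (\<tau> (Suc j)) \<omega> - W (\<tau> j) \<omega>)) \<in> borel_measurable M" for j
    by (intro borel_measurable_times borel_measurable_diff BM_measurable borel_measurable_const) (use r in blast)+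
  have "(CLINT \<omega>|M. iexp (\<Sum>j<n. c j * (W (real (Suc j) / n) \<omega> - W (real j / n) \<omega>)))
    = (CLINT \<omega>|M. iexp (1 * (\<Sum>j<n. c j * (W (\<tau> (Suc j)) \<omega> - W (\<tau> j) \<omega>))))"
    by (intro Bochner_Integration.integral_cong) (auto simp: tau)
  also have "\<dots> = char (distr M borel (\<lambda>\<omega>. \<Sum>j<n. c j * (W (\<tau> (Suc j)) \<omega> - W (\<tau> j) \<omega>))) 1"
    unfolding char_def by (subst integral_distr) auto
  also have "\<dots> = (\<Prod>j<n. char (distr M borel (\<lambda>\<omega>. c j * (W (\<tau> (Suc j)) \<omega> - W (\<tau> j) \<omega>))) 1)"
    by (rule char_distr_sum[OF ind'])
  also have "\<dots> = (\<Prod>j<n. of_real (exp (- (c j)\<^sup>2 / n / 2)))"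
  proof (intro prod.cong refl)
    fix j assume "j \<in> {..<n}"
    then have j: "j < n" by simp
    have lt: "\<tau> j < \<tau> (Suc j)" using j n by (auto simp: tau field_simps)
    have "distributed M lborel (\<lambda>\<omega>. W (\<tau> (Suc j)) \<omega> - W (\<tau> j) \<omega>) (normal_density 0 (sqrt (\<tau> (Suc j) - \<tau> j)))"
      using r lt by (intro BM_gaussian_increments) (auto simp: image_subset_iff)
    then have "char (distr M borel (\<lambda>\<omega>. c j * (W (\<tau> (Suc j)) \<omega> - W (\<tau> j) \<omega>))) 1 = of_real (exp (- (1 * c j * sqrt (\<tau> (Suc j) - \<tau> j))\<^sup>2 / 2))"
      by (rule char_normal_scaled) (use lt in auto)
    also have "(1 * c j * sqrt (\<tau> (Suc j) - \<tau> j))\<^sup>2 = (c j)\<^sup>2 / n"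
      using lt j by (simp add: power_mult_distrib tau diff_divide_distrib[symmetric])
    finally show "char (distr M borel (\<lambda>\<omega>. c j * (W (\<tau> (Suc j)) \<omega> - W (\<tau> j) \<omega>))) 1 = of_real (exp (- (c j)\<^sup>2 / n / 2))" by simp
  qed
  also have "\<dots> = of_real (\<Prod>j<n. exp (- (c j)\<^sup>2 / n / 2))" by simp
  also have "(\<Prod>j<n. exp (- (c j)\<^sup>2 / n / 2)) = exp (- (\<Sum>j<n. (c j)\<^sup>2) / n / 2)"
    by (simp add: exp_sum[symmetric] sum_negf sum_divide_distrib)
  finally show ?thesis .
qed

text \<open>A discretized Wiener integral. The index \<open>n - 1 - j\<close> undoes the time reversal, so that the increments of
\<open>W\<close> appear in forward order.\<close>

definition wiener_sum :: "(real \<Rightarrow> real) \<Rightarrow> nat \<Rightarrow> 'a \<Rightarrow> real" where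
  "wiener_sum g n \<omega> = (\<Sum>j<n. g (real (n - 1 - j) / n) * (W (real (Suc j) / n) \<omega> - W (real j / n) \<omega>))"

lemma wiener_sum_measurable: "wiener_sum g n \<in> borel_measurable M"
  unfolding wiener_sum_def[abs_def]
  by (intro borel_measurable_sum borel_measurable_times borel_measurable_diff BM_measurable) (auto simp: field_simps)

lemma wiener_sum_by_parts:
  assumes W0: "W 0 \<omega> = 0" and g0: "g 0 = 0" and n: "n > 0"
  shows "wiener_sum g n \<omega> = (\<Sum>i<n. W (1 - real (Suc i) / n) \<omega> * (g (real (Suc i) / n) - g (real i / n)))"
proof -
  let ?b = "\<lambda>i. W (1 - real i / n) \<omega>" and ?g = "\<lambda>i. g (real i / n)"
  have "wiener_sum g n \<omega> = (\<Sum>i<n. g (real (n - 1 - (n - Suc i)) / n) * (W (real (Suc (n - Suc i)) / n) \<omega> - W (real (n - Suc i) / n) \<omega>))"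
    unfolding wiener_sum_def by (rule sum.nat_diff_reindex[symmetric])
  also have "\<dots> = (\<Sum>i<n. ?g i * (?b i - ?b (Suc i)))"
  proof (intro sum.cong refl)
    fix i assume "i \<in> {..<n}"
    then have i: "i < n" by simp
    have "real (n - 1 - (n - Suc i)) = real i" "real (Suc (n - Suc i)) / n = 1 - real i / n" "real (n - Suc i) / n = 1 - real (Suc i) / n"
      using i by (auto simp: field_simps of_nat_diff)
    then show "g (real (n - 1 - (n - Suc i)) / n) * (W (real (Suc (n - Suc i)) / n) \<omega> - W (real (n - Suc i) / n) \<omega>) = ?g i * (?b i - ?b (Suc i))"
      by simp
  qed
  also have "\<dots> = (\<Sum>i<n. ?b (Suc i) * (?g (Suc i) - ?g i) - (?b (Suc i) * ?g (Suc i) - ?b i * ?g i))"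
    by (intro sum.cong refl) (simp add: algebra_simps)
  also have "\<dots> = (\<Sum>i<n. ?b (Suc i) * (?g (Suc i) - ?g i)) - (?b n * ?g n - ?b 0 * ?g 0)"
    by (subst sum_subtractf, subst sum_lessThan_telescope[of "\<lambda>i. ?b i * ?g i" n]) (rule refl)
  also have "?b n * ?g n - ?b 0 * ?g 0 = 0" using n W0 g0 by simp
  finally show ?thesis by simp
qed

lemma wiener_sum_tendsto:
  assumes W0: "W 0 \<omega> = 0" and cW: "continuous_on {0..1} (\<lambda>s. W s \<omega>)" and g: "smooth_kernel g g'"
  shows "(\<lambda>n. wiener_sum g n \<omega>) \<longlonglongrightarrow> wiener_int (\<lambda>s. W s \<omega>) g'"
proof -
  have "(\<lambda>n. \<Sum>i<n. W (1 - real (Suc i) / n) \<omega> * (g (real (Suc i) / n) - g (real i / n))) \<longlonglongrightarrow> integral {0..1} (\<lambda>z. W (1 - z) \<omega> * g' z)"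
    by (rule riemann_stieltjes_sums[where b="\<lambda>z. W (1 - z) \<omega>" and \<xi>="\<lambda>n i. real (Suc i) / n"])
      (use g continuous_on_reverse[OF cW] in \<open>auto simp: smooth_kernel_def divide_right_mono\<close>)
  then show ?thesis unfolding wiener_int_def
  proof (rule Lim_transform_eventually)
    show "\<forall>\<^sub>F n in sequentially. (\<Sum>i<n. W (1 - real (Suc i) / n) \<omega> * (g (real (Suc i) / n) - g (real i / n))) = wiener_sum g n \<omega>"
      using eventually_gt_at_top[of 0] by eventually_elim (use wiener_sum_by_parts[OF W0] g in \<open>auto simp: smooth_kernel_def\<close>)
  qed
qed

lemma AE_wiener_sum_tendsto:
  assumes g: "smooth_kernel g g'"
  shows "AE \<omega> in M. (\<lambda>n. wiener_sum g n \<omega>) \<longlonglongrightarrow> wiener_int (\<lambda>s. W s \<omega>) g'"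
  using BM_zero BM_continuous by eventually_elim (rule wiener_sum_tendsto[OF _ _ g])

lemma wiener_int_measurable:
  assumes g: "smooth_kernel g g'"
  shows "(\<lambda>\<omega>. wiener_int (\<lambda>s. W s \<omega>) g') \<in> borel_measurable (completion M)"
proof -
  have m: "(\<lambda>\<omega>. lim (\<lambda>n. wiener_sum g n \<omega>)) \<in> borel_measurable M"
    using wiener_sum_measurable by (intro borel_measurable_lim_metric) auto
  have ae: "AE \<omega> in M. lim (\<lambda>n. wiener_sum g n \<omega>) = wiener_int (\<lambda>s. W s \<omega>) g'"
    using AE_wiener_sum_tendsto[OF g] by eventually_elim (rule limI)
  show ?thesis by (rule measurable_completion_AE_eq[OF measurable_completion[OF m] AE_completion[OF ae]]) simp
qed

text \<open>The discretized integrals are linear combinations of independent Gaussian increments, and their variances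
are Riemann sums of \<open>g\<^sup>2\<close>.\<close>

lemma wiener_int_char:
  assumes g: "smooth_kernel g g'"
  shows "(CLINT \<omega>|completion M. iexp (wiener_int (\<lambda>s. W s \<omega>) g')) = of_real (exp (- (integral {0..1} (\<lambda>z. (g z)\<^sup>2)) / 2))"
proof -
  note wiener_int_measurable[OF g, measurable] wiener_sum_measurable[THEN measurable_completion, measurable]
  have 1: "(\<lambda>n. CLINT \<omega>|completion M. iexp (wiener_sum g n \<omega>)) \<longlonglongrightarrow> (CLINT \<omega>|completion M. iexp (wiener_int (\<lambda>s. W s \<omega>) g'))"
  proof (rule integral_dominated_convergence[where w="\<lambda>_. 1"])
    show "AE \<omega> in completion M. (\<lambda>n. iexp (wiener_sum g n \<omega>)) \<longlonglongrightarrow> iexp (wiener_int (\<lambda>s. W s \<omega>) g')"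
      using AE_wiener_sum_tendsto[OF g, THEN AE_completion] by eventually_elim (intro tendsto_intros)
    interpret C: prob_space "completion M" by (rule prob_space_completion)
    show "integrable (completion M) (\<lambda>_. 1 :: real)" by simp
  qed auto
  have 2: "(CLINT \<omega>|completion M. iexp (wiener_sum g n \<omega>)) = of_real (exp (- (\<Sum>i<n. (g (real i / n))\<^sup>2 * (real (Suc i) / n - real i / n)) / 2))" if n: "n > 0" for n
  proof -
    have "(CLINT \<omega>|completion M. iexp (wiener_sum g n \<omega>)) = (CLINT \<omega>|M. iexp (wiener_sum g n \<omega>))"
      by (rule integral_completion) (use wiener_sum_measurable in measurable)
    also have "\<dots> = of_real (exp (- (\<Sum>j<n. (g (real (n - 1 - j) / n))\<^sup>2) / n / 2))"
      unfolding wiener_sum_def by (rule increments_char[OF n])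
    also have "(\<Sum>j<n. (g (real (n - 1 - j) / n))\<^sup>2) = (\<Sum>i<n. (g (real i / n))\<^sup>2)"
    proof -
      have "n - 1 - j = n - Suc j" for j by simp
      then show ?thesis using sum.nat_diff_reindex[of "\<lambda>i. (g (real i / n))\<^sup>2" n] by presburger
    qed
    also have "- (\<Sum>i<n. (g (real i / n))\<^sup>2) / n = - (\<Sum>i<n. (g (real i / n))\<^sup>2 * (real (Suc i) / n - real i / n))"
      by (simp add: sum_divide_distrib diff_divide_distrib[symmetric])
    finally show ?thesis by simp
  qed
  have 3: "(\<lambda>n. \<Sum>i<n. (g (real i / n))\<^sup>2 * (real (Suc i) / n - real i / n)) \<longlonglongrightarrow> integral {0..1} (\<lambda>z. (g z)\<^sup>2 * 1)"
    by (rule riemann_stieltjes_sums[where b="\<lambda>z. (g z)\<^sup>2" and g="\<lambda>z. z" and \<xi>="\<lambda>n i. real i / n"])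
       (use g in \<open>auto simp: smooth_kernel_def divide_right_mono intro!: continuous_intros\<close>)
  have "(\<lambda>n. complex_of_real (exp (- (\<Sum>i<n. (g (real i / n))\<^sup>2 * (real (Suc i) / n - real i / n)) / 2))) \<longlonglongrightarrow> of_real (exp (- (integral {0..1} (\<lambda>z. (g z)\<^sup>2 * 1)) / 2))"
    by (intro tendsto_intros 3) auto
  then have 4: "(\<lambda>n. CLINT \<omega>|completion M. iexp (wiener_sum g n \<omega>)) \<longlonglongrightarrow> of_real (exp (- (integral {0..1} (\<lambda>z. (g z)\<^sup>2 * 1)) / 2))"
  proof (rule Lim_transform_eventually)
    show "\<forall>\<^sub>F n in sequentially. complex_of_real (exp (- (\<Sum>i<n. (g (real i / n))\<^sup>2 * (real (Suc i) / n - real i / n)) / 2)) = (CLINT \<omega>|completion M. iexp (wiener_sum g n \<omega>))"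
      using eventually_gt_at_top[of 0] by eventually_elim (simp add: 2)
  qed
  show ?thesis using LIMSEQ_unique[OF 1 4] by simp
qed

end

section \<open>Laplace transforms over the unit interval\<close>

lemma power_div_fact_le_exp:
  fixes x :: real assumes "x \<ge> 0" shows "x ^ j / fact j \<le> exp x"
proof -
  have "(\<Sum>n\<in>{j}. x ^ n /\<^sub>R fact n) \<le> (\<Sum>n. x ^ n /\<^sub>R fact n)"
    by (rule sum_le_suminf) (use assms summable_exp_generic[of x] in auto)
  then show ?thesis by (simp add: exp_def divide_inverse mult.commute)
qed

lemma inverse_power_exp_bound:
  fixes z k :: real
  assumes "z \<ge> 0" "k > 0"
  shows "(1 / z) ^ j * exp (- (k / z)) \<le> fact j / k ^ j"
proof (cases "z = 0")
  case True then show ?thesis using assms by (cases j) auto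
next
  case False
  then have z: "z > 0" using assms by simp
  have "(k / z) ^ j / fact j \<le> exp (k / z)" by (rule power_div_fact_le_exp) (use assms in auto)
  then have "(k / z) ^ j \<le> fact j * exp (k / z)" by (simp add: divide_le_eq mult.commute)
  then have "(k / z) ^ j * exp (- (k / z)) \<le> fact j" by (simp add: exp_minus divide_le_eq flip: divide_inverse)
  then show ?thesis using assms z by (simp add: power_divide field_simps)
qed

text \<open>Taylor's formula with a remainder that does not grow for negative \<open>y\<close>; this is what keeps the estimates for
Laplace transforms uniform on half-lines.\<close>

lemma exp_second_order:
  fixes y :: real shows "\<bar>exp y - 1 - y\<bar> \<le> y\<^sup>2 / 2 * exp (max y 0)"
proof -
  obtain t where t: "\<bar>t\<bar> \<le> \<bar>y\<bar>" "exp y = (\<Sum>m<2. y ^ m / fact m) + exp t / fact 2 * y ^ 2"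
    using Maclaurin_exp_le[of y 2] by blast
  show ?thesis
  proof (cases "y \<ge> 0")
    case True
    then have "exp t \<le> exp y" using t(1) by simp
    have "exp y - 1 - y = y\<^sup>2 / 2 * exp t" unfolding t(2) by (simp add: numeral_2_eq_2)
    then have "\<bar>exp y - 1 - y\<bar> = y\<^sup>2 / 2 * exp t" by (simp only: abs_mult) simp
    also have "\<dots> \<le> y\<^sup>2 / 2 * exp y" by (intro mult_left_mono) (use \<open>exp t \<le> exp y\<close> in auto)
    finally show ?thesis using True by simp
  next
    case False
    \<comment> \<open>for negative \<open>y\<close> the function \<open>y\<^sup>2/2 - (exp y - 1 - y)\<close> decreases to its value 0 at 0\<close>
    define F where "F x = x\<^sup>2 / 2 - (exp x - 1 - x)" for x :: real
    have "F 0 \<le> F y"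
    proof (rule DERIV_nonpos_imp_nonincreasing[of y 0])
      fix x :: real assume "y \<le> x" "x \<le> 0"
      show "\<exists>l. (F has_real_derivative l) (at x) \<and> l \<le> 0"
      proof (intro exI conjI)
        show "(F has_real_derivative (x - (exp x - 1))) (at x)" unfolding F_def by (auto intro!: derivative_eq_intros)
        show "x - (exp x - 1) \<le> 0" using exp_ge_add_one_self[of x] by linarith
      qed
    qed (use False in auto)
    moreover have "exp y - 1 - y \<ge> 0" using exp_ge_add_one_self[of y] by linarith
    ultimately show ?thesis using False by (simp add: F_def max_def abs_of_nonneg)
  qed
qed

text \<open>In the variable \<open>1 / z\<close> this is a Laplace transform. Its value is unaffected by the point \<open>z = 0\<close>, where the
integrand takes the default value of division by zero.\<close>

definition laplace :: "(real \<Rightarrow> real) \<Rightarrow> real \<Rightarrow> nat \<Rightarrow> real \<Rightarrow> real" where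
  "laplace c \<beta> j p = (LBINT z:{0..1}. c z * ((1 / z) ^ j * exp (- (\<beta> * p / z))))"

lemma unit_interval_bounded:
  fixes c :: "real \<Rightarrow> real"
  assumes "continuous_on {0..1} c"
  obtains C where "C \<ge> 0" "\<And>z. z \<in> {0..1} \<Longrightarrow> \<bar>c z\<bar> \<le> C"
proof -
  have "bounded (c ` {0..1})" using assms by (intro compact_imp_bounded compact_continuous_image) auto
  then obtain C where "\<forall>x\<in>c ` {0..1}. norm x \<le> C" unfolding bounded_iff by blast
  then have "\<bar>c z\<bar> \<le> max C 0" if "z \<in> {0..1}" for z using that by (metis imageI le_max_iff_disj real_norm_def)
  then show ?thesis using that[of "max C 0"] by auto
qed

lemma set_integrable_bounded_unit:
  fixes f :: "real \<Rightarrow> real"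
  assumes m: "set_borel_measurable lborel {0..1} f" and b: "\<And>z. z \<in> {0..1} \<Longrightarrow> \<bar>f z\<bar> \<le> C"
  shows "set_integrable lborel {0..1} f"
  unfolding set_integrable_def
proof (rule Bochner_Integration.integrable_bound)
  show "integrable lborel (\<lambda>z. C * indicator {0..1::real} z)" by simp
  show "(\<lambda>x. indicat_real {0..1} x *\<^sub>R f x) \<in> borel_measurable lborel" using m by (simp add: set_borel_measurable_def)
  show "AE x in lborel. norm (indicat_real {0..1} x *\<^sub>R f x) \<le> norm (C * indicator {0..1::real} x)"
    using b by (intro AE_I2) (fastforce simp: indicator_def)
qed

lemma set_measurable_lap_integrand:
  fixes c f :: "real \<Rightarrow> real"
  assumes c: "continuous_on {0..1} c" and [measurable]: "f \<in> borel_measurable borel"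
  shows "set_borel_measurable lborel {0..1} (\<lambda>z. c z * f z)"
proof -
  have [measurable]: "(\<lambda>z. indicator {0..1} z *\<^sub>R c z) \<in> borel_measurable borel"
    by (rule borel_measurable_continuous_on_indicator[OF _ c]) simp
  have "(\<lambda>z. (indicator {0..1} z *\<^sub>R c z) * f z) \<in> borel_measurable borel" by measurable
  then show ?thesis by (simp add: set_borel_measurable_def mult.assoc)
qed

lemma laplace_integrable:
  fixes c :: "real \<Rightarrow> real"
  assumes c: "continuous_on {0..1} c" and "\<beta> > 0" "p > 0"
  shows "set_integrable lborel {0..1} (\<lambda>z. c z * ((1 / z) ^ j * exp (- (\<beta> * p / z))))"
proof -
  obtain C where C: "C \<ge> 0" "\<And>z. z \<in> {0..1} \<Longrightarrow> \<bar>c z\<bar> \<le> C" using unit_interval_bounded[OF c] by blast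
  show ?thesis
  proof (rule set_integrable_bounded_unit)
    show "set_borel_measurable lborel {0..1} (\<lambda>z. c z * ((1 / z) ^ j * exp (- (\<beta> * p / z))))"
      by (rule set_measurable_lap_integrand[OF c]) measurable
    fix z :: real assume z: "z \<in> {0..1}"
    have "(1 / z) ^ j * exp (- (\<beta> * p / z)) \<le> fact j / (\<beta> * p) ^ j" by (rule inverse_power_exp_bound) (use z assms in auto)
    then show "\<bar>c z * ((1 / z) ^ j * exp (- (\<beta> * p / z)))\<bar> \<le> C * (fact j / (\<beta> * p) ^ j)"
      unfolding abs_mult[of "c z"] using C(2)[OF z] C(1) z by (intro mult_mono) auto
  qed
qed

lemma set_integral_unit_bound:
  fixes f :: "real \<Rightarrow> real"
  assumes "set_integrable lborel {0..1} f" and b: "\<And>z. z \<in> {0..1} \<Longrightarrow> \<bar>f z\<bar> \<le> C"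
  shows "\<bar>LBINT z:{0..1}. f z\<bar> \<le> C"
proof -
  have "\<bar>LBINT z:{0..1}. f z\<bar> \<le> (LBINT z:{0..1}. \<bar>f z\<bar>)"
    using set_integral_norm_bound[OF assms(1)] by simp
  also have "\<dots> \<le> (LBINT z:{0..1::real}. C)"
    using assms by (intro set_integral_mono set_integrable_abs) (auto simp: set_integrable_def)
  also have "\<dots> = C" by (simp add: set_lebesgue_integral_def)
  finally show ?thesis .
qed

lemma laplace_bound:
  assumes c: "continuous_on {0..1} c" and b: "\<beta> > 0" and A: "0 < A" "A \<le> p" 
    and C: "\<And>z. z \<in> {0..1} \<Longrightarrow> \<bar>c z\<bar> \<le> C"
  shows "\<bar>laplace c \<beta> j p\<bar> \<le> C * (fact j / (\<beta> * A) ^ j)"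
  unfolding laplace_def
proof (rule set_integral_unit_bound[OF laplace_integrable])
  have C0: "C \<ge> 0" using C[of 0] by auto
  fix z :: real assume z: "z \<in> {0..1}"
  have "(1 / z) ^ j * exp (- (\<beta> * p / z)) \<le> (1 / z) ^ j * exp (- (\<beta> * A / z))"
    using z A b by (intro mult_left_mono) (auto intro!: divide_right_mono mult_left_mono)
  also have "\<dots> \<le> fact j / (\<beta> * A) ^ j" by (rule inverse_power_exp_bound) (use z assms in auto)
  finally show "\<bar>c z * ((1 / z) ^ j * exp (- (\<beta> * p / z)))\<bar> \<le> C * (fact j / (\<beta> * A) ^ j)"
    unfolding abs_mult[of "c z"] using C[OF z] C0 z by (intro mult_mono) auto
qed (use assms in auto)

text \<open>Differentiation under the integral with a quadratic error: the second order Taylor remainder of the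
exponential is integrable because \<open>(1 / z) ^ j * exp (- k / z)\<close> is bounded.\<close>

lemma laplace_quadratic:
  assumes c: "continuous_on {0..1} c" and b: "\<beta> > 0" and A: "0 < A" "A \<le> p" "A \<le> q" 
    and C: "\<And>z. z \<in> {0..1} \<Longrightarrow> \<bar>c z\<bar> \<le> C"
  shows "\<bar>laplace c \<beta> j q - laplace c \<beta> j p + \<beta> * (q - p) * laplace c \<beta> (Suc j) p\<bar> \<le> C * (\<beta>\<^sup>2 * (fact (j + 2) / (\<beta> * A) ^ (j + 2))) * (q - p)\<^sup>2"
proof -
  have C0: "C \<ge> 0" using C[of 0] by auto
  let ?I = "\<lambda>j p z. c z * ((1 / z) ^ j * exp (- (\<beta> * p / z)))"
  let ?h = "q - p"
  have i1: "set_integrable lborel {0..1} (?I j p)" "set_integrable lborel {0..1} (?I j q)" "set_integrable lborel {0..1} (?I (Suc j) p)"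
    by (rule laplace_integrable[OF c b]; use A in linarith)+
  have i2: "set_integrable lborel {0..1} (\<lambda>z. \<beta> * ?h * ?I (Suc j) p z)" using i1(3) by (rule set_integrable_mult_right)
  have "laplace c \<beta> j q - laplace c \<beta> j p + \<beta> * ?h * laplace c \<beta> (Suc j) p = (LBINT z:{0..1}. ?I j q z - ?I j p z + \<beta> * ?h * ?I (Suc j) p z)"
    unfolding laplace_def using i1 i2 by (simp only: set_integral_add set_integral_diff set_integral_mult_right)
  also have "\<bar>\<dots>\<bar> \<le> C * (\<beta>\<^sup>2 * (fact (j + 2) / (\<beta> * A) ^ (j + 2))) * ?h\<^sup>2"
  proof (rule set_integral_unit_bound)
    show "set_integrable lborel {0..1} (\<lambda>z. ?I j q z - ?I j p z + \<beta> * ?h * ?I (Suc j) p z)"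
      using i1 i2 by (intro set_integral_add set_integral_diff)
    fix z :: real assume z: "z \<in> {0..1}"
    define r where "r = 1 / z"
    have r0: "r \<ge> 0" using z by (simp add: r_def)
    define y where "y = - (\<beta> * ?h * r)"
    have e1: "exp (- (\<beta> * q * r)) = exp (- (\<beta> * p * r)) * exp y" by (simp add: y_def exp_add[symmetric] algebra_simps)
    have "?I j q z - ?I j p z + \<beta> * ?h * ?I (Suc j) p z = c z * r ^ j * exp (- (\<beta> * p * r)) * (exp y - 1 - y)"
    proof -
      have "?I j q z - ?I j p z + \<beta> * ?h * ?I (Suc j) p z = c z * (r ^ j * exp (- (\<beta> * q * r))) - c z * (r ^ j * exp (- (\<beta> * p * r))) + \<beta> * ?h * (c z * (r * r ^ j * exp (- (\<beta> * p * r))))"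
        by (simp add: r_def power_divide)
      then show ?thesis unfolding e1 by (simp add: y_def algebra_simps)
    qed
    also have "\<bar>\<dots>\<bar> = \<bar>c z\<bar> * (r ^ j * (exp (- (\<beta> * p * r)) * \<bar>exp y - 1 - y\<bar>))"
      using r0 by (simp add: abs_mult)
    also have "\<dots> \<le> C * (r ^ j * (?h\<^sup>2 * \<beta>\<^sup>2 * r\<^sup>2 * exp (- (\<beta> * A * r))))"
    proof -
      have "exp (- (\<beta> * p * r)) * \<bar>exp y - 1 - y\<bar> \<le> exp (- (\<beta> * p * r)) * (y\<^sup>2 / 2 * exp (max y 0))"
        by (intro mult_left_mono exp_second_order) auto
      also have "\<dots> = y\<^sup>2 / 2 * exp (max y 0 - \<beta> * p * r)" by (simp add: exp_diff exp_minus field_simps)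
      also have "\<dots> \<le> y\<^sup>2 * exp (- (\<beta> * A * r))"
      proof (intro mult_mono)
        have "max y 0 - \<beta> * p * r = max (- (\<beta> * q * r)) (- (\<beta> * p * r))" by (simp add: y_def max_def algebra_simps)
        also have "\<dots> \<le> - (\<beta> * A * r)" using A b r0 by (auto intro!: mult_right_mono mult_left_mono)
        finally show "exp (max y 0 - \<beta> * p * r) \<le> exp (- (\<beta> * A * r))" by simp
      qed auto
      also have "y\<^sup>2 = ?h\<^sup>2 * \<beta>\<^sup>2 * r\<^sup>2" by (simp add: y_def power_mult_distrib)
      finally have "exp (- (\<beta> * p * r)) * \<bar>exp y - 1 - y\<bar> \<le> ?h\<^sup>2 * \<beta>\<^sup>2 * r\<^sup>2 * exp (- (\<beta> * A * r))" .
      then have "r ^ j * (exp (- (\<beta> * p * r)) * \<bar>exp y - 1 - y\<bar>) \<le> r ^ j * (?h\<^sup>2 * \<beta>\<^sup>2 * r\<^sup>2 * exp (- (\<beta> * A * r)))"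
        using r0 by (intro mult_left_mono) auto
      then show ?thesis by (rule mult_mono[OF C[OF z]]) (use r0 C0 in auto)
    qed
    also have "\<dots> = C * \<beta>\<^sup>2 * ?h\<^sup>2 * (r ^ (j + 2) * exp (- (\<beta> * A * r)))" by (simp add: power_add power2_eq_square mult_ac)
    also have "\<dots> \<le> C * \<beta>\<^sup>2 * ?h\<^sup>2 * (fact (j + 2) / (\<beta> * A) ^ (j + 2))"
      using inverse_power_exp_bound[of z "\<beta> * A" "j + 2"] z A b C0 by (intro mult_left_mono) (auto simp: r_def)
    also have "\<dots> = C * (\<beta>\<^sup>2 * (fact (j + 2) / (\<beta> * A) ^ (j + 2))) * ?h\<^sup>2" by simp
    finally show "\<bar>?I j q z - ?I j p z + \<beta> * ?h * ?I (Suc j) p z\<bar> \<le> C * (\<beta>\<^sup>2 * (fact (j + 2) / (\<beta> * A) ^ (j + 2))) * ?h\<^sup>2" .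
  qed
  finally show ?thesis .
qed

lemma has_real_derivative_quadratic:
  fixes f :: "real \<Rightarrow> real"
  assumes d: "d > 0" and q: "\<And>q. \<bar>q - p\<bar> < d \<Longrightarrow> \<bar>f q - f p - D * (q - p)\<bar> \<le> K * (q - p)\<^sup>2"
  shows "(f has_real_derivative D) (at p)"
proof -
  have "((\<lambda>q. (f q - f p) / (q - p) - D) \<longlongrightarrow> 0) (at p)"
  proof (rule Lim_null_comparison)
    have "\<forall>\<^sub>F q in at p. \<bar>q - p\<bar> < d \<and> q \<noteq> p" unfolding eventually_at using d by (auto simp: dist_real_def)
    then show "\<forall>\<^sub>F q in at p. norm ((f q - f p) / (q - p) - D) \<le> K * \<bar>q - p\<bar>"
    proof eventually_elim
      case (elim q)
      then have "(f q - f p) / (q - p) - D = (f q - f p - D * (q - p)) / (q - p)" by (simp add: field_simps)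
      moreover have "\<bar>f q - f p - D * (q - p)\<bar> / \<bar>q - p\<bar> \<le> K * (q - p)\<^sup>2 / \<bar>q - p\<bar>" using q elim by (intro divide_right_mono) auto
      moreover have "K * (q - p)\<^sup>2 / \<bar>q - p\<bar> = K * \<bar>q - p\<bar>" using elim by (simp add: nonzero_divide_eq_eq power2_eq_square mult.assoc)
      ultimately show ?case by simp
    qed
    show "((\<lambda>q. K * \<bar>q - p\<bar>) \<longlongrightarrow> 0) (at p)" by (auto intro!: tendsto_eq_intros)
  qed
  then have "((\<lambda>q. (f q - f p) / (q - p)) \<longlongrightarrow> D) (at p)" by (rule LIM_zero_cancel)
  then show ?thesis by (simp add: has_field_derivative_iff)
qed

lemma laplace_deriv:
  assumes c: "continuous_on {0..1} c" and b: "\<beta> > 0" and p: "p > 0"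
  shows "(laplace c \<beta> j has_real_derivative (- \<beta> * laplace c \<beta> (Suc j) p)) (at p)"
proof -
  obtain C where C: "\<And>z. z \<in> {0..1} \<Longrightarrow> \<bar>c z\<bar> \<le> C" using unit_interval_bounded[OF c] by blast
  show ?thesis
  proof (rule has_real_derivative_quadratic)
    show "p / 2 > 0" using p by simp
    fix q assume "\<bar>q - p\<bar> < p / 2"
    show "\<bar>laplace c \<beta> j q - laplace c \<beta> j p - - \<beta> * laplace c \<beta> (Suc j) p * (q - p)\<bar> \<le> C * (\<beta>\<^sup>2 * (fact (j + 2) / (\<beta> * (p / 2)) ^ (j + 2))) * (q - p)\<^sup>2"
    proof -
      have "p / 2 \<le> q" using \<open>\<bar>q - p\<bar> < p / 2\<close> by linarith
      have "laplace c \<beta> j q - laplace c \<beta> j p - - \<beta> * laplace c \<beta> (Suc j) p * (q - p) = laplace c \<beta> j q - laplace c \<beta> j p + \<beta> * (q - p) * laplace c \<beta> (Suc j) p" by simp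
      moreover have "\<bar>laplace c \<beta> j q - laplace c \<beta> j p + \<beta> * (q - p) * laplace c \<beta> (Suc j) p\<bar> \<le> C * (\<beta>\<^sup>2 * (fact (j + 2) / (\<beta> * (p / 2)) ^ (j + 2))) * (q - p)\<^sup>2"
        by (rule laplace_quadratic[OF c b]) (use C p \<open>p / 2 \<le> q\<close> in auto)
      ultimately show ?thesis by metis
    qed
  qed
qed

section \<open>The derivative of the Conga line as a Wiener integral\<close>

text \<open>With \<open>\<beta> = 1 / (2 s\<^sup>2)\<close> and \<open>p = x\<^sup>2\<close> this is
\<open>exp (- \<alpha> x / s\<^sup>2) * exp (- (x - \<alpha> z)\<^sup>2 / (2 s\<^sup>2 z)) / sqrt z\<close>: a heat kernel, stripped of a factor that
depends on \<open>x\<close> only. The form \<open>sqrt z * (1 / z)\<close> displays the power of \<open>1 / z\<close> that matters for \<open>laplace\<close>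
and gives the value 0 at \<open>z = 0\<close>.\<close>

definition heat_kernel :: "real \<Rightarrow> real \<Rightarrow> real \<Rightarrow> real \<Rightarrow> real" where
  "heat_kernel \<alpha> \<beta> p z = sqrt z * (1 / z) * exp (- (\<beta> * p / z)) * exp (- (\<beta> * \<alpha>\<^sup>2 * z))"

definition heat_kernel' :: "real \<Rightarrow> real \<Rightarrow> real \<Rightarrow> real \<Rightarrow> real" where
  "heat_kernel' \<alpha> \<beta> p z = heat_kernel \<alpha> \<beta> p z * (\<beta> * p * (1 / z)\<^sup>2 - (1 / z) / 2 - \<beta> * \<alpha>\<^sup>2)"

lemma continuous_on_sqrt_power_exp:
  assumes k: "k > 0"
  shows "continuous_on {0..1} (\<lambda>z::real. sqrt z * ((1 / z) ^ j * exp (- (k / z))))"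
  unfolding continuous_on_eq_continuous_within
proof
  fix z :: real assume z: "z \<in> {0..1}"
  show "continuous (at z within {0..1}) (\<lambda>z. sqrt z * ((1 / z) ^ j * exp (- (k / z))))"
  proof (cases "z = 0")
    case False
    then show ?thesis by (intro continuous_intros) auto
  next
    case True
    have "((\<lambda>z. sqrt z * ((1 / z) ^ j * exp (- (k / z)))) \<longlongrightarrow> 0) (at 0 within {0..1})"
    proof (rule Lim_null_comparison)
      have "((\<lambda>z. sqrt z * (fact j / k ^ j)) \<longlongrightarrow> sqrt 0 * (fact j / k ^ j)) (at 0 within {0..1})"
        by (intro tendsto_intros) 
      then show "((\<lambda>z. sqrt z * (fact j / k ^ j)) \<longlongrightarrow> 0) (at 0 within {0..1})" by simp
      have "\<forall>\<^sub>F z in at 0 within {0..1}. z \<in> {0..1::real}" by (auto simp: eventually_at_filter)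
      then show "\<forall>\<^sub>F z in at 0 within {0..1}. norm (sqrt z * ((1 / z) ^ j * exp (- (k / z)))) \<le> sqrt z * (fact j / k ^ j)"
      proof eventually_elim
        case (elim z)
        then have "sqrt z * ((1 / z) ^ j * exp (- (k / z))) \<le> sqrt z * (fact j / k ^ j)"
          using inverse_power_exp_bound[of z k j] k by (intro mult_left_mono) auto
        then show ?case using elim by (simp add: abs_mult)
      qed
    qed
    then show ?thesis using True by (simp add: continuous_within)
  qed
qed

lemma heat_kernel'_expand:
  "heat_kernel' \<alpha> \<beta> p z = (\<beta> * p * (sqrt z * ((1 / z) ^ 3 * exp (- (\<beta> * p / z)))) - sqrt z * ((1 / z) ^ 2 * exp (- (\<beta> * p / z))) / 2
     - \<beta> * \<alpha>\<^sup>2 * (sqrt z * ((1 / z) ^ 1 * exp (- (\<beta> * p / z))))) * exp (- (\<beta> * \<alpha>\<^sup>2 * z))"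
proof -
  have alg: "s * r * e * f * (b * r\<^sup>2 - r / 2 - a) = (b * (s * (r ^ 3 * e)) - s * (r ^ 2 * e) / 2 - a * (s * (r ^ 1 * e))) * f" for s r e f a b :: real
    by (simp add: algebra_simps power2_eq_square power3_eq_cube)
  show ?thesis unfolding heat_kernel'_def heat_kernel_def by (rule alg)
qed

text \<open>The value of the parameter \<open>\<beta>\<close> that belongs to the scale \<open>s\<close> of the Conga line.\<close>

abbreviation rate :: "real \<Rightarrow> real" where "rate s \<equiv> 1 / (2 * s\<^sup>2)"

lemma smooth_kernel_heat_kernel:
  assumes b: "\<beta> > 0" and p: "p > 0"
  shows "smooth_kernel (heat_kernel \<alpha> \<beta> p) (heat_kernel' \<alpha> \<beta> p)"
proof -
  let ?S = "\<lambda>j z. sqrt z * ((1 / z) ^ j * exp (- (\<beta> * p / z)))"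
  let ?e = "\<lambda>z. exp (- (\<beta> * \<alpha>\<^sup>2 * z))"
  have c: "continuous_on {0..1} (?S j)" for j by (rule continuous_on_sqrt_power_exp) (use b p in simp)
  have e: "continuous_on {0..1} ?e" by (intro continuous_intros)
  have g: "heat_kernel \<alpha> \<beta> p = (\<lambda>z. ?S 1 z * ?e z)" by (simp add: heat_kernel_def fun_eq_iff)
  have g': "heat_kernel' \<alpha> \<beta> p = (\<lambda>z. (\<beta> * p * ?S 3 z - ?S 2 z / 2 - \<beta> * \<alpha>\<^sup>2 * ?S 1 z) * ?e z)"
    by (intro ext heat_kernel'_expand)
  show ?thesis unfolding smooth_kernel_def
  proof (intro conjI allI impI)
    show "continuous_on {0..1} (heat_kernel \<alpha> \<beta> p)" unfolding g by (rule continuous_on_mult[OF c e])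
    show "continuous_on {0..1} (heat_kernel' \<alpha> \<beta> p)" unfolding g'
      by (rule continuous_on_mult[OF continuous_on_diff[OF continuous_on_diff[OF continuous_on_mult_left[OF c] continuous_on_divide[OF c continuous_on_const]] continuous_on_mult_left[OF c]] e]) simp
    show "heat_kernel \<alpha> \<beta> p 0 = 0" by (simp add: heat_kernel_def)
    fix z :: real assume z: "0 < z" "z < 1"
    show "(heat_kernel \<alpha> \<beta> p has_real_derivative heat_kernel' \<alpha> \<beta> p z) (at z)"
    proof -
      have d1: "((\<lambda>z. 1 / z) has_real_derivative - (1 / z\<^sup>2)) (at z)"
        using z by (auto intro!: derivative_eq_intros simp: power2_eq_square)
      have d2: "((\<lambda>z. exp (- (\<beta> * p / z))) has_real_derivative exp (- (\<beta> * p / z)) * (\<beta> * p / z\<^sup>2)) (at z)"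
        using z by (auto intro!: derivative_eq_intros simp: power2_eq_square)
      have d3: "((\<lambda>z. exp (- (\<beta> * \<alpha>\<^sup>2 * z))) has_real_derivative exp (- (\<beta> * \<alpha>\<^sup>2 * z)) * (- (\<beta> * \<alpha>\<^sup>2))) (at z)"
        by (auto intro!: derivative_eq_intros)
      note d = DERIV_mult[OF DERIV_mult[OF DERIV_mult[OF DERIV_real_sqrt[OF z(1)] d1] d2] d3]
      have s: "inverse (sqrt z) = sqrt z * (1 / z)" using z by (simp add: field_simps)
      have r: "1 / z\<^sup>2 = (1 / z)\<^sup>2" "\<beta> * p / z\<^sup>2 = \<beta> * p * (1 / z)\<^sup>2" by (simp_all add: power_divide)
      have alg: "((S * R / 2 * R + - (R\<^sup>2) * S) * E + E * (b * R\<^sup>2) * (S * R)) * F + F * (- a) * (S * R * E)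
        = S * R * E * F * (b * R\<^sup>2 - R / 2 - a)" for S R E F a b :: real
        by (simp add: algebra_simps power2_eq_square)
      show ?thesis unfolding heat_kernel_def[abs_def]
        by (rule DERIV_cong[OF d], unfold s r heat_kernel'_def heat_kernel_def, rule alg)
    qed
  qed
qed

definition path_weight :: "real \<Rightarrow> real \<Rightarrow> (real \<Rightarrow> real) \<Rightarrow> real \<Rightarrow> real" where
  "path_weight \<alpha> \<beta> w z = w (1 - z) * sqrt z * exp (- (\<beta> * \<alpha>\<^sup>2 * z))"

text \<open>A centred Gaussian field whose zeros \<open>p\<close> are the squares of the critical points; see \<open>conga_deriv\<close>.\<close>

definition crit_field :: "real \<Rightarrow> real \<Rightarrow> (real \<Rightarrow> real) \<Rightarrow> real \<Rightarrow> real" where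
  "crit_field \<alpha> \<beta> w p = wiener_int w (heat_kernel' \<alpha> \<beta> p)"

lemma continuous_on_path_weight:
  assumes "continuous_on {0..1} w" shows "continuous_on {0..1} (path_weight \<alpha> \<beta> w)"
  unfolding path_weight_def[abs_def] by (intro continuous_intros continuous_on_reverse assms)

lemma crit_field_eq_laplace:
  assumes w: "continuous_on {0..1} w" and b: "\<beta> > 0" and p: "p > 0"
  shows "crit_field \<alpha> \<beta> w p = \<beta> * p * laplace (path_weight \<alpha> \<beta> w) \<beta> 3 p - laplace (path_weight \<alpha> \<beta> w) \<beta> 2 p / 2 - \<beta> * \<alpha>\<^sup>2 * laplace (path_weight \<alpha> \<beta> w) \<beta> 1 p"
proof -
  let ?c = "path_weight \<alpha> \<beta> w"
  let ?I = "\<lambda>j z. ?c z * ((1 / z) ^ j * exp (- (\<beta> * p / z)))"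
  have i: "set_integrable lborel {0..1} (?I j)" for j by (rule laplace_integrable[OF continuous_on_path_weight[OF w] b p])
  have i3: "set_integrable lborel {0..1} (\<lambda>z. \<beta> * p * ?I 3 z)" by (rule set_integrable_mult_right[OF i])
  have i2: "set_integrable lborel {0..1} (\<lambda>z. ?I 2 z / 2)" by (rule set_integrable_divide[OF i])
  have i1: "set_integrable lborel {0..1} (\<lambda>z. \<beta> * \<alpha>\<^sup>2 * ?I 1 z)" by (rule set_integrable_mult_right[OF i])
  have ii: "set_integrable lborel {0..1} (\<lambda>z. \<beta> * p * ?I 3 z - ?I 2 z / 2 - \<beta> * \<alpha>\<^sup>2 * ?I 1 z)"
    by (intro set_integral_diff i1 i2 i3)
  have "crit_field \<alpha> \<beta> w p = integral {0..1} (\<lambda>z. \<beta> * p * ?I 3 z - ?I 2 z / 2 - \<beta> * \<alpha>\<^sup>2 * ?I 1 z)"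
    unfolding crit_field_def wiener_int_def
  proof (intro integral_cong)
    fix z :: real
    have alg: "w * ((b * (s * A) - s * B / 2 - a * (s * D)) * f) = b * (w * s * f * A) - w * s * f * B / 2 - a * (w * s * f * D)"
      for w s f a b A B D :: real by (simp add: algebra_simps)
    show "w (1 - z) * heat_kernel' \<alpha> \<beta> p z = \<beta> * p * ?I 3 z - ?I 2 z / 2 - \<beta> * \<alpha>\<^sup>2 * ?I 1 z"
      unfolding heat_kernel'_expand path_weight_def by (rule alg)
  qed
  also have "\<dots> = (LBINT z:{0..1}. \<beta> * p * ?I 3 z - ?I 2 z / 2 - \<beta> * \<alpha>\<^sup>2 * ?I 1 z)"
    by (rule set_borel_integral_eq_integral(2)[OF ii, symmetric])
  also have "\<dots> = (LBINT z:{0..1}. \<beta> * p * ?I 3 z) - (LBINT z:{0..1}. ?I 2 z / 2) - (LBINT z:{0..1}. \<beta> * \<alpha>\<^sup>2 * ?I 1 z)"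
    using i1 i2 i3 by (simp only: set_integral_diff)
  also have "\<dots> = \<beta> * p * laplace ?c \<beta> 3 p - laplace ?c \<beta> 2 p / 2 - \<beta> * \<alpha>\<^sup>2 * laplace ?c \<beta> 1 p"
    unfolding laplace_def by (simp only: set_integral_mult_right set_integral_divide_zero)
  finally show ?thesis .
qed

text \<open>Expanding the square in the exponent separates the dependence on \<open>x\<close> and on \<open>z\<close> up to the Laplace factor
\<open>exp (- \<beta> x\<^sup>2 / z)\<close>.\<close>

lemma conga_eq_laplace:
  assumes s: "s = conga_sigma \<alpha> t" "s > 0" and b: "\<beta> = rate s" and w: "continuous_on {0..1} w" and x: "x > 0"
  shows "conga \<alpha> w t x = (1 / (sqrt (2 * pi) * (2 * s))) * exp (2 * \<beta> * \<alpha> * x) * (x * laplace (path_weight \<alpha> \<beta> w) \<beta> 2 (x\<^sup>2) + \<alpha> * laplace (path_weight \<alpha> \<beta> w) \<beta> 1 (x\<^sup>2))"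
proof -
  let ?c = "path_weight \<alpha> \<beta> w"
  let ?I = "\<lambda>j z. ?c z * ((1 / z) ^ j * exp (- (\<beta> * x\<^sup>2 / z)))"
  let ?K = "(1 / (sqrt (2 * pi) * (2 * s))) * exp (2 * \<beta> * \<alpha> * x)"
  have b0: "\<beta> > 0" using b s by simp
  have i: "set_integrable lborel {0..1} (?I j)" for j by (rule laplace_integrable[OF continuous_on_path_weight[OF w] b0]) (use x in simp)
  have i2: "set_integrable lborel {0..1} (\<lambda>z. x * ?I 2 z)" by (rule set_integrable_mult_right[OF i])
  have i1: "set_integrable lborel {0..1} (\<lambda>z. \<alpha> * ?I 1 z)" by (rule set_integrable_mult_right[OF i])
  have "conga \<alpha> w t x = (LBINT z:{0..1}. ?K * (x * ?I 2 z + \<alpha> * ?I 1 z))"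
    unfolding conga_def
  proof (rule set_lebesgue_integral_cong)
    show "\<forall>z. z \<in> {0..1} \<longrightarrow> w (1 - z) * (1 / sqrt (2 * pi)) * ((x + \<alpha> * z) / (2 * conga_sigma \<alpha> t * z powr (3/2)))
        * exp (- ((x - \<alpha> * z)\<^sup>2 / (2 * (conga_sigma \<alpha> t)\<^sup>2 * z))) = ?K * (x * ?I 2 z + \<alpha> * ?I 1 z)"
    proof (intro allI impI)
      fix z :: real assume z: "z \<in> {0..1}"
      show "w (1 - z) * (1 / sqrt (2 * pi)) * ((x + \<alpha> * z) / (2 * conga_sigma \<alpha> t * z powr (3/2)))
        * exp (- ((x - \<alpha> * z)\<^sup>2 / (2 * (conga_sigma \<alpha> t)\<^sup>2 * z))) = ?K * (x * ?I 2 z + \<alpha> * ?I 1 z)"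
      proof (cases "z = 0")
        case True then show ?thesis by simp
      next
        case False
        then have z0: "z > 0" using z by simp
        have e: "- ((x - \<alpha> * z)\<^sup>2 / (2 * s\<^sup>2 * z)) = 2 * \<beta> * \<alpha> * x + (- (\<beta> * \<alpha>\<^sup>2 * z)) + (- (\<beta> * x\<^sup>2 / z))"
          using z0 s unfolding b by (simp add: field_simps power2_eq_square)
        have p: "z powr (3/2) = z * sqrt z"
          using z0 powr_add[of z 1 "1/2"] by (simp add: powr_half_sqrt)
        have q: "1 / (z * sqrt z) = sqrt z * (1 / z)\<^sup>2" using z0 by (simp add: field_simps power2_eq_square)
        have "w (1 - z) * (1 / sqrt (2 * pi)) * ((x + \<alpha> * z) / (2 * s * (z * sqrt z))) = w (1 - z) * (1 / (sqrt (2 * pi) * (2 * s))) * (x + \<alpha> * z) * (1 / (z * sqrt z))"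
          by simp
        also have "\<dots> = w (1 - z) * (1 / (sqrt (2 * pi) * (2 * s))) * (sqrt z * (x * (1/z)^2 + \<alpha> * (1/z)))"
          unfolding q using z0 by (simp add: field_simps power2_eq_square)
        finally have f: "w (1 - z) * (1 / sqrt (2 * pi)) * ((x + \<alpha> * z) / (2 * s * (z * sqrt z)))
          = w (1 - z) * (1 / (sqrt (2 * pi) * (2 * s))) * (sqrt z * (x * (1/z)^2 + \<alpha> * (1/z)^1))" by simp
        have alg: "w' * K * (q * (x * A + \<alpha> * B)) * (e1 * e2 * e3) = K * e1 * (x * (w' * q * e2 * (A * e3)) + \<alpha> * (w' * q * e2 * (B * e3)))"
          for w' K q A B e1 e2 e3 :: real by (simp add: algebra_simps)
        show ?thesis unfolding s(1)[symmetric] p e exp_add f path_weight_def by (rule alg)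
      qed
    qed
  qed simp
  also have "\<dots> = ?K * ((LBINT z:{0..1}. x * ?I 2 z) + (LBINT z:{0..1}. \<alpha> * ?I 1 z))"
    using set_integral_add(2)[OF i2 i1] by (simp only: set_integral_mult_right)
  also have "\<dots> = ?K * (x * laplace ?c \<beta> 2 (x\<^sup>2) + \<alpha> * laplace ?c \<beta> 1 (x\<^sup>2))"
    unfolding laplace_def by (simp only: set_integral_mult_right)
  finally show ?thesis .
qed

text \<open>The \<open>x\<close>-derivative of the kernel of the Conga line is a \<open>z\<close>-derivative, because that kernel is itself a
\<open>z\<close>-derivative of a normal distribution function. So the three Laplace transforms that the product rule
produces are, in the same proportion, those of \<open>crit_field_eq_laplace\<close>.\<close>

lemma conga_deriv:
  assumes s: "s = conga_sigma \<alpha> t" "s > 0" and b: "\<beta> = rate s" and w: "continuous_on {0..1} w" and x: "x > 0"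
  shows "(conga \<alpha> w t has_real_derivative - (2 * (1 / (sqrt (2 * pi) * (2 * s))) * exp (2 * \<beta> * \<alpha> * x) * crit_field \<alpha> \<beta> w (x\<^sup>2))) (at x)"
proof -
  let ?c = "path_weight \<alpha> \<beta> w"
  have b0: "\<beta> > 0" using b s by simp
  let ?K = "1 / (sqrt (2 * pi) * (2 * s))"
  have cc: "continuous_on {0..1} ?c" by (rule continuous_on_path_weight[OF w])
  have dl: "((\<lambda>x. laplace ?c \<beta> j (x\<^sup>2)) has_real_derivative (- \<beta> * laplace ?c \<beta> (Suc j) (x\<^sup>2)) * (2 * x)) (at x)" for j
    by (rule DERIV_chain2[OF laplace_deriv[OF cc b0]]) (use x in \<open>auto intro!: derivative_eq_intros\<close>)
  have dE: "((\<lambda>x. ?K * exp (2 * \<beta> * \<alpha> * x)) has_real_derivative ?K * (exp (2 * \<beta> * \<alpha> * x) * (2 * \<beta> * \<alpha>))) (at x)"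
    by (intro DERIV_cmult) (auto intro!: derivative_eq_intros)
  note d = DERIV_mult[OF dE DERIV_add[OF DERIV_mult[OF DERIV_ident dl[of 2]] DERIV_cmult[OF dl[of 1], of \<alpha>]]]
  have alg: "K * (E * (2 * b * a)) * (y * A2 + a * A1) + (1 * A2 + - b * A3 * (2 * y) * y + a * (- b * A2 * (2 * y))) * (K * E)
      = - (2 * K * E * (b * y\<^sup>2 * A3 - A2 / 2 - b * a\<^sup>2 * A1))" for K E a b y A1 A2 A3 :: real
    by (simp add: algebra_simps power2_eq_square)
  have Suc: "Suc 2 = 3" "Suc 1 = 2" by auto
  have "((\<lambda>x. ?K * exp (2 * \<beta> * \<alpha> * x) * (x * laplace ?c \<beta> 2 (x\<^sup>2) + \<alpha> * laplace ?c \<beta> 1 (x\<^sup>2))) has_real_derivative - (2 * ?K * exp (2 * \<beta> * \<alpha> * x) * crit_field \<alpha> \<beta> w (x\<^sup>2))) (at x)"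
  proof (rule DERIV_cong[OF d])
    have x2: "x\<^sup>2 > 0" using x by simp
    show "?K * (exp (2 * \<beta> * \<alpha> * x) * (2 * \<beta> * \<alpha>)) * (x * laplace ?c \<beta> 2 (x\<^sup>2) + \<alpha> * laplace ?c \<beta> 1 (x\<^sup>2))
      + (1 * laplace ?c \<beta> 2 (x\<^sup>2) + - \<beta> * laplace ?c \<beta> (Suc 2) (x\<^sup>2) * (2 * x) * x + \<alpha> * (- \<beta> * laplace ?c \<beta> (Suc 1) (x\<^sup>2) * (2 * x))) * (?K * exp (2 * \<beta> * \<alpha> * x))
      = - (2 * ?K * exp (2 * \<beta> * \<alpha> * x) * crit_field \<alpha> \<beta> w (x\<^sup>2))"
      unfolding Suc crit_field_eq_laplace[OF w b0 x2] by (rule alg)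
  qed
  then show ?thesis
  proof (rule DERIV_cong_ev[THEN iffD1, rotated -1])
    have "\<forall>\<^sub>F y in nhds x. y \<in> {0<..}" using x by (intro eventually_nhds_in_open) auto
    then show "\<forall>\<^sub>F y in nhds x. ?K * exp (2 * \<beta> * \<alpha> * y) * (y * laplace ?c \<beta> 2 (y\<^sup>2) + \<alpha> * laplace ?c \<beta> 1 (y\<^sup>2)) = conga \<alpha> w t y"
      by eventually_elim (rule conga_eq_laplace[OF s b w, symmetric], simp)
  qed simp_all
qed

lemma num_crit_eq_zeros:
  assumes s: "s = conga_sigma \<alpha> t" "s > 0" and b: "\<beta> = rate s" and w: "continuous_on {0..1} w" and a: "0 < a" and ab: "a \<le> b'"
  shows "num_crit \<alpha> w t {a..b'} = emeasure (count_space UNIV) {p\<in>{a\<^sup>2..b'\<^sup>2}. crit_field \<alpha> \<beta> w p = 0}"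
proof -
  have iff: "(conga \<alpha> w t has_real_derivative 0) (at x) \<longleftrightarrow> crit_field \<alpha> \<beta> w (x\<^sup>2) = 0" if x: "x > 0" for x
  proof
    assume "(conga \<alpha> w t has_real_derivative 0) (at x)"
    from DERIV_unique[OF this conga_deriv[OF s b w x]] show "crit_field \<alpha> \<beta> w (x\<^sup>2) = 0" using s by simp
  next
    assume "crit_field \<alpha> \<beta> w (x\<^sup>2) = 0"
    then show "(conga \<alpha> w t has_real_derivative 0) (at x)" using conga_deriv[OF s b w x] by simp
  qed
  let ?Z = "{x\<in>{a..b'}. (conga \<alpha> w t has_real_derivative 0) (at x)}"
  have inj: "inj_on (\<lambda>x. x\<^sup>2) ?Z" using a by (auto simp: inj_on_def)
  have "{p\<in>{a\<^sup>2..b'\<^sup>2}. crit_field \<alpha> \<beta> w p = 0} = (\<lambda>x. x\<^sup>2) ` ?Z"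
  proof (intro equalityI subsetI)
    fix p assume p: "p \<in> {p\<in>{a\<^sup>2..b'\<^sup>2}. crit_field \<alpha> \<beta> w p = 0}"
    then have p0: "p \<ge> 0" by (auto intro: order_trans[OF zero_le_power2])
    have "a \<le> sqrt p" using p a by (auto intro: real_le_rsqrt)
    moreover have "sqrt p \<le> b'" using p a ab by (auto intro: real_le_lsqrt)
    ultimately have "sqrt p \<in> {a..b'}" "sqrt p > 0" using a by (auto simp del: real_sqrt_gt_0_iff)
    then have "sqrt p \<in> ?Z" using p p0 iff[of "sqrt p"] by auto
    then show "p \<in> (\<lambda>x. x\<^sup>2) ` ?Z" using p0 by (intro image_eqI[of _ _ "sqrt p"]) auto
  qed (use a iff in \<open>auto simp: power_mono\<close>)
  then show ?thesis unfolding num_crit_def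
    using inj by (simp add: emeasure_count_space finite_image_iff card_image)
qed

section \<open>Counting zeros by sign changes on grids\<close>

definition grid :: "real \<Rightarrow> real \<Rightarrow> nat \<Rightarrow> nat \<Rightarrow> real" where
  "grid A B n i = A + (B - A) * (real i / n)"

definition sign_changes :: "real \<Rightarrow> real \<Rightarrow> nat \<Rightarrow> (real \<Rightarrow> real) \<Rightarrow> nat" where
  "sign_changes A B n F = card {i. i < n \<and> F (grid A B n i) * F (grid A B n (Suc i)) < 0}"

lemma grid_in:
  assumes "A \<le> B" "i \<le> n" "n > 0" shows "grid A B n i \<in> {A..B}"
proof -
  have "real i / n \<le> 1" using assms by simp
  then have "(B - A) * (real i / n) \<le> (B - A) * 1" using assms by (intro mult_left_mono) auto
  then show ?thesis using assms by (auto simp: grid_def)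
qed

lemma grid_Suc: "grid A B n (Suc i) = grid A B n i + (B - A) / n"
  by (simp add: grid_def add_divide_distrib distrib_left)

lemma grid_strict_mono: "A < B \<Longrightarrow> n > 0 \<Longrightarrow> i < j \<Longrightarrow> grid A B n i < grid A B n j"
  by (auto simp: grid_def divide_strict_right_mono)

lemma grid_mono: "A < B \<Longrightarrow> n > 0 \<Longrightarrow> i \<le> j \<Longrightarrow> grid A B n i \<le> grid A B n j"
  by (auto simp: grid_def divide_right_mono)

lemma grid_cell:
  assumes AB: "A < B" and n: "n > 0" and z: "A \<le> z" "z < B"
  obtains i where "i < n" "grid A B n i \<le> z" "z < grid A B n (Suc i)"
proof -
  define y where "y = (z - A) / (B - A) * n"
  have y0: "y \<ge> 0" "y < n" using assms by (auto simp: y_def field_simps)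
  define i where "i = nat \<lfloor>y\<rfloor>"
  have i: "real i \<le> y" "y < real (Suc i)" using y0(1) unfolding i_def of_nat_Suc by linarith+
  have z': "z = A + (B - A) * (y / n)" using AB n by (simp add: y_def)
  show ?thesis
  proof (rule that[of i])
    show "i < n" using i y0 by linarith
    show "grid A B n i \<le> z" unfolding grid_def z' using i AB by (auto intro!: mult_left_mono divide_right_mono)
    show "z < grid A B n (Suc i)" unfolding grid_def z' using i(2) AB n
      by (intro add_strict_left_mono mult_strict_left_mono divide_strict_right_mono) auto
  qed
qed

lemma sign_changes_le_zeros:
  assumes AB: "A < B" and n: "n > 0" and F: "continuous_on {A..B} F"
  shows "of_nat (sign_changes A B n F) \<le> emeasure (count_space UNIV) {p\<in>{A..B}. F p = 0}"
proof (cases "finite {p\<in>{A..B}. F p = 0}")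
  case False then show ?thesis by simp
next
  case fin: True
  let ?I = "{i. i < n \<and> F (grid A B n i) * F (grid A B n (Suc i)) < 0}"
  have "\<exists>z. grid A B n i < z \<and> z < grid A B n (Suc i) \<and> F z = 0" if i: "i \<in> ?I" for i
  proof -
    let ?u = "grid A B n i" and ?v = "grid A B n (Suc i)"
    have uv: "?u < ?v" using grid_strict_mono[OF AB n] by simp
    have c: "continuous_on {?u..?v} F" using i grid_in[of A B i n] grid_in[of A B "Suc i" n] AB n
      by (intro continuous_on_subset[OF F]) auto
    have lt: "F ?u * F ?v < 0" using i by simp
    have "\<exists>z. ?u \<le> z \<and> z \<le> ?v \<and> F z = 0"
    proof (cases "F ?u < 0")
      case True
      then have "F ?v > 0" using lt by (simp add: mult_less_0_iff)
      then show ?thesis using IVT'[of F ?u 0 ?v] True uv c by auto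
    next
      case False
      then have "F ?u > 0" "F ?v < 0" using lt by (auto simp: mult_less_0_iff)
      then show ?thesis using IVT2'[of F ?v 0 ?u] uv c by auto
    qed
    then obtain z where z: "?u \<le> z" "z \<le> ?v" "F z = 0" by blast
    moreover have "z \<noteq> ?u" "z \<noteq> ?v" using lt z(3) by auto
    ultimately show ?thesis by force
  qed
  then obtain f where f: "\<And>i. i \<in> ?I \<Longrightarrow> grid A B n i < f i \<and> f i < grid A B n (Suc i) \<and> F (f i) = 0" by metis
  have inj: "inj_on f ?I"
  proof (rule inj_onI)
    fix i j assume ij: "i \<in> ?I" "j \<in> ?I" "f i = f j"
    show "i = j"
    proof (rule ccontr)
      assume "i \<noteq> j"
      then consider "Suc i \<le> j" | "Suc j \<le> i" by linarith
      then show False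
      proof cases
        case 1 then show False using grid_mono[OF AB n, of "Suc i" j] f[OF ij(1)] f[OF ij(2)] ij(3) by linarith
      next
        case 2 then show False using grid_mono[OF AB n, of "Suc j" i] f[OF ij(1)] f[OF ij(2)] ij(3) by linarith
      qed
    qed
  qed
  have sub: "f ` ?I \<subseteq> {p\<in>{A..B}. F p = 0}"
  proof
    fix y assume "y \<in> f ` ?I"
    then obtain i where i: "i \<in> ?I" "y = f i" by blast
    show "y \<in> {p\<in>{A..B}. F p = 0}" using f[OF i(1)] i grid_in[of A B i n] grid_in[of A B "Suc i" n] AB n by auto
  qed
  have "card ?I \<le> card {p\<in>{A..B}. F p = 0}" by (rule card_inj_on_le[OF inj sub fin])
  then show ?thesis using fin by (simp add: sign_changes_def)
qed

text \<open>At a simple zero the function lies strictly on different sides of 0 to the left and to the right.\<close>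

lemma transversal_zero_sign_change:
  fixes F :: "real \<Rightarrow> real"
  assumes d: "(F has_real_derivative D) (at z)" and z: "F z = 0" and D: "D \<noteq> 0"
  obtains r where "r > 0" "\<And>u v. z - r < u \<Longrightarrow> u < z \<Longrightarrow> z < v \<Longrightarrow> v < z + r \<Longrightarrow> F u * F v < 0"
proof (cases "D > 0")
  case True
  obtain r1 where r1: "r1 > 0" "\<And>h. h > 0 \<Longrightarrow> h < r1 \<Longrightarrow> F (z + h) > F z" using DERIV_pos_inc_right[OF d True] by blast
  obtain r2 where r2: "r2 > 0" "\<And>h. h > 0 \<Longrightarrow> h < r2 \<Longrightarrow> F (z - h) < F z" using DERIV_pos_inc_left[OF d True] by blast
  show ?thesis
  proof (rule that[of "min r1 r2"])
    fix u v assume "z - min r1 r2 < u" "u < z" "z < v" "v < z + min r1 r2"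
    then have "F u < 0" "F v > 0" using r1(2)[of "v - z"] r2(2)[of "z - u"] z by auto
    then show "F u * F v < 0" by (rule mult_neg_pos)
  qed (use r1 r2 in auto)
next
  case False
  then have D: "D < 0" using D by simp
  obtain r1 where r1: "r1 > 0" "\<And>h. h > 0 \<Longrightarrow> h < r1 \<Longrightarrow> F (z + h) < F z" using DERIV_neg_dec_right[OF d D] by blast
  obtain r2 where r2: "r2 > 0" "\<And>h. h > 0 \<Longrightarrow> h < r2 \<Longrightarrow> F (z - h) > F z" using DERIV_neg_dec_left[OF d D] by blast
  show ?thesis
  proof (rule that[of "min r1 r2"])
    fix u v assume "z - min r1 r2 < u" "u < z" "z < v" "v < z + min r1 r2"
    then have "F u > 0" "F v < 0" using r1(2)[of "v - z"] r2(2)[of "z - u"] z by auto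
    then show "F u * F v < 0" by (rule mult_pos_neg)
  qed (use r1 r2 in auto)
qed

text \<open>Once the mesh is below all the radii of \<open>transversal_zero_sign_change\<close>, each zero has a cell of its own
whose end points carry opposite signs: a second zero of the same cell would lie where \<open>F\<close> does not vanish.\<close>

lemma eventually_sign_changes_ge:
  fixes F F' :: "real \<Rightarrow> real"
  assumes AB: "A < B" and d: "\<And>p. p \<in> {A..B} \<Longrightarrow> (F has_real_derivative F' p) (at p)"
    and nd: "\<And>p. p \<in> {A..B} \<Longrightarrow> F p = 0 \<Longrightarrow> F' p \<noteq> 0"
    and ng: "\<And>n i. n > 0 \<Longrightarrow> i \<le> n \<Longrightarrow> F (grid A B n i) \<noteq> 0"
    and Z: "finite Z" "Z \<subseteq> {p\<in>{A..B}. F p = 0}"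
  shows "\<forall>\<^sub>F n in sequentially. card Z \<le> sign_changes A B n F"
proof -
  have "\<exists>r>0. \<forall>u v. z - r < u \<longrightarrow> u < z \<longrightarrow> z < v \<longrightarrow> v < z + r \<longrightarrow> F u * F v < 0" if z: "z \<in> Z" for z
  proof -
    have z': "z \<in> {A..B}" "F z = 0" using z Z by auto
    show ?thesis using transversal_zero_sign_change[OF d[OF z'(1)] z'(2) nd[OF z']] by metis
  qed
  then obtain r where r: "\<And>z. z \<in> Z \<Longrightarrow> r z > 0" "\<And>z u v. z \<in> Z \<Longrightarrow> z - r z < u \<Longrightarrow> u < z \<Longrightarrow> z < v \<Longrightarrow> v < z + r z \<Longrightarrow> F u * F v < 0"
    by metis
  have ev: "\<forall>\<^sub>F n in sequentially. \<forall>z\<in>Z. (B - A) / n < r z"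
  proof (rule eventually_ball_finite[OF Z(1)], rule ballI)
    fix z assume z: "z \<in> Z"
    have "(\<lambda>n. (B - A) / real n) \<longlonglongrightarrow> 0" by (rule lim_const_over_n)
    then show "\<forall>\<^sub>F n in sequentially. (B - A) / n < r z" using r(1)[OF z] by (rule order_tendstoD)
  qed
  have gA: "F A \<noteq> 0" using ng[of 1 0] by (simp add: grid_def)
  have gB: "F B \<noteq> 0" using ng[of 1 1] by (simp add: grid_def)
  show ?thesis using ev eventually_gt_at_top[of 0]
  proof eventually_elim
    case (elim n)
    let ?I = "{i. i < n \<and> F (grid A B n i) * F (grid A B n (Suc i)) < 0}"
    have "\<exists>i. i < n \<and> grid A B n i < z \<and> z < grid A B n (Suc i)" if z: "z \<in> Z" for z
    proof -
      have z': "z \<in> {A..B}" "F z = 0" using z Z by auto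
      then have "z \<noteq> B" using gB by auto
      then obtain i where i: "i < n" "grid A B n i \<le> z" "z < grid A B n (Suc i)" using grid_cell[OF AB elim(2), of z] z' by auto
      moreover have "grid A B n i \<noteq> z" using ng[OF elim(2), of i] i(1) z'(2) by auto
      ultimately show ?thesis by force
    qed
    then obtain f where f: "\<And>z. z \<in> Z \<Longrightarrow> f z < n \<and> grid A B n (f z) < z \<and> z < grid A B n (Suc (f z))" by metis
    have len: "grid A B n (Suc (f z)) < z + r z" "grid A B n (f z) > z - r z" if "z \<in> Z" for z
      using f[OF that] elim(1) that grid_Suc[of A B n "f z"] by force+
    have inj: "inj_on f Z"
    proof (rule inj_onI)
      have *: "\<not> z < z'" if "z \<in> Z" "z' \<in> Z" "f z = f z'" for z z'
      proof
        assume lt: "z < z'"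
        have "F (grid A B n (f z)) * F z' < 0" using f[OF that(1)] f[OF that(2)] len[OF that(1)] that lt by (intro r(2)[OF that(1)]) auto
        then show False using that(2) Z by auto
      qed
      fix z z' assume "z \<in> Z" "z' \<in> Z" "f z = f z'"
      then show "z = z'" using *[of z z'] *[of z' z] by force
    qed
    have "f ` Z \<subseteq> ?I" using f len r(2) by fastforce
    then have "card Z \<le> card ?I" by (intro card_inj_on_le[OF inj]) auto
    then show ?case by (simp add: sign_changes_def)
  qed
qed

lemma sign_changes_tendsto_zeros:
  fixes F F' :: "real \<Rightarrow> real"
  assumes AB: "A < B" and d: "\<And>p. p \<in> {A..B} \<Longrightarrow> (F has_real_derivative F' p) (at p)"
    and nd: "\<And>p. p \<in> {A..B} \<Longrightarrow> F p = 0 \<Longrightarrow> F' p \<noteq> 0"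
    and ng: "\<And>n i. n > 0 \<Longrightarrow> i \<le> n \<Longrightarrow> F (grid A B n i) \<noteq> 0"
  shows "(\<lambda>n. of_nat (sign_changes A B n F) :: ennreal) \<longlonglongrightarrow> emeasure (count_space UNIV) {p\<in>{A..B}. F p = 0}"
proof (rule order_tendstoI)
  let ?Z = "{p\<in>{A..B}. F p = 0}"
  have c: "continuous_on {A..B} F" using d by (intro continuous_at_imp_continuous_on ballI DERIV_isCont)
  show "\<forall>\<^sub>F n in sequentially. of_nat (sign_changes A B n F) < a" if "emeasure (count_space UNIV) ?Z < a" for a :: ennreal
    using eventually_gt_at_top[of 0]
    by eventually_elim (rule le_less_trans[OF sign_changes_le_zeros[OF AB _ c] that])
  show "\<forall>\<^sub>F n in sequentially. a < of_nat (sign_changes A B n F)" if a: "a < emeasure (count_space UNIV) ?Z" for a :: ennreal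
  proof -
    have "\<exists>Z. finite Z \<and> Z \<subseteq> ?Z \<and> a < of_nat (card Z)"
    proof (cases "finite ?Z")
      case True then show ?thesis using a by (intro exI[of _ ?Z]) auto
    next
      case False
      have "a < top" using a le_less_trans less_le_trans top_greatest by (metis)
      then obtain k :: nat where k: "a < of_nat k" using ennreal_Ex_less_of_nat by blast
      obtain Z where "Z \<subseteq> ?Z" "finite Z" "card Z = k" using infinite_arbitrarily_large[OF False] by blast
      then show ?thesis using k by blast
    qed
    then obtain Z where Z: "finite Z" "Z \<subseteq> ?Z" "a < of_nat (card Z)" by blast
    have "\<forall>\<^sub>F n in sequentially. card Z \<le> sign_changes A B n F" by (rule eventually_sign_changes_ge[OF AB d nd ng Z(1,2)])
    then show ?thesis by eventually_elim (rule less_le_trans[OF Z(3)], simp)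
  qed
qed

section \<open>Smoothness and covariance of the field\<close>

definition crit_field' :: "real \<Rightarrow> real \<Rightarrow> (real \<Rightarrow> real) \<Rightarrow> real \<Rightarrow> real" where
  "crit_field' \<alpha> \<beta> w p = \<beta> * laplace (path_weight \<alpha> \<beta> w) \<beta> 3 p - \<beta>\<^sup>2 * p * laplace (path_weight \<alpha> \<beta> w) \<beta> 4 p + \<beta> * laplace (path_weight \<alpha> \<beta> w) \<beta> 3 p / 2 + \<beta>\<^sup>2 * \<alpha>\<^sup>2 * laplace (path_weight \<alpha> \<beta> w) \<beta> 2 p"

lemma path_weight_bound:
  fixes w :: "real \<Rightarrow> real"
  assumes b: "\<beta> > 0" and C: "\<And>s. s \<in> {0..1} \<Longrightarrow> \<bar>w s\<bar> \<le> C" and z: "z \<in> {0..1}"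
  shows "\<bar>path_weight \<alpha> \<beta> w z\<bar> \<le> C"
proof -
  have "\<bar>path_weight \<alpha> \<beta> w z\<bar> = \<bar>w (1 - z)\<bar> * (sqrt z * exp (- (\<beta> * \<alpha>\<^sup>2 * z)))" using z by (simp add: path_weight_def abs_mult)
  also have "\<dots> \<le> C * (1 * 1)" using C[of "1 - z"] z b by (intro mult_mono) auto
  finally show ?thesis by simp
qed

text \<open>The constant \<open>K\<close> depends neither on the path nor on the points, only the factor \<open>C\<close> on the size of the path.
This uniformity is what \<open>AE_no_double_zero\<close> needs.\<close>

lemma crit_field_quadratic:
  assumes b: "\<beta> > 0" and A: "0 < A"
  obtains K where "K \<ge> 0" "\<And>(w :: real \<Rightarrow> real) C p q. continuous_on {0..1} w \<Longrightarrow> (\<And>s. s \<in> {0..1} \<Longrightarrow> \<bar>w s\<bar> \<le> C) \<Longrightarrow> p \<in> {A..B} \<Longrightarrow> q \<in> {A..B} \<Longrightarrow>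
    \<bar>crit_field \<alpha> \<beta> w q - crit_field \<alpha> \<beta> w p - (q - p) * crit_field' \<alpha> \<beta> w p\<bar> \<le> K * C * (q - p)\<^sup>2"
proof -
  define k where "k j = \<beta>\<^sup>2 * (fact (j + 2) / (\<beta> * A) ^ (j + 2))" for j
  define K where "K = \<beta> * \<bar>B\<bar> * k 3 + \<beta>\<^sup>2 * (fact 4 / (\<beta> * A) ^ 4) + k 2 / 2 + \<beta> * \<alpha>\<^sup>2 * k 1"
  have k0: "k j \<ge> 0" for j using b A by (auto simp: k_def)
  show ?thesis
  proof (rule that[of K])
    show "K \<ge> 0" unfolding K_def using k0 b A by (intro add_nonneg_nonneg) auto
    fix w :: "real \<Rightarrow> real" and C p q assume w: "continuous_on {0..1} w" and C: "\<And>s. s \<in> {0..1} \<Longrightarrow> \<bar>w s\<bar> \<le> C" and p: "p \<in> {A..B}" and q: "q \<in> {A..B}"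
    let ?c = "path_weight \<alpha> \<beta> w"
    let ?h = "q - p"
    have C0: "C \<ge> 0" using C[of 0] by auto
    have cc: "continuous_on {0..1} ?c" by (rule continuous_on_path_weight[OF w])
    have bc: "\<And>z. z \<in> {0..1} \<Longrightarrow> \<bar>?c z\<bar> \<le> C" by (rule path_weight_bound[OF b C])
    have pq: "p > 0" "q > 0" "A \<le> p" "A \<le> q" "q \<le> \<bar>B\<bar>" using p q A by auto
    define R where "R j = laplace ?c \<beta> j q - laplace ?c \<beta> j p + \<beta> * (q - p) * laplace ?c \<beta> (Suc j) p" for j
    have R: "\<bar>R j\<bar> \<le> C * k j * ?h\<^sup>2" for j
      unfolding R_def k_def by (rule laplace_quadratic[OF cc b A pq(3,4) bc])
    have L4: "\<bar>laplace ?c \<beta> 4 p\<bar> \<le> C * (fact 4 / (\<beta> * A) ^ 4)" by (rule laplace_bound[OF cc b A pq(3) bc])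
    have e: "laplace ?c \<beta> 3 q = R 3 + laplace ?c \<beta> 3 p - \<beta> * ?h * laplace ?c \<beta> 4 p"
      "laplace ?c \<beta> 2 q = R 2 + laplace ?c \<beta> 2 p - \<beta> * ?h * laplace ?c \<beta> 3 p"
      "laplace ?c \<beta> 1 q = R 1 + laplace ?c \<beta> 1 p - \<beta> * ?h * laplace ?c \<beta> 2 p"
      by (simp_all add: R_def eval_nat_numeral)
    have "crit_field \<alpha> \<beta> w q - crit_field \<alpha> \<beta> w p - ?h * crit_field' \<alpha> \<beta> w p = \<beta> * q * R 3 - \<beta>\<^sup>2 * ?h\<^sup>2 * laplace ?c \<beta> 4 p - R 2 / 2 - \<beta> * \<alpha>\<^sup>2 * R 1"
      unfolding crit_field_eq_laplace[OF w b pq(1)] crit_field_eq_laplace[OF w b pq(2)] crit_field'_def e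
      by (simp add: field_simps power2_eq_square)
    also have "\<bar>\<dots>\<bar> \<le> \<bar>\<beta> * q * R 3\<bar> + \<bar>\<beta>\<^sup>2 * ?h\<^sup>2 * laplace ?c \<beta> 4 p\<bar> + \<bar>R 2 / 2\<bar> + \<bar>\<beta> * \<alpha>\<^sup>2 * R 1\<bar>" by linarith
    also have "\<dots> \<le> \<beta> * \<bar>B\<bar> * (C * k 3 * ?h\<^sup>2) + \<beta>\<^sup>2 * ?h\<^sup>2 * (C * (fact 4 / (\<beta> * A) ^ 4)) + (C * k 2 * ?h\<^sup>2) / 2 + \<beta> * \<alpha>\<^sup>2 * (C * k 1 * ?h\<^sup>2)"
    proof (intro add_mono)
      show "\<bar>\<beta> * q * R 3\<bar> \<le> \<beta> * \<bar>B\<bar> * (C * k 3 * ?h\<^sup>2)" unfolding abs_mult using R[of 3] pq b by (intro mult_mono) auto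
      show "\<bar>\<beta>\<^sup>2 * ?h\<^sup>2 * laplace ?c \<beta> 4 p\<bar> \<le> \<beta>\<^sup>2 * ?h\<^sup>2 * (C * (fact 4 / (\<beta> * A) ^ 4))" unfolding abs_mult using L4 by (intro mult_mono) auto
      show "\<bar>R 2 / 2\<bar> \<le> (C * k 2 * ?h\<^sup>2) / 2" using R[of 2] by simp
      show "\<bar>\<beta> * \<alpha>\<^sup>2 * R 1\<bar> \<le> \<beta> * \<alpha>\<^sup>2 * (C * k 1 * ?h\<^sup>2)" unfolding abs_mult using R[of 1] b by (intro mult_mono) auto
    qed
    also have "\<dots> = K * C * ?h\<^sup>2" by (simp add: K_def algebra_simps)
    finally show "\<bar>crit_field \<alpha> \<beta> w q - crit_field \<alpha> \<beta> w p - ?h * crit_field' \<alpha> \<beta> w p\<bar> \<le> K * C * ?h\<^sup>2" .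
  qed
qed

lemma crit_field_deriv:
  assumes b: "\<beta> > 0" and p: "p > 0" and w: "continuous_on {0..1} w"
  shows "(crit_field \<alpha> \<beta> w has_real_derivative crit_field' \<alpha> \<beta> w p) (at p)"
proof -
  obtain K where "K \<ge> 0" and K: "\<And>(w :: real \<Rightarrow> real) C p' q. continuous_on {0..1} w \<Longrightarrow> (\<And>s. s \<in> {0..1} \<Longrightarrow> \<bar>w s\<bar> \<le> C) \<Longrightarrow> p' \<in> {p/2..2 * p} \<Longrightarrow> q \<in> {p/2..2 * p} \<Longrightarrow>
    \<bar>crit_field \<alpha> \<beta> w q - crit_field \<alpha> \<beta> w p' - (q - p') * crit_field' \<alpha> \<beta> w p'\<bar> \<le> K * C * (q - p')\<^sup>2"
    by (rule crit_field_quadratic[where A="p/2" and B="2 * p" and \<alpha>=\<alpha>, OF b]) (use p in simp, blast)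
  obtain C where C: "\<And>s. s \<in> {0..1} \<Longrightarrow> \<bar>w s\<bar> \<le> C" using unit_interval_bounded[OF w] by blast
  show ?thesis
  proof (rule has_real_derivative_quadratic)
    show "p / 2 > 0" using p by simp
    fix q assume q: "\<bar>q - p\<bar> < p / 2"
    have "\<bar>crit_field \<alpha> \<beta> w q - crit_field \<alpha> \<beta> w p - (q - p) * crit_field' \<alpha> \<beta> w p\<bar> \<le> K * C * (q - p)\<^sup>2"
      by (rule K[OF w C]) (use q p in \<open>auto simp: abs_if split: if_splits\<close>)
    then show "\<bar>crit_field \<alpha> \<beta> w q - crit_field \<alpha> \<beta> w p - crit_field' \<alpha> \<beta> w p * (q - p)\<bar> \<le> K * C * (q - p)\<^sup>2" by (simp add: mult.commute)
  qed
qed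

definition kernel_inner :: "(real \<Rightarrow> real) \<Rightarrow> (real \<Rightarrow> real) \<Rightarrow> real" where
  "kernel_inner g h = integral {0..1} (\<lambda>z. g z * h z)"

definition kappa :: "real \<Rightarrow> real \<Rightarrow> real \<Rightarrow> real" where
  "kappa \<alpha> \<beta> = laplace (\<lambda>z. exp (- (2 * \<beta> * \<alpha>\<^sup>2 * z))) \<beta> 1"

text \<open>The product of two kernels depends on \<open>p\<close> and \<open>q\<close> through \<open>p + q\<close> only. This is the reason for working with
\<open>p = x\<^sup>2\<close> and without the factor \<open>exp (\<alpha> x / s\<^sup>2)\<close>.\<close>

lemma kernel_inner_heat_kernel:
  assumes b: "\<beta> > 0" and p: "p > 0" "q > 0"
  shows "kernel_inner (heat_kernel \<alpha> \<beta> p) (heat_kernel \<alpha> \<beta> q) = kappa \<alpha> \<beta> (p + q)"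
proof -
  let ?I = "\<lambda>z. exp (- (2 * \<beta> * \<alpha>\<^sup>2 * z)) * ((1 / z) ^ 1 * exp (- (\<beta> * (p + q) / z)))"
  have i: "set_integrable lborel {0..1} ?I"
    by (rule laplace_integrable) (use b p in \<open>auto intro!: continuous_intros\<close>)
  have "kernel_inner (heat_kernel \<alpha> \<beta> p) (heat_kernel \<alpha> \<beta> q) = integral {0..1} ?I"
    unfolding kernel_inner_def
  proof (rule integral_cong)
    fix z :: real assume z: "z \<in> {0..1}"
    have e: "sqrt z * sqrt z * (1 / z) * (1 / z) = 1 / z" using z by simp
    have "heat_kernel \<alpha> \<beta> p z * heat_kernel \<alpha> \<beta> q z = (sqrt z * sqrt z * (1 / z) * (1 / z)) * (exp (- (\<beta> * p / z)) * exp (- (\<beta> * q / z))) * (exp (- (\<beta> * \<alpha>\<^sup>2 * z)) * exp (- (\<beta> * \<alpha>\<^sup>2 * z)))"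
      by (simp only: heat_kernel_def mult_ac)
    also have "exp (- (\<beta> * p / z)) * exp (- (\<beta> * q / z)) = exp (- (\<beta> * (p + q) / z))" by (simp add: exp_add[symmetric] distrib_left add_divide_distrib)
    also have "exp (- (\<beta> * \<alpha>\<^sup>2 * z)) * exp (- (\<beta> * \<alpha>\<^sup>2 * z)) = exp (- (2 * \<beta> * \<alpha>\<^sup>2 * z))" by (simp add: exp_add[symmetric])
    finally show "heat_kernel \<alpha> \<beta> p z * heat_kernel \<alpha> \<beta> q z = ?I z" unfolding e by simp
  qed
  also have "\<dots> = kappa \<alpha> \<beta> (p + q)" unfolding kappa_def laplace_def by (rule set_borel_integral_eq_integral(2)[OF i, symmetric])
  finally show ?thesis .
qed

text \<open>A bound for a fixed \<open>\<beta>\<close>, from the half of the interval where \<open>1 / z \<le> 2\<close>; it serves to show positivity.\<close>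

lemma kappa_lower_crude:
  assumes b: "\<beta> > 0" and S: "S > 0"
  shows "kappa \<alpha> \<beta> S \<ge> exp (- (2 * \<beta> * (\<alpha>\<^sup>2 + S))) / 2"
proof -
  let ?I = "\<lambda>z. exp (- (2 * \<beta> * \<alpha>\<^sup>2 * z)) * ((1 / z) ^ 1 * exp (- (\<beta> * S / z)))"
  let ?c = "exp (- (2 * \<beta> * (\<alpha>\<^sup>2 + S)))"
  have i: "set_integrable lborel {0..1} ?I"
    by (rule laplace_integrable) (use b S in \<open>auto intro!: continuous_intros\<close>)
  have "(LBINT z:{0..1}. indicator {1/2..1::real} z * ?c) = (LINT z|lborel. indicator {1/2..1::real} z * ?c)"
    unfolding set_lebesgue_integral_def by (intro Bochner_Integration.integral_cong) (auto simp: indicator_def)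
  then have "?c / 2 = (LBINT z:{0..1}. indicator {1/2..1::real} z * ?c)" by simp
  also have "\<dots> \<le> (LBINT z:{0..1}. ?I z)"
  proof (rule set_integral_mono)
    show "set_integrable lborel {0..1} (\<lambda>z::real. indicator {1/2..1} z * ?c)"
      by (rule set_integrable_bounded_unit[where C="?c"]) (auto simp: set_borel_measurable_def indicator_def)
    fix z :: real assume z: "z \<in> {0..1}"
    show "indicator {1/2..1} z * ?c \<le> ?I z"
    proof (cases "z \<ge> 1/2")
      case True
      have "- (2 * \<beta> * (\<alpha>\<^sup>2 + S)) \<le> - (2 * \<beta> * \<alpha>\<^sup>2 * z) + - (\<beta> * S / z)"
      proof -
        have "2 * \<beta> * \<alpha>\<^sup>2 * z \<le> 2 * \<beta> * \<alpha>\<^sup>2 * 1" using z b by (intro mult_left_mono) auto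
        moreover have "\<beta> * S / z \<le> \<beta> * S * 2" using True z b S by (simp add: field_simps)
        ultimately show ?thesis by (simp add: algebra_simps)
      qed
      then have "?c \<le> exp (- (2 * \<beta> * \<alpha>\<^sup>2 * z)) * exp (- (\<beta> * S / z))" by (simp add: exp_add[symmetric])
      also have "\<dots> \<le> ?I z" using True z by (simp add: field_simps)
      finally show ?thesis using True z by simp
    qed (use z in simp)
  qed (rule i)
  also have "\<dots> = kappa \<alpha> \<beta> S" by (simp add: kappa_def laplace_def)
  finally show ?thesis .
qed

lemma kappa_pos: "\<beta> > 0 \<Longrightarrow> S > 0 \<Longrightarrow> kappa \<alpha> \<beta> S > 0"
  using kappa_lower_crude[of \<beta> S \<alpha>] exp_gt_zero[of "- (2 * \<beta> * (\<alpha>\<^sup>2 + S))"] by linarith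

lemma kernel_inner_integrable:
  assumes "smooth_kernel g g'" "smooth_kernel h h'" shows "(\<lambda>z. g z * h z) integrable_on {0..1}"
  using assms by (intro integrable_continuous_real continuous_on_mult) (auto simp: smooth_kernel_def)

lemma kernel_inner_commute: "kernel_inner g h = kernel_inner h g"
  by (simp add: kernel_inner_def mult.commute)

lemma kernel_inner_linear:
  assumes "smooth_kernel g g'" "smooth_kernel h h'" "smooth_kernel k k'"
  shows "kernel_inner (\<lambda>z. a * g z + b * h z) k = a * kernel_inner g k + b * kernel_inner h k"
proof -
  have "kernel_inner (\<lambda>z. a * g z + b * h z) k = integral {0..1} (\<lambda>z. a * (g z * k z) + b * (h z * k z))"
    unfolding kernel_inner_def by (simp add: algebra_simps)
  also have "\<dots> = integral {0..1} (\<lambda>z. a * (g z * k z)) + integral {0..1} (\<lambda>z. b * (h z * k z))"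
    using kernel_inner_integrable[OF assms(1,3)] kernel_inner_integrable[OF assms(2,3)] by (intro integral_add integrable_on_mult_right)
  finally show ?thesis by (simp add: kernel_inner_def)
qed

lemma smooth_kernel_lin:
  "smooth_kernel g g' \<Longrightarrow> smooth_kernel h h' \<Longrightarrow> smooth_kernel (\<lambda>z. a * g z + b * h z) (\<lambda>z. a * g' z + b * h' z)"
  by (intro smooth_kernel_add smooth_kernel_cmult)

lemma kernel_inner_quadratic:
  assumes g: "smooth_kernel g g'" and h: "smooth_kernel h h'"
  shows "kernel_inner (\<lambda>z. a * g z + b * h z) (\<lambda>z. a * g z + b * h z) = a\<^sup>2 * kernel_inner g g + 2 * a * b * kernel_inner g h + b\<^sup>2 * kernel_inner h h"
proof -
  have k: "smooth_kernel (\<lambda>z. a * g z + b * h z) (\<lambda>z. a * g' z + b * h' z)" by (rule smooth_kernel_lin[OF g h])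
  have "kernel_inner (\<lambda>z. a * g z + b * h z) (\<lambda>z. a * g z + b * h z) = a * kernel_inner g (\<lambda>z. a * g z + b * h z) + b * kernel_inner h (\<lambda>z. a * g z + b * h z)"
    by (rule kernel_inner_linear[OF g h k])
  also have "\<dots> = a * (a * kernel_inner g g + b * kernel_inner h g) + b * (a * kernel_inner g h + b * kernel_inner h h)"
    unfolding kernel_inner_commute[of g "\<lambda>z. a * g z + b * h z"] kernel_inner_commute[of h "\<lambda>z. a * g z + b * h z"] kernel_inner_linear[OF g h g] kernel_inner_linear[OF g h h] ..
  finally show ?thesis by (simp add: kernel_inner_commute[of h g] algebra_simps power2_eq_square)
qed

context brownian_motion_01 begin

abbreviation BM_int :: "(real \<Rightarrow> real) \<Rightarrow> 'a \<Rightarrow> real" where "BM_int g' \<omega> \<equiv> wiener_int (\<lambda>s. W s \<omega>) g'"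

lemma AE_BM_int_lin:
  assumes g: "smooth_kernel g g'" and h: "smooth_kernel h h'"
  shows "AE \<omega> in completion M. BM_int (\<lambda>z. a * g' z + b * h' z) \<omega> = a * BM_int g' \<omega> + b * BM_int h' \<omega>"
  using BM_continuous[THEN AE_completion]
proof eventually_elim
  case (elim \<omega>)
  show ?case using wiener_int_add[OF elim smooth_kernel_cmult[OF g] smooth_kernel_cmult[OF h]] by (simp add: wiener_int_cmult)
qed

lemma BM_int_char:
  assumes g: "smooth_kernel g g'"
  shows "(CLINT \<omega>|completion M. iexp (BM_int g' \<omega>)) = of_real (exp (- kernel_inner g g / 2))"
  using wiener_int_char[OF g] by (simp add: kernel_inner_def power2_eq_square)

lemma BM_int_char2:
  assumes g: "smooth_kernel g g'" and h: "smooth_kernel h h'"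
  shows "(CLINT \<omega>|completion M. iexp (a * BM_int g' \<omega> + b * BM_int h' \<omega>)) = of_real (exp (- (a\<^sup>2 * kernel_inner g g + 2 * a * b * kernel_inner g h + b\<^sup>2 * kernel_inner h h) / 2))"
proof -
  note [measurable] = wiener_int_measurable[OF g] wiener_int_measurable[OF h] wiener_int_measurable[OF smooth_kernel_lin[OF g h]]
  have "(CLINT \<omega>|completion M. iexp (a * BM_int g' \<omega> + b * BM_int h' \<omega>)) = (CLINT \<omega>|completion M. iexp (BM_int (\<lambda>z. a * g' z + b * h' z) \<omega>))"
  proof (rule integral_cong_AE)
    show "AE \<omega> in completion M. iexp (a * BM_int g' \<omega> + b * BM_int h' \<omega>) = iexp (BM_int (\<lambda>z. a * g' z + b * h' z) \<omega>)"
      using AE_BM_int_lin[OF g h, of a b] by eventually_elim (simp only:)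
  qed measurable
  then show ?thesis unfolding BM_int_char[OF smooth_kernel_lin[OF g h]] kernel_inner_quadratic[OF g h] .
qed

lemma BM_int_char1:
  assumes g: "smooth_kernel g g'"
  shows "(CLINT \<omega>|completion M. iexp (a * BM_int g' \<omega>)) = of_real (exp (- (a\<^sup>2 * kernel_inner g g) / 2))"
  using BM_int_char2[OF g g, of a 0] by simp

lemma BM_int_small:
  assumes g: "smooth_kernel g g'" and pos: "kernel_inner g g > 0" and e: "e \<ge> 0"
  shows "measure (completion M) {\<omega>\<in>space M. \<bar>BM_int g' \<omega>\<bar> \<le> e} \<le> e / sqrt (kernel_inner g g)"
proof -
  interpret C: prob_space "completion M" by (rule prob_space_completion)
  show ?thesis using C.gaussian_small_ball[OF wiener_int_measurable[OF g] pos e BM_int_char1[OF g]] by simp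
qed

lemma AE_BM_int_nonzero:
  assumes g: "smooth_kernel g g'" and pos: "kernel_inner g g > 0"
  shows "AE \<omega> in completion M. BM_int g' \<omega> \<noteq> 0"
proof -
  interpret C: prob_space "completion M" by (rule prob_space_completion)
  note [measurable] = wiener_int_measurable[OF g]
  have "measure (completion M) {\<omega>\<in>space (completion M). BM_int g' \<omega> = 0} \<le> 0" using BM_int_small[OF g pos, of 0] by simp
  then have z: "measure (completion M) {\<omega>\<in>space (completion M). BM_int g' \<omega> = 0} = 0" by (simp add: measure_le_0_iff)
  have "{\<omega>\<in>space (completion M). BM_int g' \<omega> = 0} \<in> sets (completion M)" by measurable
  from C.prob_eq_0[OF this] z have "AE \<omega> in completion M. \<omega> \<notin> {\<omega>\<in>space (completion M). BM_int g' \<omega> = 0}" by simp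
  moreover have "AE \<omega> in completion M. \<omega> \<in> space M" by (rule AE_I2) simp
  ultimately show ?thesis by eventually_elim auto
qed

lemma BM_int_orthant:
  assumes g: "smooth_kernel g g'" and h: "smooth_kernel h h'" and pos: "kernel_inner g g > 0" "kernel_inner h h > 0"
  shows "measure (completion M) {\<omega>\<in>space M. BM_int g' \<omega> * BM_int h' \<omega> < 0} = arccos (kernel_inner g h / sqrt (kernel_inner g g * kernel_inner h h)) / pi"
proof -
  interpret C: prob_space "completion M" by (rule prob_space_completion)
  show ?thesis using C.gaussian_pair_sign_change[OF wiener_int_measurable[OF g] wiener_int_measurable[OF h] pos BM_int_char2[OF g h]] by simp
qed

lemma kernel_inner_cauchy_schwarz:
  assumes g: "smooth_kernel g g'" and h: "smooth_kernel h h'" and pos: "kernel_inner g g > 0"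
  shows "(kernel_inner g h)\<^sup>2 \<le> kernel_inner g g * kernel_inner h h"
proof -
  interpret C: prob_space "completion M" by (rule prob_space_completion)
  show ?thesis using C.gaussian_pair_cauchy_schwarz[OF wiener_int_measurable[OF g] wiener_int_measurable[OF h] pos BM_int_char2[OF g h]] by simp
qed

text \<open>The joint characteristic function of the four Gaussian variables factorizes when the cross covariances vanish.\<close>

lemma BM_int_indep_signs:
  assumes g1: "smooth_kernel g1 g1'" and g2: "smooth_kernel g2 g2'" and h1: "smooth_kernel h1 h1'" and h2: "smooth_kernel h2 h2'"
    and z: "kernel_inner g1 h1 = 0" "kernel_inner g1 h2 = 0" "kernel_inner g2 h1 = 0" "kernel_inner g2 h2 = 0"
  shows "measure (completion M) {\<omega>\<in>space M. BM_int g1' \<omega> * BM_int g2' \<omega> < 0 \<and> BM_int h1' \<omega> * BM_int h2' \<omega> < 0}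
    = measure (completion M) {\<omega>\<in>space M. BM_int g1' \<omega> * BM_int g2' \<omega> < 0} * measure (completion M) {\<omega>\<in>space M. BM_int h1' \<omega> * BM_int h2' \<omega> < 0}"
proof -
  interpret C: prob_space "completion M" by (rule prob_space_completion)
  define \<phi> where "\<phi> a b = complex_of_real (exp (- kernel_inner (\<lambda>z. a * g1 z + b * g2 z) (\<lambda>z. a * g1 z + b * g2 z) / 2))" for a b
  define \<psi> where "\<psi> a b = complex_of_real (exp (- kernel_inner (\<lambda>z. a * h1 z + b * h2 z) (\<lambda>z. a * h1 z + b * h2 z) / 2))" for a b
  note m = wiener_int_measurable[OF g1] wiener_int_measurable[OF g2] wiener_int_measurable[OF h1] wiener_int_measurable[OF h2]
  note [measurable] = m
  have ch: "(CLINT \<omega>|completion M. iexp (a * BM_int g1' \<omega> + b * BM_int g2' \<omega> + c * BM_int h1' \<omega> + d * BM_int h2' \<omega>)) = \<phi> a b * \<psi> c d" for a b c d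
  proof -
    let ?G = "\<lambda>z. a * g1 z + b * g2 z" and ?G' = "\<lambda>z. a * g1' z + b * g2' z"
    let ?H = "\<lambda>z. c * h1 z + d * h2 z" and ?H' = "\<lambda>z. c * h1' z + d * h2' z"
    have G: "smooth_kernel ?G ?G'" by (rule smooth_kernel_lin[OF g1 g2])
    have H: "smooth_kernel ?H ?H'" by (rule smooth_kernel_lin[OF h1 h2])
    note [measurable] = wiener_int_measurable[OF G] wiener_int_measurable[OF H]
    have GH: "kernel_inner ?G ?H = 0"
      unfolding kernel_inner_linear[OF g1 g2 H] kernel_inner_commute[of g1 ?H] kernel_inner_commute[of g2 ?H] kernel_inner_linear[OF h1 h2 g1] kernel_inner_linear[OF h1 h2 g2]
      using z by (simp add: kernel_inner_commute[of h1] kernel_inner_commute[of h2])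
    have "(CLINT \<omega>|completion M. iexp (a * BM_int g1' \<omega> + b * BM_int g2' \<omega> + c * BM_int h1' \<omega> + d * BM_int h2' \<omega>)) = (CLINT \<omega>|completion M. iexp (1 * BM_int ?G' \<omega> + 1 * BM_int ?H' \<omega>))"
    proof (rule integral_cong_AE)
      show "AE \<omega> in completion M. iexp (a * BM_int g1' \<omega> + b * BM_int g2' \<omega> + c * BM_int h1' \<omega> + d * BM_int h2' \<omega>) = iexp (1 * BM_int ?G' \<omega> + 1 * BM_int ?H' \<omega>)"
        using AE_BM_int_lin[OF g1 g2, of a b] AE_BM_int_lin[OF h1 h2, of c d] by eventually_elim (simp only: mult_1 add.assoc)
    qed measurable
    also have "\<dots> = \<phi> a b * \<psi> c d"
      unfolding BM_int_char2[OF G H] GH \<phi>_def \<psi>_def by (simp add: exp_add[symmetric] add_divide_distrib flip: of_real_mult)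
    finally show ?thesis .
  qed
  show ?thesis using C.sign_changes_independent_if_char_factorizes[OF m ch] by (simp add: \<phi>_def \<psi>_def kernel_inner_def)
qed

end

section \<open>The almost sure and the mean number of zeros\<close>

lemma kappa_antimono:
  assumes b: "\<beta> > 0" and S: "0 < S" "S \<le> T" shows "kappa \<alpha> \<beta> T \<le> kappa \<alpha> \<beta> S"
  unfolding kappa_def laplace_def
proof (rule set_integral_mono)
  show "set_integrable lborel {0..1} (\<lambda>z. exp (- (2 * \<beta> * \<alpha>\<^sup>2 * z)) * ((1 / z) ^ 1 * exp (- (\<beta> * T / z))))"
    "set_integrable lborel {0..1} (\<lambda>z. exp (- (2 * \<beta> * \<alpha>\<^sup>2 * z)) * ((1 / z) ^ 1 * exp (- (\<beta> * S / z))))"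
    by (rule laplace_integrable; use b S in \<open>auto intro!: continuous_intros\<close>)+
  fix z :: real assume z: "z \<in> {0..1}"
  show "exp (- (2 * \<beta> * \<alpha>\<^sup>2 * z)) * ((1 / z) ^ 1 * exp (- (\<beta> * T / z))) \<le> exp (- (2 * \<beta> * \<alpha>\<^sup>2 * z)) * ((1 / z) ^ 1 * exp (- (\<beta> * S / z)))"
    using z b S by (intro mult_left_mono) (auto intro!: divide_right_mono)
qed

text \<open>The angle, in the Hilbert space of square integrable functions, between the kernels of the field at \<open>p\<close> and
at \<open>q\<close>.\<close>

definition field_angle :: "real \<Rightarrow> real \<Rightarrow> real \<Rightarrow> real \<Rightarrow> real" where
  "field_angle \<alpha> \<beta> p q = arccos (kappa \<alpha> \<beta> (p + q) / sqrt (kappa \<alpha> \<beta> (2 * p) * kappa \<alpha> \<beta> (2 * q)))"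

definition zero_count :: "real \<Rightarrow> real \<Rightarrow> real \<Rightarrow> real \<Rightarrow> (real \<Rightarrow> real) \<Rightarrow> ennreal" where
  "zero_count \<alpha> \<beta> A B w = emeasure (count_space UNIV) {p\<in>{A..B}. crit_field \<alpha> \<beta> w p = 0}"

text \<open>The length of the spherical polygon whose corners are the normalized kernels at the grid points.\<close>

definition grid_length :: "real \<Rightarrow> real \<Rightarrow> real \<Rightarrow> real \<Rightarrow> nat \<Rightarrow> real" where
  "grid_length \<alpha> \<beta> A B n = (\<Sum>i<n. field_angle \<alpha> \<beta> (grid A B n i) (grid A B n (Suc i)))"

context brownian_motion_01 begin

abbreviation crit_process :: "real \<Rightarrow> real \<Rightarrow> real \<Rightarrow> 'a \<Rightarrow> real" where
  "crit_process \<alpha> \<beta> p \<omega> \<equiv> crit_field \<alpha> \<beta> (\<lambda>s. W s \<omega>) p"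

lemma crit_process_measurable: "\<beta> > 0 \<Longrightarrow> p > 0 \<Longrightarrow> crit_process \<alpha> \<beta> p \<in> borel_measurable (completion M)"
  unfolding crit_field_def[abs_def] by (rule wiener_int_measurable[OF smooth_kernel_heat_kernel])

lemma crit_process_var: "\<beta> > 0 \<Longrightarrow> p > 0 \<Longrightarrow> kernel_inner (heat_kernel \<alpha> \<beta> p) (heat_kernel \<alpha> \<beta> p) = kappa \<alpha> \<beta> (2 * p)"
  using kernel_inner_heat_kernel[of \<beta> p p \<alpha>] by simp

lemma crit_process_sign_change:
  assumes b: "\<beta> > 0" and p: "p > 0" "q > 0"
  shows "measure (completion M) {\<omega>\<in>space M. crit_process \<alpha> \<beta> p \<omega> * crit_process \<alpha> \<beta> q \<omega> < 0} = field_angle \<alpha> \<beta> p q / pi"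
  using BM_int_orthant[OF smooth_kernel_heat_kernel[OF b p(1)] smooth_kernel_heat_kernel[OF b p(2)], of \<alpha> \<alpha>] kappa_pos[OF b] p
  unfolding crit_field_def field_angle_def crit_process_var[OF b p(1)] crit_process_var[OF b p(2)] kernel_inner_heat_kernel[OF b p] by simp

lemma AE_crit_process_nonzero: "\<beta> > 0 \<Longrightarrow> p > 0 \<Longrightarrow> AE \<omega> in completion M. crit_process \<alpha> \<beta> p \<omega> \<noteq> 0"
  unfolding crit_field_def using AE_BM_int_nonzero[OF smooth_kernel_heat_kernel] kappa_pos crit_process_var by simp

text \<open>At a double zero \<open>p\<close> the field is bounded by a multiple of \<open>1 / n\<^sup>2\<close> at a point of the \<open>n\<close>-th grid next to
\<open>p\<close>. One grid point has this property with probability at most a multiple of \<open>1 / n\<^sup>2\<close>, because the density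
of a normal variable is bounded, so some point of the grid has it with probability at most a multiple of
\<open>1 / n\<close>.\<close>

lemma AE_no_double_zero:
  assumes b: "\<beta> > 0" and AB: "0 < A" "A < B"
  shows "AE \<omega> in completion M. \<forall>p\<in>{A..B}. crit_process \<alpha> \<beta> p \<omega> = 0 \<longrightarrow> crit_field' \<alpha> \<beta> (\<lambda>s. W s \<omega>) p \<noteq> 0"
proof -
  interpret C: prob_space "completion M" by (rule prob_space_completion)
  obtain K where K0: "K \<ge> 0" and K: "\<And>(w :: real \<Rightarrow> real) C p q. continuous_on {0..1} w \<Longrightarrow> (\<And>s. s \<in> {0..1} \<Longrightarrow> \<bar>w s\<bar> \<le> C) \<Longrightarrow> p \<in> {A..B} \<Longrightarrow> q \<in> {A..B} \<Longrightarrow>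
    \<bar>crit_field \<alpha> \<beta> w q - crit_field \<alpha> \<beta> w p - (q - p) * crit_field' \<alpha> \<beta> w p\<bar> \<le> K * C * (q - p)\<^sup>2"
    by (rule crit_field_quadratic[where A=A and B=B and \<alpha>=\<alpha>, OF b AB(1)]) blast
  define e where "e C n = K * real C * ((B - A) / real (Suc n))\<^sup>2" for C n :: nat
  define E where "E C n = (\<Union>i\<le>Suc n. {\<omega>\<in>space M. \<bar>crit_process \<alpha> \<beta> (grid A B (Suc n) i) \<omega>\<bar> \<le> e C n})" for C n
  define v where "v = kappa \<alpha> \<beta> (2 * B)"
  have v: "v > 0" unfolding v_def using AB by (intro kappa_pos[OF b]) auto
  have e0: "e C n \<ge> 0" for C n unfolding e_def using K0 by simp
  have g: "grid A B (Suc n) i \<in> {A..B}" if "i \<le> Suc n" for n i using grid_in[of A B i "Suc n"] that AB by simp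
  have Em: "{\<omega>\<in>space M. \<bar>crit_process \<alpha> \<beta> (grid A B (Suc n) i) \<omega>\<bar> \<le> e C n} \<in> sets (completion M)" if "i \<le> Suc n" for i n C
  proof -
    have "grid A B (Suc n) i > 0" using g[OF that] AB by auto
    note [measurable] = crit_process_measurable[OF b this]
    have "{\<omega>\<in>space (completion M). \<bar>crit_process \<alpha> \<beta> (grid A B (Suc n) i) \<omega>\<bar> \<le> e C n} \<in> sets (completion M)" by measurable
    then show ?thesis by simp
  qed
  have Em': "E C n \<in> sets (completion M)" for C n unfolding E_def using Em by auto
  have PE: "measure (completion M) (E C n) \<le> real (n + 2) * (e C n / sqrt v)" for C n
  proof -
    have "measure (completion M) (E C n) \<le> (\<Sum>i\<le>Suc n. measure (completion M) {\<omega>\<in>space M. \<bar>crit_process \<alpha> \<beta> (grid A B (Suc n) i) \<omega>\<bar> \<le> e C n})"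
      unfolding E_def by (rule C.finite_measure_subadditive_finite) (use Em in auto)
    also have "\<dots> \<le> (\<Sum>i\<le>Suc n. e C n / sqrt v)"
    proof (rule sum_mono)
      fix i assume "i \<in> {..Suc n}"
      then have gi: "grid A B (Suc n) i \<in> {A..B}" using g by simp
      then have p: "grid A B (Suc n) i > 0" using AB by auto
      have kp: "kappa \<alpha> \<beta> (2 * grid A B (Suc n) i) > 0" using p by (intro kappa_pos[OF b]) auto
      have "measure (completion M) {\<omega>\<in>space M. \<bar>crit_process \<alpha> \<beta> (grid A B (Suc n) i) \<omega>\<bar> \<le> e C n} \<le> e C n / sqrt (kappa \<alpha> \<beta> (2 * grid A B (Suc n) i))"
        using BM_int_small[OF smooth_kernel_heat_kernel[OF b p], of \<alpha> "e C n"] kp e0 unfolding crit_process_var[OF b p] crit_field_def by simp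
      also have "\<dots> \<le> e C n / sqrt v"
        unfolding v_def using v[unfolded v_def] e0 p gi by (intro divide_left_mono real_sqrt_le_mono kappa_antimono[OF b] mult_pos_pos) (auto simp: kp)
      finally show "measure (completion M) {\<omega>\<in>space M. \<bar>crit_process \<alpha> \<beta> (grid A B (Suc n) i) \<omega>\<bar> \<le> e C n} \<le> e C n / sqrt v" .
    qed
    also have "\<dots> = real (n + 2) * (e C n / sqrt v)" by simp
    finally show ?thesis .
  qed
  have null: "AE \<omega> in completion M. \<omega> \<notin> (\<Inter>n. E C n)" for C
  proof -
    have "(\<lambda>n. real (n + 2) * (e C n / sqrt v)) = (\<lambda>n. (K * C * (B - A)\<^sup>2 / sqrt v) * (real (n + 2) / real (Suc n) * (1 / real (Suc n))))"
      by (simp add: e_def power2_eq_square fun_eq_iff field_simps)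
    also have "\<dots> \<longlonglongrightarrow> (K * C * (B - A)\<^sup>2 / sqrt v) * (1 * 0)"
    proof (intro tendsto_intros)
      have "(\<lambda>n. 1 + 1 / real (Suc n)) \<longlonglongrightarrow> 1 + 0" by (intro tendsto_intros LIMSEQ_Suc[OF lim_1_over_n])
      moreover have "(\<lambda>n. 1 + 1 / real (Suc n)) = (\<lambda>n. real (n + 2) / real (Suc n))" by (auto simp: field_simps)
      ultimately show "(\<lambda>n. real (n + 2) / real (Suc n)) \<longlonglongrightarrow> 1" by simp
      show "(\<lambda>n. 1 / real (Suc n)) \<longlonglongrightarrow> 0" by (rule LIMSEQ_Suc[OF lim_1_over_n])
    qed
    finally have lim: "(\<lambda>n. real (n + 2) * (e C n / sqrt v)) \<longlonglongrightarrow> 0" by simp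
    have IE: "(\<Inter>n. E C n) \<in> sets (completion M)" using Em' by (intro sets.countable_INT) auto
    have "measure (completion M) (\<Inter>n. E C n) \<le> 0"
    proof (rule LIMSEQ_le_const[OF lim], intro exI allI impI)
      fix n
      have "measure (completion M) (\<Inter>n. E C n) \<le> measure (completion M) (E C n)" using Em' by (intro C.finite_measure_mono) auto
      then show "measure (completion M) (\<Inter>n. E C n) \<le> real (n + 2) * (e C n / sqrt v)" using PE[of C n] by linarith
    qed
    then have "measure (completion M) (\<Inter>n. E C n) = 0" by (simp add: measure_le_0_iff)
    then have "(\<Inter>n. E C n) \<in> null_sets (completion M)" using IE C.emeasure_eq_measure by (auto simp: null_sets_def)
    then show ?thesis by (rule AE_not_in)
  qed
  then have "AE \<omega> in completion M. \<forall>C. \<omega> \<notin> (\<Inter>n. E C n)" by (simp add: AE_all_countable)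
  moreover have "AE \<omega> in completion M. \<omega> \<in> space M" by (rule AE_I2) simp
  ultimately show ?thesis using BM_continuous[THEN AE_completion]
  proof eventually_elim
    case (elim \<omega>)
    let ?w = "\<lambda>s. W s \<omega>"
    obtain C0 where C0: "\<And>s. s \<in> {0..1} \<Longrightarrow> \<bar>?w s\<bar> \<le> C0" using unit_interval_bounded[OF elim(3)] by blast
    obtain C :: nat where C: "real C \<ge> C0" using real_arch_simple by blast
    have bC: "\<bar>?w s\<bar> \<le> real C" if "s \<in> {0..1}" for s using C0[OF that] C by linarith
    show ?case
    proof (intro ballI impI notI)
      fix p assume p: "p \<in> {A..B}" and z: "crit_process \<alpha> \<beta> p \<omega> = 0" "crit_field' \<alpha> \<beta> ?w p = 0"
      have "\<omega> \<in> E C n" for n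
      proof -
        have "\<exists>i\<le>Suc n. \<bar>grid A B (Suc n) i - p\<bar> \<le> (B - A) / Suc n"
        proof (cases "p = B")
          case True then show ?thesis using AB by (intro exI[of _ "Suc n"]) (auto simp: grid_def)
        next
          case False
          then obtain i where i: "i < Suc n" "grid A B (Suc n) i \<le> p" "p < grid A B (Suc n) (Suc i)"
            using grid_cell[OF AB(2), of "Suc n" p] p by auto
          then show ?thesis using grid_Suc[of A B "Suc n" i] by (intro exI[of _ i]) auto
        qed
        then obtain i where i: "i \<le> Suc n" "\<bar>grid A B (Suc n) i - p\<bar> \<le> (B - A) / Suc n" by blast
        have "\<bar>crit_process \<alpha> \<beta> (grid A B (Suc n) i) \<omega>\<bar> \<le> K * C * (grid A B (Suc n) i - p)\<^sup>2"
          using K[OF elim(3) bC p g[OF i(1)]] z by simp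
        also have "\<dots> \<le> e C n" unfolding e_def
          using i(2) K0 AB by (intro mult_left_mono power2_le_iff_abs_le[THEN iffD2]) auto
        finally show ?thesis unfolding E_def using i(1) elim(2) by auto
      qed
      then show False using elim(1) by blast
    qed
  qed
qed

lemma AE_grid_nonzero:
  assumes b: "\<beta> > 0" and AB: "0 < A" "A < B"
  shows "AE \<omega> in completion M. \<forall>n i. n > 0 \<longrightarrow> i \<le> n \<longrightarrow> crit_process \<alpha> \<beta> (grid A B n i) \<omega> \<noteq> 0"
  unfolding AE_all_countable
proof (intro allI)
  fix n i :: nat
  show "AE \<omega> in completion M. n > 0 \<longrightarrow> i \<le> n \<longrightarrow> crit_process \<alpha> \<beta> (grid A B n i) \<omega> \<noteq> 0"
  proof (cases "n > 0 \<and> i \<le> n")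
    case True
    then have "grid A B n i > 0" using grid_in[of A B i n] AB by auto
    from AE_crit_process_nonzero[OF b this, of \<alpha>] show ?thesis by eventually_elim simp
  next
    case False then show ?thesis by (intro AE_I2) blast
  qed
qed

lemma AE_sign_changes_tendsto_zero_count:
  assumes b: "\<beta> > 0" and AB: "0 < A" "A < B"
  shows "AE \<omega> in completion M. (\<lambda>n. of_nat (sign_changes A B n (\<lambda>p. crit_process \<alpha> \<beta> p \<omega>)) :: ennreal) \<longlonglongrightarrow> zero_count \<alpha> \<beta> A B (\<lambda>s. W s \<omega>)"
  using AE_grid_nonzero[OF b AB, of \<alpha>] AE_no_double_zero[OF b AB, of \<alpha>] BM_continuous[THEN AE_completion]
proof eventually_elim
  case (elim \<omega>)
  show ?case unfolding zero_count_def
  proof (rule sign_changes_tendsto_zeros[OF AB(2)])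
    fix p assume "p \<in> {A..B}"
    then show "(crit_field \<alpha> \<beta> (\<lambda>s. W s \<omega>) has_real_derivative crit_field' \<alpha> \<beta> (\<lambda>s. W s \<omega>) p) (at p)"
      using AB by (intro crit_field_deriv[OF b _ elim(3)]) auto
  qed (use elim in auto)
qed

end

lemma sign_changes_indicator:
  "real (sign_changes A B n F) = (\<Sum>i<n. indicator {F. F (grid A B n i) * F (grid A B n (Suc i)) < 0} F)"
proof -
  have "{i. i < n \<and> F (grid A B n i) * F (grid A B n (Suc i)) < 0} = {i\<in>{..<n}. F (grid A B n i) * F (grid A B n (Suc i)) < 0}" by auto
  then have "real (sign_changes A B n F) = (\<Sum>i\<in>{i\<in>{..<n}. F (grid A B n i) * F (grid A B n (Suc i)) < 0}. 1)"
    by (simp add: sign_changes_def)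
  also have "\<dots> = (\<Sum>i<n. if F (grid A B n i) * F (grid A B n (Suc i)) < 0 then 1 else 0)"
    by (rule sum.inter_filter) simp
  finally show ?thesis unfolding indicator_def of_bool_def mem_Collect_eq .
qed

lemma grid_pos: "0 < A \<Longrightarrow> A < B \<Longrightarrow> i \<le> n \<Longrightarrow> n > 0 \<Longrightarrow> grid A B n i > 0"
  using grid_in[of A B i n] by auto

lemma sign_changes_le: "sign_changes A B n F \<le> n"
proof -
  have "card {i. i < n \<and> F (grid A B n i) * F (grid A B n (Suc i)) < 0} \<le> card {..<n}" by (rule card_mono) auto
  then show ?thesis by (simp add: sign_changes_def)
qed

context brownian_motion_01 begin

lemma sign_changes_measurable:
  assumes b: "\<beta> > 0" and AB: "0 < A" "A < B"
  shows "(\<lambda>\<omega>. real (sign_changes A B n (\<lambda>p. crit_process \<alpha> \<beta> p \<omega>))) \<in> borel_measurable (completion M)"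
  unfolding sign_changes_indicator
proof (rule borel_measurable_sum)
  fix i assume "i \<in> {..<n}"
  then have i: "i < n" by simp
  have "grid A B n i > 0" "grid A B n (Suc i) > 0" using i by (auto intro!: grid_pos[OF AB])
  note [measurable] = crit_process_measurable[OF b this(1)] crit_process_measurable[OF b this(2)]
  have "(\<lambda>\<omega>. if crit_process \<alpha> \<beta> (grid A B n i) \<omega> * crit_process \<alpha> \<beta> (grid A B n (Suc i)) \<omega> < 0 then 1 else 0 :: real) \<in> borel_measurable (completion M)"
    by measurable
  then show "(\<lambda>\<omega>. indicat_real {F. F (grid A B n i) * F (grid A B n (Suc i)) < 0} (\<lambda>p. crit_process \<alpha> \<beta> p \<omega>)) \<in> borel_measurable (completion M)"
    by (simp add: indicator_def)
qed

lemma sign_changes_integrable: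
  assumes b: "\<beta> > 0" and AB: "0 < A" "A < B"
  shows "integrable (completion M) (\<lambda>\<omega>. real (sign_changes A B n (\<lambda>p. crit_process \<alpha> \<beta> p \<omega>)))"
proof -
  interpret C: prob_space "completion M" by (rule prob_space_completion)
  show ?thesis
    by (rule C.integrable_const_bound[where B="real n"]) (use sign_changes_le sign_changes_measurable[OF b AB] in auto)
qed

lemma expectation_sign_changes:
  assumes b: "\<beta> > 0" and AB: "0 < A" "A < B"
  shows "(LINT \<omega>|completion M. real (sign_changes A B n (\<lambda>p. crit_process \<alpha> \<beta> p \<omega>))) = grid_length \<alpha> \<beta> A B n / pi"
proof -
  interpret C: prob_space "completion M" by (rule prob_space_completion)
  let ?E = "\<lambda>i. {\<omega>\<in>space M. crit_process \<alpha> \<beta> (grid A B n i) \<omega> * crit_process \<alpha> \<beta> (grid A B n (Suc i)) \<omega> < 0}"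
  have E: "?E i \<in> sets (completion M)" if i: "i < n" for i
  proof -
    have "grid A B n i > 0" "grid A B n (Suc i) > 0" using i by (auto intro!: grid_pos[OF AB])
    note [measurable] = crit_process_measurable[OF b this(1)] crit_process_measurable[OF b this(2)]
    have "{\<omega>\<in>space (completion M). crit_process \<alpha> \<beta> (grid A B n i) \<omega> * crit_process \<alpha> \<beta> (grid A B n (Suc i)) \<omega> < 0} \<in> sets (completion M)" by measurable
    then show ?thesis by simp
  qed
  have "(LINT \<omega>|completion M. real (sign_changes A B n (\<lambda>p. crit_process \<alpha> \<beta> p \<omega>))) = (LINT \<omega>|completion M. (\<Sum>i<n. indicator (?E i) \<omega>))"
    unfolding sign_changes_indicator by (intro Bochner_Integration.integral_cong sum.cong) (auto simp: indicator_def)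
  also have "\<dots> = (\<Sum>i<n. LINT \<omega>|completion M. indicator (?E i) \<omega>)"
    using E by (intro Bochner_Integration.integral_sum) (auto intro!: integrable_real_indicator simp: C.emeasure_eq_measure)
  also have "\<dots> = (\<Sum>i<n. measure (completion M) (?E i))" by (intro sum.cong) (auto intro!: arg_cong[where f="measure (completion M)"])
  also have "\<dots> = (\<Sum>i<n. field_angle \<alpha> \<beta> (grid A B n i) (grid A B n (Suc i)) / pi)"
    by (intro sum.cong refl crit_process_sign_change[OF b] grid_pos[OF AB]) auto
  finally show ?thesis by (simp add: grid_length_def sum_divide_distrib)
qed

lemma nn_expectation_sign_changes:
  assumes b: "\<beta> > 0" and AB: "0 < A" "A < B"
  shows "(\<integral>\<^sup>+\<omega>. of_nat (sign_changes A B n (\<lambda>p. crit_process \<alpha> \<beta> p \<omega>)) \<partial>completion M) = ennreal (grid_length \<alpha> \<beta> A B n / pi)"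
proof -
  have "(\<integral>\<^sup>+\<omega>. of_nat (sign_changes A B n (\<lambda>p. crit_process \<alpha> \<beta> p \<omega>)) \<partial>completion M) = (\<integral>\<^sup>+\<omega>. ennreal (real (sign_changes A B n (\<lambda>p. crit_process \<alpha> \<beta> p \<omega>))) \<partial>completion M)"
    by (simp add: ennreal_of_nat_eq_real_of_nat)
  also have "\<dots> = ennreal (LINT \<omega>|completion M. real (sign_changes A B n (\<lambda>p. crit_process \<alpha> \<beta> p \<omega>)))"
    by (rule nn_integral_eq_integral[OF sign_changes_integrable[OF b AB]]) simp
  finally show ?thesis by (simp add: expectation_sign_changes[OF b AB])
qed

lemma sign_changes_measurable_ennreal:
  assumes b: "\<beta> > 0" and AB: "0 < A" "A < B"
  shows "(\<lambda>\<omega>. of_nat (sign_changes A B n (\<lambda>p. crit_process \<alpha> \<beta> p \<omega>)) :: ennreal) \<in> borel_measurable (completion M)"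
  using measurable_compose[OF sign_changes_measurable[OF b AB] measurable_ennreal] by (simp add: ennreal_of_nat_eq_real_of_nat)

lemma zero_count_measurable:
  assumes b: "\<beta> > 0" and AB: "0 < A" "A < B"
  shows "(\<lambda>\<omega>. zero_count \<alpha> \<beta> A B (\<lambda>s. W s \<omega>)) \<in> borel_measurable (completion M)"
proof -
  let ?L = "\<lambda>\<omega>. liminf (\<lambda>n. of_nat (sign_changes A B n (\<lambda>p. crit_process \<alpha> \<beta> p \<omega>)) :: ennreal)"
  have m: "?L \<in> borel_measurable (completion M)"
    using sign_changes_measurable_ennreal[OF b AB] by (intro borel_measurable_liminf)
  have "AE \<omega> in completion M. ?L \<omega> = zero_count \<alpha> \<beta> A B (\<lambda>s. W s \<omega>)"
    using AE_sign_changes_tendsto_zero_count[OF b AB, of \<alpha>] by eventually_elim (rule lim_imp_Liminf[OF trivial_limit_sequentially])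
  from measurable_completion_AE_eq[OF m this] show ?thesis by simp
qed

lemma AE_sign_changes_le_zero_count:
  assumes b: "\<beta> > 0" and AB: "0 < A" "A < B" and n: "n > 0"
  shows "AE \<omega> in completion M. of_nat (sign_changes A B n (\<lambda>p. crit_process \<alpha> \<beta> p \<omega>)) \<le> zero_count \<alpha> \<beta> A B (\<lambda>s. W s \<omega>)"
  using BM_continuous[THEN AE_completion]
proof eventually_elim
  case (elim \<omega>)
  have "continuous_on {A..B} (crit_field \<alpha> \<beta> (\<lambda>s. W s \<omega>))"
    using AB by (intro continuous_at_imp_continuous_on ballI DERIV_isCont[OF crit_field_deriv[OF b _ elim]]) auto
  then show ?case unfolding zero_count_def by (rule sign_changes_le_zeros[OF AB(2) n])
qed

lemma expectation_zero_count_ge: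
  assumes b: "\<beta> > 0" and AB: "0 < A" "A < B" and n: "n > 0"
  shows "ennreal (grid_length \<alpha> \<beta> A B n / pi) \<le> (\<integral>\<^sup>+\<omega>. zero_count \<alpha> \<beta> A B (\<lambda>s. W s \<omega>) \<partial>completion M)"
  unfolding nn_expectation_sign_changes[OF b AB, symmetric]
  by (rule nn_integral_mono_AE[OF AE_sign_changes_le_zero_count[OF b AB n]])

text \<open>By Fatou's lemma, along the refinements of one fixed grid.\<close>

lemma expectation_zero_count_le:
  assumes b: "\<beta> > 0" and AB: "0 < A" "A < B" and m: "m > 0"
    and c: "\<And>k. k > 0 \<Longrightarrow> grid_length \<alpha> \<beta> A B (m * k) / pi \<le> c"
  shows "(\<integral>\<^sup>+\<omega>. zero_count \<alpha> \<beta> A B (\<lambda>s. W s \<omega>) \<partial>completion M) \<le> ennreal c"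
proof -
  let ?S = "\<lambda>k \<omega>. of_nat (sign_changes A B (m * Suc k) (\<lambda>p. crit_process \<alpha> \<beta> p \<omega>)) :: ennreal"
  have sub: "filterlim (\<lambda>k. m * Suc k) sequentially sequentially"
    using m by (intro filterlim_subseq strict_monoI) auto
  have "(\<integral>\<^sup>+\<omega>. zero_count \<alpha> \<beta> A B (\<lambda>s. W s \<omega>) \<partial>completion M) = (\<integral>\<^sup>+\<omega>. liminf (\<lambda>k. ?S k \<omega>) \<partial>completion M)"
  proof (rule nn_integral_cong_AE)
    show "AE \<omega> in completion M. zero_count \<alpha> \<beta> A B (\<lambda>s. W s \<omega>) = liminf (\<lambda>k. ?S k \<omega>)"
      using AE_sign_changes_tendsto_zero_count[OF b AB, of \<alpha>]
    proof eventually_elim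
      case (elim \<omega>)
      have "(\<lambda>k. ?S k \<omega>) \<longlonglongrightarrow> zero_count \<alpha> \<beta> A B (\<lambda>s. W s \<omega>)" by (rule filterlim_compose[OF elim sub])
      from lim_imp_Liminf[OF trivial_limit_sequentially this] show ?case by simp
    qed
  qed
  also have "\<dots> \<le> liminf (\<lambda>k. \<integral>\<^sup>+\<omega>. ?S k \<omega> \<partial>completion M)"
    by (rule nn_integral_liminf) (rule sign_changes_measurable_ennreal[OF b AB])
  also have "\<dots> \<le> liminf (\<lambda>k::nat. ennreal c)"
    by (intro Liminf_mono always_eventually allI) (simp add: nn_expectation_sign_changes[OF b AB] c m ennreal_leI del: mult_Suc_right)
  also have "\<dots> = ennreal c" by (simp add: Liminf_const)
  finally show ?thesis .
qed

end

section \<open>Gaussian bounds for the covariance\<close>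

lemma power_le_one_plus_square:
  fixes y :: real assumes "y \<ge> 0" shows "y ^ j \<le> 1 + (y\<^sup>2) ^ j"
proof (cases "y \<le> 1")
  case True then have "y ^ j \<le> 1" using assms by (intro power_le_one) auto
  then show ?thesis by (smt (verit) zero_le_power zero_le_power2)
next
  case False
  then have "y \<le> y\<^sup>2" by (simp add: power2_eq_square)
  then have "y ^ j \<le> (y\<^sup>2) ^ j" using assms by (intro power_mono) auto
  then show ?thesis by simp
qed

text \<open>Away from \<open>z = 0\<close> the powers of \<open>1 / z\<close> are bounded. Near \<open>z = 0\<close> the distance of \<open>\<alpha> z\<close> from \<open>x\<close> is bounded
below, and a part of the exponential beats them. The powers of the rescaled distance are absorbed by another
part of the exponential. What remains is a Gaussian in \<open>z\<close> of width \<open>s\<close>.\<close>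

lemma gauss_kernel_pointwise:
  fixes \<alpha> a :: real and j k :: nat
  assumes al: "\<alpha> > 0" and a: "a > 0"
  obtains C where "C > 0" "\<And>s x z. 0 < s \<Longrightarrow> s \<le> 1 \<Longrightarrow> a \<le> x \<Longrightarrow> 0 < z \<Longrightarrow> z \<le> 1 \<Longrightarrow>
     (1 / z) ^ k * (\<bar>x - \<alpha> * z\<bar> / s) ^ j * exp (- ((x - \<alpha> * z)\<^sup>2 / (s\<^sup>2 * z))) \<le> C * exp (- ((x - \<alpha> * z)\<^sup>2 / (2 * s\<^sup>2)))"
proof -
  define C1 where "C1 = (2 * \<alpha> / a) ^ k + fact k / (a\<^sup>2 / 16) ^ k"
  define C2 :: real where "C2 = 1 + 4 ^ j * fact j"
  have C1: "C1 > 0" unfolding C1_def using al a by (intro add_pos_pos) auto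
  have C2: "C2 > 0" unfolding C2_def by (intro add_pos_pos) auto
  show ?thesis
  proof (rule that[of "C1 * C2"])
    show "C1 * C2 > 0" using C1 C2 by simp
    fix s x z :: real assume s: "0 < s" "s \<le> 1" and x: "a \<le> x" and z: "0 < z" "z \<le> 1"
    define y where "y = \<bar>x - \<alpha> * z\<bar> / s"
    have y0: "y \<ge> 0" using s by (simp add: y_def)
    have y2: "(x - \<alpha> * z)\<^sup>2 / s\<^sup>2 = y\<^sup>2" by (simp add: y_def power_divide)
    have e1: "(x - \<alpha> * z)\<^sup>2 / (s\<^sup>2 * z) = y\<^sup>2 / z" "(x - \<alpha> * z)\<^sup>2 / (2 * s\<^sup>2) = y\<^sup>2 / 2"
      unfolding y2[symmetric] by simp_all
    have b1: "(1 / z) ^ k * exp (- (y\<^sup>2 / (4 * z))) \<le> C1"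
    proof (cases "z \<ge> a / (2 * \<alpha>)")
      case True
      have "1 / z \<le> 2 * \<alpha> / a" using True al a z by (simp add: field_simps)
      then have "(1 / z) ^ k \<le> (2 * \<alpha> / a) ^ k" using z by (intro power_mono) auto
      then have "(1 / z) ^ k * exp (- (y\<^sup>2 / (4 * z))) \<le> (2 * \<alpha> / a) ^ k * 1" using z al a by (intro mult_mono) auto
      also have "\<dots> \<le> C1" unfolding C1_def by simp
      finally show ?thesis .
    next
      case False
      then have "\<alpha> * z \<le> a / 2" using al by (simp add: field_simps)
      then have "x - \<alpha> * z \<ge> a / 2" using x by linarith
      then have "a / 2 \<le> \<bar>x - \<alpha> * z\<bar>" by linarith
      also have "\<dots> \<le> y" using s by (simp add: y_def le_divide_eq mult_left_le)
      finally have "(a / 2)\<^sup>2 \<le> y\<^sup>2" using a by (intro power_mono) auto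
      then have "exp (- (y\<^sup>2 / (4 * z))) \<le> exp (- (a\<^sup>2 / 16 / z))" using z by (simp add: field_simps power2_eq_square)
      then have "(1 / z) ^ k * exp (- (y\<^sup>2 / (4 * z))) \<le> (1 / z) ^ k * exp (- (a\<^sup>2 / 16 / z))" using z by (intro mult_left_mono) auto
      also have "\<dots> \<le> fact k / (a\<^sup>2 / 16) ^ k" by (rule inverse_power_exp_bound) (use z a in auto)
      also have "\<dots> \<le> C1" unfolding C1_def using al a by simp
      finally show ?thesis .
    qed
    have b2: "y ^ j * exp (- (y\<^sup>2 / 4)) \<le> C2"
    proof -
      have "(y\<^sup>2 / 4) ^ j / fact j \<le> exp (y\<^sup>2 / 4)" by (rule power_div_fact_le_exp) simp
      then have "(y\<^sup>2) ^ j \<le> 4 ^ j * fact j * exp (y\<^sup>2 / 4)" by (simp add: power_divide field_simps)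
      then have 1: "(y\<^sup>2) ^ j * exp (- (y\<^sup>2 / 4)) \<le> 4 ^ j * fact j" by (simp add: exp_minus divide_le_eq flip: divide_inverse)
      have "y ^ j * exp (- (y\<^sup>2 / 4)) \<le> (1 + (y\<^sup>2) ^ j) * exp (- (y\<^sup>2 / 4))"
        by (intro mult_right_mono power_le_one_plus_square y0) auto
      also have "\<dots> = exp (- (y\<^sup>2 / 4)) + (y\<^sup>2) ^ j * exp (- (y\<^sup>2 / 4))" by (simp add: distrib_right)
      also have "\<dots> \<le> 1 + 4 ^ j * fact j" using 1 by (intro add_mono) auto
      finally show ?thesis by (simp add: C2_def)
    qed
    have "exp (- (y\<^sup>2 / z)) \<le> exp (- (y\<^sup>2 / (4 * z))) * exp (- (y\<^sup>2 / 4)) * exp (- (y\<^sup>2 / 2))"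
    proof -
      have "y\<^sup>2 * 1 \<le> y\<^sup>2 * (1 / z)" using z by (intro mult_left_mono) auto
      then have "y\<^sup>2 / (4 * z) + y\<^sup>2 / 4 + y\<^sup>2 / 2 \<le> y\<^sup>2 / z" by (simp add: field_simps)
      then show ?thesis by (simp add: exp_add[symmetric])
    qed
    then have "(1 / z) ^ k * y ^ j * exp (- (y\<^sup>2 / z)) \<le> (1 / z) ^ k * y ^ j * (exp (- (y\<^sup>2 / (4 * z))) * exp (- (y\<^sup>2 / 4)) * exp (- (y\<^sup>2 / 2)))"
      using z y0 by (intro mult_left_mono) auto
    also have "\<dots> = ((1 / z) ^ k * exp (- (y\<^sup>2 / (4 * z)))) * (y ^ j * exp (- (y\<^sup>2 / 4))) * exp (- (y\<^sup>2 / 2))" by (simp only: mult_ac)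
    also have "\<dots> \<le> (C1 * C2) * exp (- (y\<^sup>2 / 2))"
      using b1 b2 C1 z y0 by (intro mult_right_mono mult_mono) auto
    finally show "(1 / z) ^ k * (\<bar>x - \<alpha> * z\<bar> / s) ^ j * exp (- ((x - \<alpha> * z)\<^sup>2 / (s\<^sup>2 * z))) \<le> C1 * C2 * exp (- ((x - \<alpha> * z)\<^sup>2 / (2 * s\<^sup>2)))"
      unfolding e1 unfolding y_def[symmetric] .
  qed
qed

lemma gauss_window_integral:
  fixes \<alpha> s x :: real
  assumes al: "\<alpha> > 0" and s: "s > 0"
  shows "set_integrable lborel {0..1} (\<lambda>z. exp (- ((x - \<alpha> * z)\<^sup>2 / (2 * s\<^sup>2))))"
    "(LBINT z:{0..1}. exp (- ((x - \<alpha> * z)\<^sup>2 / (2 * s\<^sup>2)))) \<le> sqrt (2 * pi) / \<alpha> * s"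
proof -
  let ?f = "\<lambda>z. exp (- ((x - \<alpha> * z)\<^sup>2 / (2 * s\<^sup>2)))"
  let ?K = "sqrt (2 * pi) / \<alpha> * s"
  have e: "?f z = ?K * normal_density (x / \<alpha>) (s / \<alpha>) z" for z
  proof -
    have "z - x / \<alpha> = - ((x - \<alpha> * z) / \<alpha>)" using al by (simp add: field_simps)
    then have "(z - x / \<alpha>)\<^sup>2 / (s / \<alpha>)\<^sup>2 = (x - \<alpha> * z)\<^sup>2 / s\<^sup>2" using al by (simp add: power_divide)
    then have "(z - x / \<alpha>)\<^sup>2 / (2 * (s / \<alpha>)\<^sup>2) = (x - \<alpha> * z)\<^sup>2 / (2 * s\<^sup>2)" by (metis divide_divide_eq_left mult.commute)
    moreover have "sqrt (2 * pi * (s / \<alpha>)\<^sup>2) = sqrt (2 * pi) * (s / \<alpha>)"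
      unfolding real_sqrt_mult real_sqrt_abs using al s by simp
    ultimately show ?thesis using al s by (simp add: normal_density_def)
  qed
  have i: "integrable lborel ?f" unfolding e using al s by (intro integrable_mult_right integrable_normal_density) auto
  then show si: "set_integrable lborel {0..1} ?f" unfolding set_integrable_def by (rule integrable_mult_indicator[rotated]) simp
  have "(LBINT z:{0..1}. ?f z) \<le> (LINT z|lborel. ?f z)"
    unfolding set_lebesgue_integral_def using si i
    by (intro integral_mono) (auto simp: set_integrable_def indicator_def)
  also have "\<dots> = ?K" unfolding e using al s by simp
  finally show "(LBINT z:{0..1}. ?f z) \<le> ?K" .
qed

text \<open>Completing the square shows that the Laplace integrand concentrates around \<open>z = x / \<alpha>\<close>.\<close>

lemma complete_the_square:
  fixes \<alpha> \<beta> s x z :: real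
  assumes b: "\<beta> = rate s" and z: "z \<ge> 0" and j: "j > 0"
  shows "exp (- (2 * \<beta> * \<alpha>\<^sup>2 * z)) * ((1 / z) ^ j * exp (- (\<beta> * (2 * x\<^sup>2) / z))) = exp (- (2 * \<alpha> * x / s\<^sup>2)) * ((1 / z) ^ j * exp (- ((x - \<alpha> * z)\<^sup>2 / (s\<^sup>2 * z))))"
proof (cases "z = 0")
  case True then show ?thesis using j by (simp add: power_0_left)
next
  case False
  then have z: "z > 0" using z by simp
  have "- (2 * \<beta> * \<alpha>\<^sup>2 * z) + - (\<beta> * (2 * x\<^sup>2) / z) = - (2 * \<alpha> * x / s\<^sup>2) + - ((x - \<alpha> * z)\<^sup>2 / (s\<^sup>2 * z))"
    using z unfolding b by (cases "s = 0") (simp_all add: field_simps power2_eq_square)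
  then have "exp (- (2 * \<beta> * \<alpha>\<^sup>2 * z)) * exp (- (\<beta> * (2 * x\<^sup>2) / z)) = exp (- (2 * \<alpha> * x / s\<^sup>2)) * exp (- ((x - \<alpha> * z)\<^sup>2 / (s\<^sup>2 * z)))"
    by (metis exp_add)
  then show ?thesis by (simp only: mult_ac)
qed

text \<open>The moments of \<open>1 / z\<close> about \<open>c\<close>, for the measure whose total mass is \<open>kappa\<close>. With \<open>c\<close> close to the mean
they scale with the width \<open>s\<close>, which the plain moments do not.\<close>

definition centered_moment :: "real \<Rightarrow> real \<Rightarrow> real \<Rightarrow> nat \<Rightarrow> real \<Rightarrow> real" where
  "centered_moment \<alpha> \<beta> c j S = (LBINT z:{0..1}. exp (- (2 * \<beta> * \<alpha>\<^sup>2 * z)) * ((1 / z) * exp (- (\<beta> * S / z))) * (1 / z - c) ^ j)"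

lemma continuous_on_tilt: "continuous_on {0..1} (\<lambda>z. exp (- (2 * \<beta> * \<alpha>\<^sup>2 * z)) :: real)"
  by (intro continuous_intros)

definition tilted_laplace :: "real \<Rightarrow> real \<Rightarrow> nat \<Rightarrow> real \<Rightarrow> real" where
  "tilted_laplace \<alpha> \<beta> j = laplace (\<lambda>z. exp (- (2 * \<beta> * \<alpha>\<^sup>2 * z))) \<beta> j"

lemma centered_moment_expand:
  assumes b: "\<beta> > 0" and S: "S > 0"
  shows "centered_moment \<alpha> \<beta> c 0 S = tilted_laplace \<alpha> \<beta> 1 S"
    "centered_moment \<alpha> \<beta> c 1 S = tilted_laplace \<alpha> \<beta> 2 S - c * tilted_laplace \<alpha> \<beta> 1 S"
    "centered_moment \<alpha> \<beta> c 2 S = tilted_laplace \<alpha> \<beta> 3 S - 2 * c * tilted_laplace \<alpha> \<beta> 2 S + c\<^sup>2 * tilted_laplace \<alpha> \<beta> 1 S"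
    "centered_moment \<alpha> \<beta> c 3 S = tilted_laplace \<alpha> \<beta> 4 S - 3 * c * tilted_laplace \<alpha> \<beta> 3 S + 3 * c\<^sup>2 * tilted_laplace \<alpha> \<beta> 2 S - c ^ 3 * tilted_laplace \<alpha> \<beta> 1 S"
proof -
  let ?I = "\<lambda>j z. exp (- (2 * \<beta> * \<alpha>\<^sup>2 * z)) * ((1 / z) ^ j * exp (- (\<beta> * S / z)))"
  have i: "set_integrable lborel {0..1} (?I j)" for j by (rule laplace_integrable[OF continuous_on_tilt b S])
  have im: "set_integrable lborel {0..1} (\<lambda>z. r * ?I j z)" for j r by (rule set_integrable_mult_right[OF i])
  have l: "tilted_laplace \<alpha> \<beta> j S = (LBINT z:{0..1}. ?I j z)" for j by (simp add: tilted_laplace_def laplace_def)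
  have lm: "r * tilted_laplace \<alpha> \<beta> j S = (LBINT z:{0..1}. r * ?I j z)" for r j by (simp only: l set_integral_mult_right)
  have a1: "e * (R * f) * (R - c) ^ 1 = e * (R ^ 2 * f) - c * (e * (R ^ 1 * f))" for e R f :: real
    by (simp add: algebra_simps power2_eq_square)
  have a2: "e * (R * f) * (R - c) ^ 2 = e * (R ^ 3 * f) - (2 * c) * (e * (R ^ 2 * f)) + c\<^sup>2 * (e * (R ^ 1 * f))" for e R f :: real
    by (simp add: algebra_simps power2_eq_square power3_eq_cube)
  have a3: "e * (R * f) * (R - c) ^ 3 = e * (R ^ 4 * f) - (3 * c) * (e * (R ^ 3 * f)) + (3 * c\<^sup>2) * (e * (R ^ 2 * f)) - c ^ 3 * (e * (R ^ 1 * f))" for e R f :: real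
    by (simp add: algebra_simps power2_eq_square power3_eq_cube power4_eq_xxxx)
  show "centered_moment \<alpha> \<beta> c 0 S = tilted_laplace \<alpha> \<beta> 1 S" unfolding centered_moment_def l by simp
  show "centered_moment \<alpha> \<beta> c 1 S = tilted_laplace \<alpha> \<beta> 2 S - c * tilted_laplace \<alpha> \<beta> 1 S"
    unfolding lm l[of 2] centered_moment_def a1 by (rule set_integral_diff(2)[OF i im])
  show "centered_moment \<alpha> \<beta> c 2 S = tilted_laplace \<alpha> \<beta> 3 S - 2 * c * tilted_laplace \<alpha> \<beta> 2 S + c\<^sup>2 * tilted_laplace \<alpha> \<beta> 1 S"
    unfolding lm l[of 3] centered_moment_def a2
    by (subst set_integral_add(2)[OF set_integral_diff(1)[OF i im] im], subst set_integral_diff(2)[OF i im], rule refl)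
  show "centered_moment \<alpha> \<beta> c 3 S = tilted_laplace \<alpha> \<beta> 4 S - 3 * c * tilted_laplace \<alpha> \<beta> 3 S + 3 * c\<^sup>2 * tilted_laplace \<alpha> \<beta> 2 S - c ^ 3 * tilted_laplace \<alpha> \<beta> 1 S"
    unfolding lm l[of 4] centered_moment_def a3
    by (subst set_integral_diff(2)[OF set_integral_add(1)[OF set_integral_diff(1)[OF i im] im] im],
        subst set_integral_add(2)[OF set_integral_diff(1)[OF i im] im], subst set_integral_diff(2)[OF i im], rule refl)
qed

lemma centered_moment_bound:
  fixes \<alpha> a :: real and j :: nat
  assumes al: "\<alpha> > 0" and a: "a > 0"
  obtains C where "C > 0" "\<And>s x. 0 < s \<Longrightarrow> s \<le> 1 \<Longrightarrow> a \<le> x \<Longrightarrow>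
     \<bar>centered_moment \<alpha> (rate s) (\<alpha> / x) j (2 * x\<^sup>2)\<bar> \<le> C * s ^ (j + 1) * exp (- (2 * \<alpha> * x / s\<^sup>2))"
proof -
  obtain C where C: "C > 0" "\<And>s x z. 0 < s \<Longrightarrow> s \<le> 1 \<Longrightarrow> a \<le> x \<Longrightarrow> 0 < z \<Longrightarrow> z \<le> 1 \<Longrightarrow>
     (1 / z) ^ (j + 1) * (\<bar>x - \<alpha> * z\<bar> / s) ^ j * exp (- ((x - \<alpha> * z)\<^sup>2 / (s\<^sup>2 * z))) \<le> C * exp (- ((x - \<alpha> * z)\<^sup>2 / (2 * s\<^sup>2)))"
    using gauss_kernel_pointwise[OF al a, of "j + 1" j] by blast
  show ?thesis
  proof (rule that[of "C / a ^ j * (sqrt (2 * pi) / \<alpha>)"])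
    show "C / a ^ j * (sqrt (2 * pi) / \<alpha>) > 0" using C al a by simp
    fix s x :: real assume s: "0 < s" "s \<le> 1" and x: "a \<le> x"
    let ?\<beta> = "rate s"
    let ?E = "exp (- (2 * \<alpha> * x / s\<^sup>2))"
    let ?g = "\<lambda>z. exp (- ((x - \<alpha> * z)\<^sup>2 / (2 * s\<^sup>2)))"
    let ?f = "\<lambda>z. exp (- (2 * ?\<beta> * \<alpha>\<^sup>2 * z)) * ((1 / z) * exp (- (?\<beta> * (2 * x\<^sup>2) / z))) * (1 / z - \<alpha> / x) ^ j"
    have x0: "x > 0" using a x by simp
    have pw: "\<bar>?f z\<bar> \<le> ?E * (C / a ^ j * s ^ j) * ?g z" if z: "z \<in> {0..1}" for z
    proof (cases "z = 0")
      case True then show ?thesis using C a s by simp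
    next
      case False
      then have z0: "0 < z" "z \<le> 1" using z by auto
      have "1 / z - \<alpha> / x = (x - \<alpha> * z) / (x * z)" using z0 x0 by (simp add: field_simps)
      then have d: "\<bar>1 / z - \<alpha> / x\<bar> = (1 / x) * s * ((1 / z) * (\<bar>x - \<alpha> * z\<bar> / s))" using z0 x0 s by (simp add: abs_mult)
      have "?f z = (?E * ((1 / z) * exp (- ((x - \<alpha> * z)\<^sup>2 / (s\<^sup>2 * z))))) * (1 / z - \<alpha> / x) ^ j"
        using complete_the_square[OF refl, of z 1 s \<alpha> x] z0 by simp
      then have "\<bar>?f z\<bar> = (?E * ((1 / z) * exp (- ((x - \<alpha> * z)\<^sup>2 / (s\<^sup>2 * z))))) * \<bar>1 / z - \<alpha> / x\<bar> ^ j"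
        using z0 by (simp add: abs_mult power_abs)
      also have "\<dots> = ?E * (1 / x) ^ j * s ^ j * ((1 / z) ^ (j + 1) * (\<bar>x - \<alpha> * z\<bar> / s) ^ j * exp (- ((x - \<alpha> * z)\<^sup>2 / (s\<^sup>2 * z))))"
        unfolding d by (simp only: power_mult_distrib power_add power_one_right mult_ac)
      also have "\<dots> \<le> ?E * (1 / a) ^ j * s ^ j * (C * ?g z)"
      proof (rule mult_mono[OF _ C(2)[OF s x z0]])
        show "?E * (1 / x) ^ j * s ^ j \<le> ?E * (1 / a) ^ j * s ^ j"
          using s x0 a x by (intro mult_mono power_mono) (auto intro!: divide_left_mono)
      qed (use z0 s a in auto)
      also have "\<dots> = ?E * (C / a ^ j * s ^ j) * ?g z" by (simp add: power_one_over)
      finally show ?thesis .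
    qed
    have ig: "set_integrable lborel {0..1} (\<lambda>z. ?E * (C / a ^ j * s ^ j) * ?g z)"
      by (rule set_integrable_mult_right[OF gauss_window_integral(1)[OF al s(1)]])
    have if': "set_integrable lborel {0..1} ?f"
      unfolding set_integrable_def
    proof (rule Bochner_Integration.integrable_bound)
      show "integrable lborel (\<lambda>z. indicator {0..1} z *\<^sub>R (?E * (C / a ^ j * s ^ j) * ?g z))" using ig by (simp add: set_integrable_def)
      show "AE z in lborel. norm (indicator {0..1} z *\<^sub>R ?f z) \<le> norm (indicator {0..1} z *\<^sub>R (?E * (C / a ^ j * s ^ j) * ?g z))"
      proof (rule AE_I2)
        fix z :: real
        show "norm (indicator {0..1} z *\<^sub>R ?f z) \<le> norm (indicator {0..1} z *\<^sub>R (?E * (C / a ^ j * s ^ j) * ?g z))"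
        proof (cases "z \<in> {0..1}")
          case True
          have "norm (indicator {0..1} z *\<^sub>R ?f z) = \<bar>?f z\<bar>" using True by simp
          also note pw[OF True]
          also have "?E * (C / a ^ j * s ^ j) * ?g z \<le> norm (indicator {0..1} z *\<^sub>R (?E * (C / a ^ j * s ^ j) * ?g z))"
            using True by (metis abs_ge_self indicator_simps(1) real_norm_def real_scaleR_def mult_1)
          finally show ?thesis .
        qed simp
      qed
    qed measurable
    have "\<bar>centered_moment \<alpha> ?\<beta> (\<alpha> / x) j (2 * x\<^sup>2)\<bar> \<le> (LBINT z:{0..1}. \<bar>?f z\<bar>)"
      unfolding centered_moment_def using set_integral_norm_bound[OF if'] by simp
    also have "\<dots> \<le> (LBINT z:{0..1}. ?E * (C / a ^ j * s ^ j) * ?g z)"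
      by (rule set_integral_mono[OF set_integrable_abs[OF if'] ig pw])
    also have "\<dots> = ?E * (C / a ^ j * s ^ j) * (LBINT z:{0..1}. ?g z)" by (rule set_integral_mult_right)
    also have "\<dots> \<le> ?E * (C / a ^ j * s ^ j) * (sqrt (2 * pi) / \<alpha> * s)"
      using gauss_window_integral(2)[OF al s(1), of x] C a s by (intro mult_left_mono) auto
    also have "\<dots> = C / a ^ j * (sqrt (2 * pi) / \<alpha>) * s ^ (j + 1) * ?E" by simp
    finally show "\<bar>centered_moment \<alpha> ?\<beta> (\<alpha> / x) j (2 * x\<^sup>2)\<bar> \<le> C / a ^ j * (sqrt (2 * pi) / \<alpha>) * s ^ (j + 1) * ?E" .
  qed
qed

text \<open>Only the left half of the peak at \<open>z = x / \<alpha>\<close> is used, because for \<open>x\<close> near \<open>\<alpha>\<close> the right half lies outside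
the unit interval.\<close>

lemma kappa_lower:
  fixes \<alpha> a b :: real
  assumes al: "\<alpha> > 0" and a: "a > 0" and ab: "b \<le> \<alpha>"
  obtains c where "c > 0" "\<And>s x. 0 < s \<Longrightarrow> s \<le> 1 \<Longrightarrow> a \<le> x \<Longrightarrow> x \<le> b \<Longrightarrow>
     c * s * exp (- (2 * \<alpha> * x / s\<^sup>2)) \<le> kappa \<alpha> (rate s) (2 * x\<^sup>2)"
proof -
  \<comment> \<open>keeps the points \<open>\<alpha> z\<close> with \<open>x - h s \<le> \<alpha> z \<le> x\<close> above \<open>a / 2\<close>\<close>
  define h where "h = a / 2"
  have h: "h > 0" using a by (simp add: h_def)
  define c where "c = exp (- (h\<^sup>2 * (2 * \<alpha> / a))) * (h / \<alpha>)"
  show ?thesis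
  proof (rule that[of c])
    show "c > 0" unfolding c_def using h al by simp
    fix s x :: real assume s: "0 < s" "s \<le> 1" and x: "a \<le> x" "x \<le> b"
    let ?\<beta> = "rate s"
    let ?E = "exp (- (2 * \<alpha> * x / s\<^sup>2))"
    let ?I = "\<lambda>z. exp (- (2 * ?\<beta> * \<alpha>\<^sup>2 * z)) * ((1 / z) ^ 1 * exp (- (?\<beta> * (2 * x\<^sup>2) / z)))"
    let ?u = "(x - h * s) / \<alpha>" and ?v = "x / \<alpha>"
    let ?k = "?E * exp (- (h\<^sup>2 * (2 * \<alpha> / a)))"
    have x0: "x > 0" using a x by simp
    have hs: "h * s \<le> a / 2" using mult_left_mono[OF s(2), of h] h by (simp add: h_def)
    have u0: "?u > 0" using hs x a al by (intro divide_pos_pos) linarith+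
    have v1: "?v \<le> 1" using x ab al by (simp add: field_simps)
    have uv: "?u \<le> ?v" using h s al by (simp add: divide_right_mono)
    have sub: "{?u..?v} \<subseteq> {0..1}" using u0 v1 by auto
    have i: "set_integrable lborel {0..1} ?I" by (rule laplace_integrable[OF continuous_on_tilt]) (use s x0 in auto)
    have ii: "integrable lborel (\<lambda>z. indicator {0..1} z *\<^sub>R ?I z)" using i by (simp add: set_integrable_def)
    have "c * s * ?E = (LINT z|lborel. ?k * indicator {?u..?v} z)"
    proof -
      have "measure lborel {?u..?v} = h * s / \<alpha>" using uv by (simp add: diff_divide_distrib)
      then show ?thesis by (simp add: c_def del: measure_lborel_Icc)
    qed
    also have "\<dots> \<le> (LINT z|lborel. indicator {0..1} z *\<^sub>R ?I z)"
    proof (rule integral_mono[OF _ ii])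
      show "integrable lborel (\<lambda>z. ?k * indicator {?u..?v} z)"
        by (intro integrable_mult_right integrable_real_indicator) (simp_all add: emeasure_lborel_Icc_eq)
      fix z :: real
      show "?k * indicator {?u..?v} z \<le> indicator {0..1} z *\<^sub>R ?I z"
      proof (cases "z \<in> {?u..?v}")
        case False
        then have "?k * indicator {?u..?v} z = 0" by simp
        moreover have "0 \<le> indicator {0..1} z *\<^sub>R ?I z" by (auto simp: indicator_def)
        ultimately show ?thesis by simp
      next
        case True
        then have z: "?u \<le> z" "z \<le> ?v" "0 < z" "z \<le> 1" using u0 v1 by auto
        have az: "x - h * s \<le> \<alpha> * z" "\<alpha> * z \<le> x" using z(1,2) al by (simp_all add: field_simps)
        have za: "a / (2 * \<alpha>) \<le> z"
        proof -
          have "a / 2 \<le> \<alpha> * z" using az(1) hs x by linarith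
          then show ?thesis using al by (simp add: field_simps)
        qed
        have "(x - \<alpha> * z)\<^sup>2 \<le> (h * s)\<^sup>2" using az by (intro power_mono) auto
        then have "(x - \<alpha> * z)\<^sup>2 / s\<^sup>2 \<le> h\<^sup>2" using s by (simp add: divide_le_eq power_mult_distrib)
        moreover have "1 / z \<le> 2 * \<alpha> / a" using za al a z by (simp add: field_simps)
        ultimately have "(x - \<alpha> * z)\<^sup>2 / s\<^sup>2 * (1 / z) \<le> h\<^sup>2 * (2 * \<alpha> / a)" using z by (intro mult_mono) auto
        then have "exp (- (h\<^sup>2 * (2 * \<alpha> / a))) \<le> exp (- ((x - \<alpha> * z)\<^sup>2 / (s\<^sup>2 * z)))" by simp
        also have "\<dots> \<le> (1 / z) ^ 1 * exp (- ((x - \<alpha> * z)\<^sup>2 / (s\<^sup>2 * z)))" using z by (simp add: field_simps)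
        finally have "?k \<le> ?E * ((1 / z) ^ 1 * exp (- ((x - \<alpha> * z)\<^sup>2 / (s\<^sup>2 * z))))" by (intro mult_left_mono) auto
        also have "\<dots> = ?I z" using complete_the_square[OF refl, of z 1 s \<alpha> x] z by simp
        finally show ?thesis using True z by simp
      qed
    qed
    also have "\<dots> = kappa \<alpha> ?\<beta> (2 * x\<^sup>2)" by (simp add: kappa_def laplace_def set_lebesgue_integral_def)
    finally show "c * s * ?E \<le> kappa \<alpha> ?\<beta> (2 * x\<^sup>2)" .
  qed
qed

section \<open>Curvature of the logarithm of the covariance\<close>

lemma tilted_laplace_deriv:
  assumes "\<beta> > 0" "S > 0"
  shows "(tilted_laplace \<alpha> \<beta> j has_real_derivative (- \<beta> * tilted_laplace \<alpha> \<beta> (Suc j) S)) (at S)"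
  unfolding tilted_laplace_def by (rule laplace_deriv[OF continuous_on_tilt assms])

text \<open>The mean of \<open>(1 / z) ^ j\<close> for the probability measure proportional to the integrand of \<open>kappa\<close>.\<close>

definition tilted_moment :: "real \<Rightarrow> real \<Rightarrow> nat \<Rightarrow> real \<Rightarrow> real" where
  "tilted_moment \<alpha> \<beta> j S = tilted_laplace \<alpha> \<beta> (Suc j) S / kappa \<alpha> \<beta> S"

lemma kappa_eq_laplace: "kappa \<alpha> \<beta> S = tilted_laplace \<alpha> \<beta> 1 S" by (simp add: kappa_def tilted_laplace_def)

lemma tilted_moment_deriv:
  assumes b: "\<beta> > 0" and S: "S > 0"
  shows "(tilted_moment \<alpha> \<beta> j has_real_derivative (- \<beta> * (tilted_moment \<alpha> \<beta> (Suc j) S - tilted_moment \<alpha> \<beta> j S * tilted_moment \<alpha> \<beta> 1 S))) (at S)"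
proof -
  have k: "tilted_laplace \<alpha> \<beta> 1 S > 0" using kappa_pos[OF b S] kappa_eq_laplace by metis
  have d: "((\<lambda>S. tilted_laplace \<alpha> \<beta> (Suc j) S / tilted_laplace \<alpha> \<beta> 1 S) has_real_derivative
     ((- \<beta> * tilted_laplace \<alpha> \<beta> (Suc (Suc j)) S) * tilted_laplace \<alpha> \<beta> 1 S - tilted_laplace \<alpha> \<beta> (Suc j) S * (- \<beta> * tilted_laplace \<alpha> \<beta> (Suc 1) S)) / (tilted_laplace \<alpha> \<beta> 1 S * tilted_laplace \<alpha> \<beta> 1 S)) (at S)"
    by (rule DERIV_divide[OF tilted_laplace_deriv[OF b S] tilted_laplace_deriv[OF b S]]) (use k in simp)
  have alg: "((- b * L2) * L1 - Lj * (- b * M)) / (L1 * L1) = - b * (L2 / L1 - Lj / L1 * (M / L1))" if "L1 > 0" for b L2 L1 Lj M :: real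
    using that by (simp add: field_simps)
  show ?thesis unfolding tilted_moment_def[abs_def] kappa_eq_laplace by (rule DERIV_cong[OF d alg[OF k]])
qed

text \<open>The variance of \<open>\<beta> / z\<close> for that probability measure, which is the second derivative of \<open>ln kappa\<close>.\<close>

definition log_kappa_curv :: "real \<Rightarrow> real \<Rightarrow> real \<Rightarrow> real" where
  "log_kappa_curv \<alpha> \<beta> S = \<beta>\<^sup>2 * (tilted_moment \<alpha> \<beta> 2 S - (tilted_moment \<alpha> \<beta> 1 S)\<^sup>2)"

text \<open>The third cumulant of \<open>- \<beta> / z\<close>.\<close>

definition log_kappa_curv' :: "real \<Rightarrow> real \<Rightarrow> real \<Rightarrow> real" where
  "log_kappa_curv' \<alpha> \<beta> S = - (\<beta> ^ 3 * (tilted_moment \<alpha> \<beta> 3 S - 3 * tilted_moment \<alpha> \<beta> 1 S * tilted_moment \<alpha> \<beta> 2 S + 2 * (tilted_moment \<alpha> \<beta> 1 S) ^ 3))"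

lemma ln_kappa_deriv:
  assumes b: "\<beta> > 0" and S: "S > 0"
  shows "((\<lambda>S. ln (kappa \<alpha> \<beta> S)) has_real_derivative - \<beta> * tilted_moment \<alpha> \<beta> 1 S) (at S)"
    "((\<lambda>S. - \<beta> * tilted_moment \<alpha> \<beta> 1 S) has_real_derivative log_kappa_curv \<alpha> \<beta> S) (at S)"
    "(log_kappa_curv \<alpha> \<beta> has_real_derivative log_kappa_curv' \<alpha> \<beta> S) (at S)"
proof -
  have k: "tilted_laplace \<alpha> \<beta> 1 S > 0" using kappa_pos[OF b S] kappa_eq_laplace by metis
  have Suc: "Suc 1 = 2" "Suc 2 = 3" by auto
  have "((\<lambda>S. ln (tilted_laplace \<alpha> \<beta> 1 S)) has_real_derivative (- \<beta> * tilted_laplace \<alpha> \<beta> (Suc 1) S) / tilted_laplace \<alpha> \<beta> 1 S) (at S)"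
    using DERIV_chain2[OF DERIV_ln_divide[OF k] tilted_laplace_deriv[OF b S]] by simp
  then show "((\<lambda>S. ln (kappa \<alpha> \<beta> S)) has_real_derivative - \<beta> * tilted_moment \<alpha> \<beta> 1 S) (at S)"
    by (simp add: kappa_eq_laplace tilted_moment_def)
  show "((\<lambda>S. - \<beta> * tilted_moment \<alpha> \<beta> 1 S) has_real_derivative log_kappa_curv \<alpha> \<beta> S) (at S)"
    by (rule DERIV_cong[OF DERIV_cmult[OF tilted_moment_deriv[OF b S, of \<alpha> 1]]]) (simp add: log_kappa_curv_def power2_eq_square algebra_simps Suc del: One_nat_def)
  have d: "((\<lambda>S. \<beta>\<^sup>2 * (tilted_moment \<alpha> \<beta> 2 S - tilted_moment \<alpha> \<beta> 1 S * tilted_moment \<alpha> \<beta> 1 S)) has_real_derivative log_kappa_curv' \<alpha> \<beta> S) (at S)"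
    by (rule DERIV_cong[OF DERIV_cmult[OF DERIV_diff[OF tilted_moment_deriv[OF b S, of \<alpha> 2] DERIV_mult[OF tilted_moment_deriv[OF b S, of \<alpha> 1] tilted_moment_deriv[OF b S, of \<alpha> 1]]]]])
      (simp add: log_kappa_curv'_def power2_eq_square power3_eq_cube algebra_simps Suc del: One_nat_def)
  then show "(log_kappa_curv \<alpha> \<beta> has_real_derivative log_kappa_curv' \<alpha> \<beta> S) (at S)" by (simp add: log_kappa_curv_def[abs_def] power2_eq_square)
qed

lemma log_kappa_curv_nonneg:
  assumes b: "\<beta> > 0" and S: "S > 0"
  shows "log_kappa_curv \<alpha> \<beta> S \<ge> 0"
proof -
  have k: "tilted_laplace \<alpha> \<beta> 1 S > 0" using kappa_pos[OF b S] kappa_eq_laplace by metis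
  \<comment> \<open>about its mean, the second moment is the variance\<close>
  define c where "c = tilted_moment \<alpha> \<beta> 1 S"
  have "0 \<le> centered_moment \<alpha> \<beta> c 2 S" unfolding centered_moment_def set_lebesgue_integral_def
    by (intro Bochner_Integration.integral_nonneg) (auto simp: indicator_def)
  also have "\<dots> = tilted_laplace \<alpha> \<beta> 1 S * (tilted_moment \<alpha> \<beta> 2 S - (tilted_moment \<alpha> \<beta> 1 S)\<^sup>2)"
  proof -
    have "tilted_laplace \<alpha> \<beta> 3 S = tilted_moment \<alpha> \<beta> 2 S * tilted_laplace \<alpha> \<beta> 1 S" "tilted_laplace \<alpha> \<beta> 2 S = c * tilted_laplace \<alpha> \<beta> 1 S"
      using k by (simp_all add: tilted_moment_def kappa_eq_laplace c_def eval_nat_numeral)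
    then show ?thesis unfolding centered_moment_expand(3)[OF b S] by (simp add: c_def algebra_simps power2_eq_square del: One_nat_def)
  qed
  finally show ?thesis using k b by (simp add: log_kappa_curv_def zero_le_mult_iff)
qed

lemma kappa_bounds:
  fixes \<alpha> a b :: real
  assumes al: "\<alpha> > 0" and a: "a > 0" and ab: "b \<le> \<alpha>"
  obtains c C D where "c > 0" "C > 0" "D \<ge> 0"
    "\<And>s x. 0 < s \<Longrightarrow> s \<le> 1 \<Longrightarrow> a \<le> x \<Longrightarrow> x \<le> b \<Longrightarrow> c * s * exp (- (2 * \<alpha> * x / s\<^sup>2)) \<le> kappa \<alpha> (rate s) (2 * x\<^sup>2)"
    "\<And>s x. 0 < s \<Longrightarrow> s \<le> 1 \<Longrightarrow> a \<le> x \<Longrightarrow> x \<le> b \<Longrightarrow> kappa \<alpha> (rate s) (2 * x\<^sup>2) \<le> C * s * exp (- (2 * \<alpha> * x / s\<^sup>2))"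
    "\<And>s x j. 0 < s \<Longrightarrow> s \<le> 1 \<Longrightarrow> a \<le> x \<Longrightarrow> x \<le> b \<Longrightarrow> j \<in> {1,2,3} \<Longrightarrow> \<bar>centered_moment \<alpha> (rate s) (\<alpha> / x) j (2 * x\<^sup>2)\<bar> \<le> D * s ^ j * kappa \<alpha> (rate s) (2 * x\<^sup>2)"
proof -
  obtain c where c: "c > 0" "\<And>s x. 0 < s \<Longrightarrow> s \<le> 1 \<Longrightarrow> a \<le> x \<Longrightarrow> x \<le> b \<Longrightarrow>
     c * s * exp (- (2 * \<alpha> * x / s\<^sup>2)) \<le> kappa \<alpha> (rate s) (2 * x\<^sup>2)"
    using kappa_lower[OF al a ab] by blast
  have "\<exists>C>0. \<forall>s x. 0 < s \<longrightarrow> s \<le> 1 \<longrightarrow> a \<le> x \<longrightarrow>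
     \<bar>centered_moment \<alpha> (rate s) (\<alpha> / x) j (2 * x\<^sup>2)\<bar> \<le> C * s ^ (j + 1) * exp (- (2 * \<alpha> * x / s\<^sup>2))" for j
    using centered_moment_bound[OF al a, of j] by metis
  then obtain C where C: "\<And>j. C j > 0" "\<And>j s x. 0 < s \<Longrightarrow> s \<le> 1 \<Longrightarrow> a \<le> x \<Longrightarrow>
     \<bar>centered_moment \<alpha> (rate s) (\<alpha> / x) j (2 * x\<^sup>2)\<bar> \<le> C j * s ^ (j + 1) * exp (- (2 * \<alpha> * x / s\<^sup>2))" by metis
  define D where "D = (C 1 + C 2 + C 3) / c"
  show ?thesis
  proof (rule that[of c "C 0" D])
    show "c > 0" by (rule c)
    show "C 0 > 0" by (rule C)
    show "D \<ge> 0" unfolding D_def using C(1) c(1) by (simp add: add_nonneg_nonneg less_imp_le)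
    show "c * s * exp (- (2 * \<alpha> * x / s\<^sup>2)) \<le> kappa \<alpha> (rate s) (2 * x\<^sup>2)" if "0 < s" "s \<le> 1" "a \<le> x" "x \<le> b" for s x
      by (rule c(2)[OF that])
    show "kappa \<alpha> (rate s) (2 * x\<^sup>2) \<le> C 0 * s * exp (- (2 * \<alpha> * x / s\<^sup>2))" if "0 < s" "s \<le> 1" "a \<le> x" "x \<le> b" for s x
    proof -
      have "centered_moment \<alpha> (rate s) (\<alpha> / x) 0 (2 * x\<^sup>2) = kappa \<alpha> (rate s) (2 * x\<^sup>2)"
        unfolding kappa_eq_laplace by (rule centered_moment_expand(1)) (use that a in auto)
      then show ?thesis using C(2)[OF that(1-3), of 0] by simp
    qed
    fix s x :: real and j :: nat assume s: "0 < s" "s \<le> 1" and x: "a \<le> x" "x \<le> b" and j: "j \<in> {1, 2, 3}"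
    let ?E = "exp (- (2 * \<alpha> * x / s\<^sup>2))"
    have Cj: "C j \<le> D * c" unfolding D_def using c(1) C(1)[of 1] C(1)[of 2] C(1)[of 3] j by auto
    have "\<bar>centered_moment \<alpha> (rate s) (\<alpha> / x) j (2 * x\<^sup>2)\<bar> \<le> C j * s ^ (j + 1) * ?E" by (rule C(2)[OF s x(1)])
    also have "\<dots> \<le> (D * c) * s ^ (j + 1) * ?E" using Cj s by (intro mult_right_mono) auto
    also have "\<dots> = D * s ^ j * (c * s * ?E)" by simp
    also have "\<dots> \<le> D * s ^ j * kappa \<alpha> (rate s) (2 * x\<^sup>2)"
      using c(2)[OF s x] s \<open>D \<ge> 0\<close> by (intro mult_left_mono) auto
    finally show "\<bar>centered_moment \<alpha> (rate s) (\<alpha> / x) j (2 * x\<^sup>2)\<bar> \<le> D * s ^ j * kappa \<alpha> (rate s) (2 * x\<^sup>2)" .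
  qed
qed

text \<open>Cumulants of order at least 2 do not change under a shift, so they can be written in terms of the moments
about \<open>\<alpha> / x\<close>. The moments of order \<open>j\<close> are \<open>O(s ^ j)\<close>, while \<open>\<beta>\<close> is of order \<open>s\<^sup>-\<^sup>2\<close>.\<close>

lemma log_kappa_curv_bounds:
  fixes \<alpha> a b :: real
  assumes al: "\<alpha> > 0" and a: "a > 0" and ab: "b \<le> \<alpha>"
  obtains V T where "V \<ge> 0" "T \<ge> 0"
    "\<And>s S. 0 < s \<Longrightarrow> s \<le> 1 \<Longrightarrow> 2 * a\<^sup>2 \<le> S \<Longrightarrow> S \<le> 2 * b\<^sup>2 \<Longrightarrow> 0 \<le> b \<Longrightarrow> log_kappa_curv \<alpha> (rate s) S \<le> V / s\<^sup>2"
    "\<And>s S. 0 < s \<Longrightarrow> s \<le> 1 \<Longrightarrow> 2 * a\<^sup>2 \<le> S \<Longrightarrow> S \<le> 2 * b\<^sup>2 \<Longrightarrow> 0 \<le> b \<Longrightarrow> \<bar>log_kappa_curv' \<alpha> (rate s) S\<bar> \<le> T / s ^ 3"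
proof -
  obtain c C D where "c > 0" "C > 0" and D: "D \<ge> 0" and "\<And>s x. 0 < s \<Longrightarrow> s \<le> 1 \<Longrightarrow> a \<le> x \<Longrightarrow> x \<le> b \<Longrightarrow> c * s * exp (- (2 * \<alpha> * x / s\<^sup>2)) \<le> kappa \<alpha> (rate s) (2 * x\<^sup>2)"
    "\<And>s x. 0 < s \<Longrightarrow> s \<le> 1 \<Longrightarrow> a \<le> x \<Longrightarrow> x \<le> b \<Longrightarrow> kappa \<alpha> (rate s) (2 * x\<^sup>2) \<le> C * s * exp (- (2 * \<alpha> * x / s\<^sup>2))"
    and K: "\<And>s x j. 0 < s \<Longrightarrow> s \<le> 1 \<Longrightarrow> a \<le> x \<Longrightarrow> x \<le> b \<Longrightarrow> j \<in> {1,2,3} \<Longrightarrow> \<bar>centered_moment \<alpha> (rate s) (\<alpha> / x) j (2 * x\<^sup>2)\<bar> \<le> D * s ^ j * kappa \<alpha> (rate s) (2 * x\<^sup>2)"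
    using kappa_bounds[OF al a ab] by blast
  have core: "log_kappa_curv \<alpha> (rate s) S \<le> (D / 4) / s\<^sup>2 \<and> \<bar>log_kappa_curv' \<alpha> (rate s) S\<bar> \<le> ((D + 3 * D\<^sup>2 + 2 * D ^ 3) / 8) / s ^ 3"
    if s: "0 < s" "s \<le> 1" and S: "2 * a\<^sup>2 \<le> S" "S \<le> 2 * b\<^sup>2" and b0: "0 \<le> b" for s S
  proof -
    define x where "x = sqrt (S / 2)"
    define \<beta> where "\<beta> = rate s"
    have b: "\<beta> > 0" using s by (simp add: \<beta>_def)
    have S0: "S > 0" using S(1) a zero_less_power2[of a] by linarith
    have Sx: "S = 2 * x\<^sup>2" using S0 by (simp add: x_def)
    have x: "a \<le> x" "x \<le> b" unfolding x_def using S a b0 by (auto intro!: real_le_rsqrt real_le_lsqrt)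
    have k: "kappa \<alpha> \<beta> S > 0" by (rule kappa_pos[OF b S0])
    define c where "c = \<alpha> / x"
    define n where "n j = centered_moment \<alpha> \<beta> c j S / kappa \<alpha> \<beta> S" for j
    have n: "\<bar>n j\<bar> \<le> D * s ^ j" if "j \<in> {1,2,3}" for j
      using K[OF s x that] k unfolding n_def c_def Sx \<beta>_def by (simp add: abs_divide divide_le_eq)
    have n': "\<bar>n 1\<bar> \<le> D * s" "\<bar>n 2\<bar> \<le> D * s\<^sup>2" "\<bar>n 3\<bar> \<le> D * s ^ 3" using n[of 1] n[of 2] n[of 3] by auto
    have m: "tilted_moment \<alpha> \<beta> 1 S = n 1 + c" "tilted_moment \<alpha> \<beta> 2 S = n 2 + 2 * c * n 1 + c\<^sup>2"
      "tilted_moment \<alpha> \<beta> 3 S = n 3 + 3 * c * tilted_moment \<alpha> \<beta> 2 S - 3 * c\<^sup>2 * tilted_moment \<alpha> \<beta> 1 S + c ^ 3"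
      using k unfolding n_def tilted_moment_def centered_moment_expand[OF b S0] kappa_eq_laplace[symmetric]
      by (simp_all add: eval_nat_numeral add_divide_distrib diff_divide_distrib distrib_left right_diff_distrib)
    have v: "log_kappa_curv \<alpha> \<beta> S = \<beta>\<^sup>2 * (n 2 - (n 1)\<^sup>2)" unfolding log_kappa_curv_def m by (simp add: algebra_simps power2_eq_square)
    have t: "log_kappa_curv' \<alpha> \<beta> S = - (\<beta> ^ 3 * (n 3 - 3 * n 1 * n 2 + 2 * (n 1) ^ 3))" unfolding log_kappa_curv'_def m
      by (simp add: algebra_simps power2_eq_square power3_eq_cube)
    have "log_kappa_curv \<alpha> \<beta> S \<le> \<beta>\<^sup>2 * (D * s\<^sup>2)" unfolding v
    proof (rule mult_left_mono)
      show "n 2 - (n 1)\<^sup>2 \<le> D * s\<^sup>2" using n'(2) zero_le_power2[of "n 1"] abs_ge_self[of "n 2"] by linarith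
    qed simp
    also have "\<dots> = (D / 4) / s\<^sup>2" using s by (simp add: \<beta>_def field_simps power2_eq_square)
    finally have 1: "log_kappa_curv \<alpha> \<beta> S \<le> (D / 4) / s\<^sup>2" .
    have "\<bar>n 3 - 3 * n 1 * n 2 + 2 * (n 1) ^ 3\<bar> \<le> \<bar>n 3\<bar> + 3 * (\<bar>n 1\<bar> * \<bar>n 2\<bar>) + 2 * \<bar>n 1\<bar> ^ 3"
    proof -
      have "\<bar>n 3 - 3 * n 1 * n 2 + 2 * (n 1) ^ 3\<bar> \<le> \<bar>n 3\<bar> + \<bar>3 * n 1 * n 2\<bar> + \<bar>2 * (n 1) ^ 3\<bar>" by linarith
      then show ?thesis by (simp add: abs_mult power_abs)
    qed
    also have "\<dots> \<le> D * s ^ 3 + 3 * ((D * s) * (D * s\<^sup>2)) + 2 * (D * s) ^ 3"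
      using n' D s by (intro add_mono mult_left_mono mult_mono power_mono) auto
    also have "\<dots> = (D + 3 * D\<^sup>2 + 2 * D ^ 3) * s ^ 3" by (simp add: algebra_simps power2_eq_square power3_eq_cube)
    finally have "\<beta> ^ 3 * \<bar>n 3 - 3 * n 1 * n 2 + 2 * (n 1) ^ 3\<bar> \<le> \<beta> ^ 3 * ((D + 3 * D\<^sup>2 + 2 * D ^ 3) * s ^ 3)" using b by (intro mult_left_mono) auto
    also have "\<dots> = ((D + 3 * D\<^sup>2 + 2 * D ^ 3) / 8) / s ^ 3" using s by (simp add: \<beta>_def field_simps power2_eq_square power3_eq_cube)
    finally have "\<bar>log_kappa_curv' \<alpha> \<beta> S\<bar> \<le> ((D + 3 * D\<^sup>2 + 2 * D ^ 3) / 8) / s ^ 3" unfolding t abs_minus_cancel abs_mult using b by simp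
    then show ?thesis using 1 by (simp add: \<beta>_def)
  qed
  show ?thesis
    by (rule that[of "D / 4" "(D + 3 * D\<^sup>2 + 2 * D ^ 3) / 8"]) (use core D in auto)
qed

section \<open>Angles and inscribed polygons\<close>

text \<open>Rolle's theorem for the symmetric second difference minus its quadratic interpolation in the step, followed
by the mean value theorem for \<open>f'\<close>.\<close>

lemma second_difference:
  fixes f f' f'' :: "real \<Rightarrow> real"
  assumes uv: "u < v"
    and d1: "\<And>x. x \<in> {u..v} \<Longrightarrow> (f has_real_derivative f' x) (at x)"
    and d2: "\<And>x. x \<in> {u..v} \<Longrightarrow> (f' has_real_derivative f'' x) (at x)"
  obtains \<xi> where "u < \<xi>" "\<xi> < v" "f u + f v - 2 * f ((u + v) / 2) = ((v - u) / 2)\<^sup>2 * f'' \<xi>"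
proof -
  define m where "m = (u + v) / 2"
  define d where "d = (v - u) / 2"
  have d0: "d > 0" using uv by (simp add: d_def)
  have md: "m + d = v" "m - d = u" by (simp_all add: m_def d_def field_simps)
  have mem: "m + h \<in> {u..v}" "m - h \<in> {u..v}" if "0 \<le> h" "h \<le> d" for h using that md by auto
  define g where "g h = f (m + h) + f (m - h) - 2 * f m" for h
  define \<phi> where "\<phi> h = g h - h\<^sup>2 * (g d / d\<^sup>2)" for h
  have dg: "(g has_real_derivative f' (m + h) - f' (m - h)) (at h)" if "0 \<le> h" "h \<le> d" for h
  proof -
    have 1: "((\<lambda>h. f (m + h)) has_real_derivative f' (m + h) * 1) (at h)"
      by (rule DERIV_chain2[where f=f and g="\<lambda>h. m + h", OF d1[OF mem(1)[OF that]]]) (auto intro!: derivative_eq_intros)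
    have 2: "((\<lambda>h. f (m - h)) has_real_derivative f' (m - h) * (- 1)) (at h)"
      by (rule DERIV_chain2[where f=f and g="\<lambda>h. m - h", OF d1[OF mem(2)[OF that]]]) (auto intro!: derivative_eq_intros)
    have 3: "((\<lambda>h. f (m + h) + f (m - h) - 2 * f m) has_real_derivative f' (m + h) * 1 + f' (m - h) * (- 1) - 0) (at h)"
      by (rule DERIV_diff[OF DERIV_add[OF 1 2] DERIV_const])
    then show ?thesis by (simp add: g_def[abs_def])
  qed
  have dp: "(\<phi> has_real_derivative f' (m + h) - f' (m - h) - 2 * h * (g d / d\<^sup>2)) (at h)" if "0 \<le> h" "h \<le> d" for h
  proof -
    have "((\<lambda>h. h\<^sup>2 * c) has_real_derivative 2 * h * c) (at h)" for c by (auto intro!: derivative_eq_intros)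
    then show ?thesis unfolding \<phi>_def[abs_def] by (rule DERIV_diff[OF dg[OF that]])
  qed
  have "\<exists>h>0. h < d \<and> (\<phi> has_real_derivative 0) (at h)"
  proof (rule Rolle[OF d0])
    show "\<phi> 0 = \<phi> d" using d0 by (simp add: \<phi>_def g_def)
    show "continuous_on {0..d} \<phi>" using dp by (intro continuous_at_imp_continuous_on ballI DERIV_isCont) auto
    show "\<phi> differentiable (at h)" if "0 < h" "h < d" for h using dp[of h] that by (auto simp: real_differentiable_def)
  qed
  then obtain h where h: "0 < h" "h < d" "(\<phi> has_real_derivative 0) (at h)" by blast
  have e1: "f' (m + h) - f' (m - h) = 2 * h * (g d / d\<^sup>2)" using DERIV_unique[OF h(3) dp[of h]] h by simp
  have "\<exists>z. m - h < z \<and> z < m + h \<and> f' (m + h) - f' (m - h) = ((m + h) - (m - h)) * f'' z"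
  proof (rule MVT2)
    show "m - h < m + h" using h by simp
    fix x assume "m - h \<le> x" "x \<le> m + h"
    then show "(f' has_real_derivative f'' x) (at x)" using h md by (intro d2) auto
  qed
  then obtain z where z: "m - h < z" "z < m + h" "f' (m + h) - f' (m - h) = 2 * h * f'' z" by auto
  have "g d = d\<^sup>2 * f'' z" using e1 z(3) h d0 by (simp add: field_simps)
  then have "f v + f u - 2 * f m = d\<^sup>2 * f'' z" by (simp add: g_def md)
  then have "f u + f v - 2 * f ((u + v) / 2) = ((v - u) / 2)\<^sup>2 * f'' z" unfolding m_def d_def by (metis add.commute)
  then show ?thesis using z h md by (intro that[of z]) auto
qed

lemma cos_le_exp_neg_square:
  fixes D :: real assumes "0 \<le> D" "D \<le> pi" shows "cos D \<le> exp (- (D\<^sup>2 / 2))"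
proof -
  have g: "D * cos D - sin D \<le> 0" if D: "0 \<le> D" "D \<le> pi" for D :: real
  proof -
    have "(\<lambda>D. D * cos D - sin D) D \<le> (\<lambda>D. D * cos D - sin D) 0"
    proof (rule DERIV_nonpos_imp_nonincreasing[OF D(1)])
      fix x :: real assume x: "0 \<le> x" "x \<le> D"
      show "\<exists>y. ((\<lambda>D. D * cos D - sin D) has_real_derivative y) (at x) \<and> y \<le> 0"
        using x D sin_ge_zero[of x] by (intro exI[of _ "- (x * sin x)"] conjI) (auto intro!: derivative_eq_intros)
    qed
    then show ?thesis by simp
  qed
  have "(\<lambda>D. cos D * exp (D\<^sup>2 / 2)) D \<le> (\<lambda>D. cos D * exp (D\<^sup>2 / 2)) 0"
  proof (rule DERIV_nonpos_imp_nonincreasing[OF assms(1)])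
    fix x :: real assume x: "0 \<le> x" "x \<le> D"
    have "((\<lambda>D. cos D * exp (D\<^sup>2 / 2)) has_real_derivative exp (x\<^sup>2 / 2) * (x * cos x - sin x)) (at x)"
      by (auto intro!: derivative_eq_intros simp: algebra_simps)
    moreover have "exp (x\<^sup>2 / 2) * (x * cos x - sin x) \<le> 0" using g[of x] x assms by (intro mult_nonneg_nonpos) auto
    ultimately show "\<exists>y. ((\<lambda>D. cos D * exp (D\<^sup>2 / 2)) has_real_derivative y) (at x) \<and> y \<le> 0" by blast
  qed
  then show ?thesis by (simp add: exp_minus field_simps)
qed

lemma arccos_exp_upper:
  fixes D :: real assumes "0 \<le> D" shows "arccos (exp (- (D\<^sup>2 / 2))) \<le> D"
proof (cases "D \<le> pi")
  case True
  have "arccos (exp (- (D\<^sup>2 / 2))) \<le> arccos (cos D)"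
    by (rule arccos_le_arccos) (use cos_le_exp_neg_square[OF assms True] in auto)
  then show ?thesis using True assms by (simp add: arccos_cos)
next
  case False
  have "arccos (exp (- (D\<^sup>2 / 2))) \<le> pi" by (intro arccos_ubound) (auto intro: order_trans[of _ 0])
  then show ?thesis using False by simp
qed

text \<open>An angle is at least the chord it subtends, \<open>sqrt (2 - 2 cos t)\<close>.\<close>

lemma arccos_exp_lower:
  fixes D :: real assumes D: "0 \<le> D" shows "D - D ^ 3 / 4 \<le> arccos (exp (- (D\<^sup>2 / 2)))"
proof -
  define u where "u = D\<^sup>2 / 2"
  define t where "t = arccos (exp (- u))"
  have u0: "u \<ge> 0" by (simp add: u_def)
  have e01: "-1 \<le> exp (- u)" "exp (- u) \<le> 1" using u0 by (auto intro: order_trans[of _ 0])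
  have t0: "0 \<le> t" unfolding t_def by (rule arccos_lbound[OF e01])
  have ct: "cos t = exp (- u)" unfolding t_def using e01 by simp
  show ?thesis
  proof (cases "D \<le> 2")
    case False
    then have "D * 1 \<le> D * (D\<^sup>2 / 4)" using D by (intro mult_left_mono) (auto simp: power2_eq_square intro: order_trans[OF _ mult_mono[of 2 D 2 D]])
    then have "D - D ^ 3 / 4 \<le> 0" by (simp add: power2_eq_square power3_eq_cube)
    then show ?thesis using t0 by (simp add: t_def u_def)
  next
    case True
    have q: "D\<^sup>2 / 4 \<le> 1" using True D power_mono[of D 2 2] by simp
    have "exp (- u) \<le> 1 - u + u\<^sup>2 / 2"
      using order_trans[OF abs_ge_self exp_second_order[of "- u"]] u0 by (simp add: max_def)
    moreover have "2 - 2 * cos t \<le> t\<^sup>2"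
    proof -
      have "cos t = 1 - 2 * (sin (t / 2))\<^sup>2" using cos_double_sin[of "t / 2"] by simp
      moreover have "(sin (t / 2))\<^sup>2 \<le> (t / 2)\<^sup>2" using abs_sin_x_le_abs_x[of "t / 2"] by (simp add: abs_le_square_iff[symmetric])
      ultimately show ?thesis by (simp add: power_divide)
    qed
    ultimately have "2 * u - u\<^sup>2 \<le> t\<^sup>2" unfolding ct by linarith
    moreover have "(D - D ^ 3 / 4)\<^sup>2 \<le> 2 * u - u\<^sup>2"
    proof -
      have "(D - D ^ 3 / 4)\<^sup>2 = D\<^sup>2 * (1 - D\<^sup>2 / 4)\<^sup>2" by (simp add: algebra_simps power2_eq_square power3_eq_cube)
      also have "\<dots> \<le> D\<^sup>2 * (1 - D\<^sup>2 / 4)"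
        using q by (intro mult_left_mono) (auto simp: power2_eq_square intro!: mult_left_le)
      also have "\<dots> = 2 * u - u\<^sup>2" by (simp add: u_def algebra_simps power2_eq_square)
      finally show ?thesis .
    qed
    ultimately have "(D - D ^ 3 / 4)\<^sup>2 \<le> t\<^sup>2" by linarith
    then have "D - D ^ 3 / 4 \<le> t" using t0 by (rule power2_le_imp_le)
    then show ?thesis by (simp add: t_def u_def)
  qed
qed

text \<open>Minus the logarithm of the correlation is half a second difference of \<open>ln kappa\<close> over the interval from \<open>2 p\<close> to
\<open>2 q\<close>.\<close>

lemma field_angle_curv:
  assumes b: "\<beta> > 0" and p: "0 < p" "p < q"
  obtains \<xi> where "2 * p < \<xi>" "\<xi> < 2 * q" "field_angle \<alpha> \<beta> p q = arccos (exp (- (((q - p) * sqrt (log_kappa_curv \<alpha> \<beta> \<xi>))\<^sup>2 / 2)))"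
proof -
  let ?l = "\<lambda>S. ln (kappa \<alpha> \<beta> S)"
  obtain \<xi> where x: "2 * p < \<xi>" "\<xi> < 2 * q" "?l (2 * p) + ?l (2 * q) - 2 * ?l ((2 * p + 2 * q) / 2) = ((2 * q - 2 * p) / 2)\<^sup>2 * log_kappa_curv \<alpha> \<beta> \<xi>"
    by (rule second_difference[of "2 * p" "2 * q" ?l "\<lambda>S. - \<beta> * tilted_moment \<alpha> \<beta> 1 S" "log_kappa_curv \<alpha> \<beta>"])
      (use p ln_kappa_deriv[OF b] in auto)
  have k: "kappa \<alpha> \<beta> (2 * p) > 0" "kappa \<alpha> \<beta> (2 * q) > 0" "kappa \<alpha> \<beta> (p + q) > 0" using p by (auto intro!: kappa_pos[OF b])
  have e: "?l (2 * p) + ?l (2 * q) - 2 * ?l (p + q) = (q - p)\<^sup>2 * log_kappa_curv \<alpha> \<beta> \<xi>"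
    using x(3) by (simp add: diff_divide_distrib add_divide_distrib)
  have "kappa \<alpha> \<beta> (p + q) / sqrt (kappa \<alpha> \<beta> (2 * p) * kappa \<alpha> \<beta> (2 * q)) = exp (?l (p + q) - (?l (2 * p) + ?l (2 * q)) / 2)"
  proof -
    have "sqrt (kappa \<alpha> \<beta> (2 * p) * kappa \<alpha> \<beta> (2 * q)) = exp ((?l (2 * p) + ?l (2 * q)) / 2)"
    proof (rule real_sqrt_unique)
      have "(exp ((?l (2 * p) + ?l (2 * q)) / 2))\<^sup>2 = exp (?l (2 * p) + ?l (2 * q))" by (simp add: power2_eq_square exp_add[symmetric])
      also have "\<dots> = kappa \<alpha> \<beta> (2 * p) * kappa \<alpha> \<beta> (2 * q)" using k by (simp add: exp_add)
      finally show "(exp ((?l (2 * p) + ?l (2 * q)) / 2))\<^sup>2 = kappa \<alpha> \<beta> (2 * p) * kappa \<alpha> \<beta> (2 * q)" .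
    qed simp
    then show ?thesis using k by (simp add: exp_diff)
  qed
  also have "?l (p + q) - (?l (2 * p) + ?l (2 * q)) / 2 = - (((q - p) * sqrt (log_kappa_curv \<alpha> \<beta> \<xi>))\<^sup>2 / 2)"
  proof -
    have "((q - p) * sqrt (log_kappa_curv \<alpha> \<beta> \<xi>))\<^sup>2 = (q - p)\<^sup>2 * log_kappa_curv \<alpha> \<beta> \<xi>"
      using log_kappa_curv_nonneg[OF b, of \<xi> \<alpha>] x p by (simp add: power_mult_distrib)
    moreover have "l - (u + v) / 2 = - (Y / 2)" if "u + v - 2 * l = Y" for l u v Y :: real using that by (simp add: field_simps)
    ultimately show ?thesis using e by metis
  qed
  finally show ?thesis using x(1,2) by (intro that[of \<xi>]) (simp_all add: field_angle_def)
qed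

lemma field_angle_bounds:
  assumes b: "\<beta> > 0" and p: "0 < p" "p < q"
  obtains \<xi> where "2 * p < \<xi>" "\<xi> < 2 * q" "field_angle \<alpha> \<beta> p q \<le> (q - p) * sqrt (log_kappa_curv \<alpha> \<beta> \<xi>)"
    "(q - p) * sqrt (log_kappa_curv \<alpha> \<beta> \<xi>) - ((q - p) * sqrt (log_kappa_curv \<alpha> \<beta> \<xi>)) ^ 3 / 4 \<le> field_angle \<alpha> \<beta> p q"
proof -
  obtain \<xi> where x: "2 * p < \<xi>" "\<xi> < 2 * q" "field_angle \<alpha> \<beta> p q = arccos (exp (- (((q - p) * sqrt (log_kappa_curv \<alpha> \<beta> \<xi>))\<^sup>2 / 2)))"
    using field_angle_curv[OF b p, where \<alpha>=\<alpha>] by blast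
  have "(q - p) * sqrt (log_kappa_curv \<alpha> \<beta> \<xi>) \<ge> 0" using p log_kappa_curv_nonneg[OF b, of \<xi> \<alpha>] x by simp
  then show ?thesis using x arccos_exp_upper arccos_exp_lower by (intro that[of \<xi>]) auto
qed

text \<open>Within one cell of the coarse grid the speed \<open>sqrt (log_kappa_curv \<xi>)\<close> of the curve varies by at most the square
root of the oscillation of \<open>log_kappa_curv\<close>. In units of \<open>s\<close>, with \<open>y\<close> the mesh, the arc over a cell and
the chord across it differ by \<open>O(y powr (3/2))\<close>, which is small compared with \<open>y\<close>.\<close>

lemma grid_length_refine:
  fixes \<alpha> a b :: real
  assumes al: "\<alpha> > 0" and a: "a > 0" and ab: "a < b" "b \<le> \<alpha>"
  obtains V T where "V \<ge> 0" "T \<ge> 0" "\<And>s m k. 0 < s \<Longrightarrow> s \<le> 1 \<Longrightarrow> m > 0 \<Longrightarrow> k > 0 \<Longrightarrow>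
     grid_length \<alpha> (rate s) (a\<^sup>2) (b\<^sup>2) (m * k) \<le> grid_length \<alpha> (rate s) (a\<^sup>2) (b\<^sup>2) m
       + real m * (2 * ((b\<^sup>2 - a\<^sup>2) / (m * s)) * sqrt (2 * T * ((b\<^sup>2 - a\<^sup>2) / (m * s))) + ((b\<^sup>2 - a\<^sup>2) / (m * s) * sqrt V) ^ 3 / 4)"
proof -
  obtain V T where V: "V \<ge> 0" "T \<ge> 0"
    and cV: "\<And>s S. 0 < s \<Longrightarrow> s \<le> 1 \<Longrightarrow> 2 * a\<^sup>2 \<le> S \<Longrightarrow> S \<le> 2 * b\<^sup>2 \<Longrightarrow> 0 \<le> b \<Longrightarrow> log_kappa_curv \<alpha> (rate s) S \<le> V / s\<^sup>2"
    and cT: "\<And>s S. 0 < s \<Longrightarrow> s \<le> 1 \<Longrightarrow> 2 * a\<^sup>2 \<le> S \<Longrightarrow> S \<le> 2 * b\<^sup>2 \<Longrightarrow> 0 \<le> b \<Longrightarrow> \<bar>log_kappa_curv' \<alpha> (rate s) S\<bar> \<le> T / s ^ 3"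
    by (rule log_kappa_curv_bounds[OF al a ab(2)]) blast
  define A where "A = a\<^sup>2"
  define B where "B = b\<^sup>2"
  have AB: "0 < A" "A < B" using a ab by (auto simp: A_def B_def power_strict_mono)
  have b0: "0 \<le> b" using a ab by simp
  show ?thesis
  proof (rule that[OF V])
    fix s :: real and m k :: nat assume s: "0 < s" "s \<le> 1" and m: "m > 0" and k: "k > 0"
    define \<beta> where "\<beta> = rate s"
    have b: "\<beta> > 0" using s by (simp add: \<beta>_def)
    define d where "d = (B - A) / m"
    define y where "y = (B - A) / (m * s)"
    have d0: "d > 0" using AB m by (simp add: d_def)
    have yd: "y = d / s" by (simp add: y_def d_def)
    have mk: "m * k > 0" using m k by simp
    let ?g = "grid A B m" and ?h = "grid A B (m * k)"
    have h: "?h (i * k + j) = ?g i + d / k * j" for i j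
      using m k by (simp add: grid_def d_def field_simps)
    define e where "e = T / s ^ 3 * (2 * d)"
    have e0: "e \<ge> 0" using V s d0 by (simp add: e_def)
    define U where "U i = log_kappa_curv \<alpha> \<beta> (2 * ?g i)" for i
    have cell: "?g i \<in> {A..B}" "?g (Suc i) \<in> {A..B}" if "i < m" for i using grid_in[of A B i m] grid_in[of A B "Suc i" m] that AB m by auto
    have U0: "U i \<ge> 0" if "i < m" for i unfolding U_def using cell[OF that] AB by (intro log_kappa_curv_nonneg[OF b]) auto
    have osc: "\<bar>log_kappa_curv \<alpha> \<beta> \<xi> - U i\<bar> \<le> e" if i: "i < m" and xi: "2 * ?g i < \<xi>" "\<xi> < 2 * ?g (Suc i)" for i \<xi>
    proof -
      have "\<exists>z. 2 * ?g i < z \<and> z < \<xi> \<and> log_kappa_curv \<alpha> \<beta> \<xi> - log_kappa_curv \<alpha> \<beta> (2 * ?g i) = (\<xi> - 2 * ?g i) * log_kappa_curv' \<alpha> \<beta> z"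
        by (rule MVT2[OF xi(1)]) (use cell[OF i] AB in \<open>auto intro!: ln_kappa_deriv(3)[OF b]\<close>)
      then obtain z where z: "2 * ?g i < z" "z < \<xi>" "log_kappa_curv \<alpha> \<beta> \<xi> - U i = (\<xi> - 2 * ?g i) * log_kappa_curv' \<alpha> \<beta> z" by (auto simp: U_def)
      have "\<bar>log_kappa_curv' \<alpha> \<beta> z\<bar> \<le> T / s ^ 3" unfolding \<beta>_def using z xi cell[OF i] by (intro cT s b0) (auto simp: A_def B_def)
      moreover have "\<bar>\<xi> - 2 * ?g i\<bar> \<le> 2 * d" using xi grid_Suc[of A B m i] by (simp add: d_def)
      ultimately show ?thesis unfolding z(3) e_def abs_mult mult.commute[of "T / s ^ 3"] by (intro mult_mono) (use d0 in auto)
    qed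
    have fine: "(\<Sum>j<k. field_angle \<alpha> \<beta> (?h (i * k + j)) (?h (Suc (i * k + j)))) \<le> d * (sqrt (U i) + sqrt e)" if i: "i < m" for i
    proof -
      have "(\<Sum>j<k. field_angle \<alpha> \<beta> (?h (i * k + j)) (?h (Suc (i * k + j)))) \<le> (\<Sum>j<k. d / k * (sqrt (U i) + sqrt e))"
      proof (rule sum_mono)
        fix j assume "j \<in> {..<k}"
        then have j: "j < k" by simp
        let ?p = "?h (i * k + j)" and ?q = "?h (Suc (i * k + j))"
        have q: "?q = ?p + d / k" using k unfolding grid_Suc by (simp add: d_def)
        have dk: "d / k > 0" using d0 k by simp
        have "0 \<le> d / k * j" using dk by (intro mult_nonneg_nonneg) auto
        then have pg: "?g i \<le> ?p" unfolding h by simp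
        have qg: "?q \<le> ?g (Suc i)"
        proof -
          have "d / k * (real j + 1) \<le> d / k * real k" using j dk by (intro mult_left_mono) auto
          also have "\<dots> = d" using k by simp
          finally show ?thesis unfolding q h grid_Suc[of A B m i] d_def[symmetric] by (simp add: distrib_left)
        qed
        have p0: "?p > 0" using pg cell(1)[OF i] AB by auto
        obtain \<xi> where x: "2 * ?p < \<xi>" "\<xi> < 2 * ?q" "field_angle \<alpha> \<beta> ?p ?q \<le> (?q - ?p) * sqrt (log_kappa_curv \<alpha> \<beta> \<xi>)"
          using field_angle_bounds[OF b p0, of ?q \<alpha>] q dk by (metis less_add_same_cancel1)
        have "log_kappa_curv \<alpha> \<beta> \<xi> \<le> U i + e" using osc[OF i, of \<xi>] x pg qg by (auto simp: abs_le_iff)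
        then have "sqrt (log_kappa_curv \<alpha> \<beta> \<xi>) \<le> sqrt (U i + e)" by simp
        also have "\<dots> \<le> sqrt (U i) + sqrt e" using U0[OF i] e0 by (rule sqrt_add_le_add_sqrt)
        finally have "(?q - ?p) * sqrt (log_kappa_curv \<alpha> \<beta> \<xi>) \<le> d / k * (sqrt (U i) + sqrt e)" unfolding q using dk by (simp del: times_divide_eq_left)
        then show "field_angle \<alpha> \<beta> ?p ?q \<le> d / k * (sqrt (U i) + sqrt e)" using x(3) by linarith
      qed
      also have "\<dots> = d * (sqrt (U i) + sqrt e)" using k by simp
      finally show ?thesis .
    qed
    have coarse: "d * (sqrt (U i) - sqrt e) - (y * sqrt V) ^ 3 / 4 \<le> field_angle \<alpha> \<beta> (?g i) (?g (Suc i))" if i: "i < m" for i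
    proof -
      have g: "?g (Suc i) - ?g i = d" using grid_Suc[of A B m i] by (simp add: d_def)
      have lt: "?g i < ?g (Suc i)" using g d0 by linarith
      have g0: "0 < ?g i" using cell(1)[OF i] AB by auto
      obtain \<xi> where x: "2 * ?g i < \<xi>" "\<xi> < 2 * ?g (Suc i)" 
        "d * sqrt (log_kappa_curv \<alpha> \<beta> \<xi>) - (d * sqrt (log_kappa_curv \<alpha> \<beta> \<xi>)) ^ 3 / 4 \<le> field_angle \<alpha> \<beta> (?g i) (?g (Suc i))"
        using field_angle_bounds[OF b g0 lt, where \<alpha>=\<alpha>] unfolding g by blast
      have c0: "log_kappa_curv \<alpha> \<beta> \<xi> \<ge> 0" using x g0 by (intro log_kappa_curv_nonneg[OF b]) linarith
      have "sqrt (U i) \<le> sqrt (log_kappa_curv \<alpha> \<beta> \<xi> + e)" using osc[OF i x(1,2)] by (auto simp: abs_le_iff)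
      also have "\<dots> \<le> sqrt (log_kappa_curv \<alpha> \<beta> \<xi>) + sqrt e" using c0 e0 by (rule sqrt_add_le_add_sqrt)
      finally have "d * (sqrt (U i) - sqrt e) \<le> d * sqrt (log_kappa_curv \<alpha> \<beta> \<xi>)" using d0 by (intro mult_left_mono) auto
      moreover have "(d * sqrt (log_kappa_curv \<alpha> \<beta> \<xi>)) ^ 3 \<le> (y * sqrt V) ^ 3"
      proof (rule power_mono)
        have "log_kappa_curv \<alpha> \<beta> \<xi> \<le> V / s\<^sup>2" unfolding \<beta>_def using x cell[OF i] by (intro cV s b0) (auto simp: A_def B_def)
        then have "sqrt (log_kappa_curv \<alpha> \<beta> \<xi>) \<le> sqrt (V / s\<^sup>2)" by simp
        also have "\<dots> = sqrt V / s" using s by (simp add: real_sqrt_divide)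
        finally have "d * sqrt (log_kappa_curv \<alpha> \<beta> \<xi>) \<le> d * (sqrt V / s)" using d0 by (intro mult_left_mono) auto
        then show "d * sqrt (log_kappa_curv \<alpha> \<beta> \<xi>) \<le> y * sqrt V" by (simp add: yd)
        show "0 \<le> d * sqrt (log_kappa_curv \<alpha> \<beta> \<xi>)" using d0 c0 by simp
      qed
      ultimately show ?thesis using x(3) by linarith
    qed
    have de: "d * sqrt e = y * sqrt (2 * T * y)"
    proof -
      have "e = 2 * T * y / s\<^sup>2" using s by (simp add: e_def yd power2_eq_square power3_eq_cube mult.assoc)
      then have "sqrt e = sqrt (2 * T * y) / s" using s by (simp add: real_sqrt_divide)
      then show ?thesis by (simp add: yd)
    qed
    have "grid_length \<alpha> \<beta> A B (m * k) = (\<Sum>i<m. \<Sum>n\<in>{i * k..<i * k + k}. field_angle \<alpha> \<beta> (?h n) (?h (Suc n)))"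
      unfolding grid_length_def by (rule sum.nat_group[symmetric])
    also have "\<dots> = (\<Sum>i<m. \<Sum>j<k. field_angle \<alpha> \<beta> (?h (i * k + j)) (?h (Suc (i * k + j))))"
    proof (rule sum.cong[OF refl])
      fix i
      show "(\<Sum>n\<in>{i * k..<i * k + k}. field_angle \<alpha> \<beta> (?h n) (?h (Suc n))) = (\<Sum>j<k. field_angle \<alpha> \<beta> (?h (i * k + j)) (?h (Suc (i * k + j))))"
        by (rule sum.reindex_bij_witness[where i="\<lambda>j. i * k + j" and j="\<lambda>n. n - i * k"]) auto
    qed
    also have "\<dots> \<le> (\<Sum>i<m. field_angle \<alpha> \<beta> (?g i) (?g (Suc i)) + (2 * y * sqrt (2 * T * y) + (y * sqrt V) ^ 3 / 4))"
    proof (rule sum_mono)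
      fix i assume "i \<in> {..<m}"
      then have i: "i < m" by simp
      have "d * (sqrt (U i) + sqrt e) = d * (sqrt (U i) - sqrt e) + 2 * (d * sqrt e)" by (simp add: algebra_simps)
      then show "(\<Sum>j<k. field_angle \<alpha> \<beta> (?h (i * k + j)) (?h (Suc (i * k + j)))) \<le> field_angle \<alpha> \<beta> (?g i) (?g (Suc i)) + (2 * y * sqrt (2 * T * y) + (y * sqrt V) ^ 3 / 4)"
        using fine[OF i] coarse[OF i] unfolding de by linarith
    qed
    also have "\<dots> = grid_length \<alpha> \<beta> A B m + real m * (2 * y * sqrt (2 * T * y) + (y * sqrt V) ^ 3 / 4)"
      by (simp add: sum.distrib grid_length_def)
    finally show "grid_length \<alpha> (rate s) (a\<^sup>2) (b\<^sup>2) (m * k) \<le> grid_length \<alpha> (rate s) (a\<^sup>2) (b\<^sup>2) m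
       + real m * (2 * ((b\<^sup>2 - a\<^sup>2) / (m * s)) * sqrt (2 * T * ((b\<^sup>2 - a\<^sup>2) / (m * s))) + ((b\<^sup>2 - a\<^sup>2) / (m * s) * sqrt V) ^ 3 / 4)"
      unfolding y_def \<beta>_def A_def B_def .
  qed
qed

text \<open>Up to constants, \<open>kappa (2 x\<^sup>2)\<close> is \<open>s * exp (- 2 \<alpha> x / s\<^sup>2)\<close>. So the correlation of the field at \<open>x\<^sup>2\<close> and
\<open>y\<^sup>2\<close> is at most a constant times \<open>exp (- 2 \<alpha> (z - (x + y) / 2) / s\<^sup>2)\<close>, where \<open>z\<close> is the quadratic mean of
\<open>x\<close> and \<open>y\<close>, and \<open>z\<close> exceeds the arithmetic mean by at least a multiple of \<open>(x - y)\<^sup>2\<close>.\<close>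

lemma correlation_decay:
  fixes \<alpha> a b :: real
  assumes al: "\<alpha> > 0" and a: "a > 0" and ab: "a < b" "b \<le> \<alpha>"
  obtains K where "K > 0" "\<And>s p q. 0 < s \<Longrightarrow> s \<le> 1 \<Longrightarrow> p \<in> {a\<^sup>2..b\<^sup>2} \<Longrightarrow> q \<in> {a\<^sup>2..b\<^sup>2} \<Longrightarrow> K * s \<le> \<bar>p - q\<bar> \<Longrightarrow>
     pi / 3 \<le> field_angle \<alpha> (rate s) p q"
proof -
  obtain c C where c: "c > 0" and C: "C > 0" and lo: "\<And>s x. 0 < s \<Longrightarrow> s \<le> 1 \<Longrightarrow> a \<le> x \<Longrightarrow> x \<le> b \<Longrightarrow> c * s * exp (- (2 * \<alpha> * x / s\<^sup>2)) \<le> kappa \<alpha> (rate s) (2 * x\<^sup>2)"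
    and hi: "\<And>s x. 0 < s \<Longrightarrow> s \<le> 1 \<Longrightarrow> a \<le> x \<Longrightarrow> x \<le> b \<Longrightarrow> kappa \<alpha> (rate s) (2 * x\<^sup>2) \<le> C * s * exp (- (2 * \<alpha> * x / s\<^sup>2))"
    by (rule kappa_bounds[OF al a ab(2)]) blast
  define r where "r = \<alpha> / (16 * b ^ 3)"
  have b0: "b > 0" using a ab by simp
  have r: "r > 0" using al b0 by (simp add: r_def)
  define K where "K = sqrt (max 1 (ln (2 * C / c)) / r)"
  have K0: "K > 0" unfolding K_def using r by simp
  have K2: "K\<^sup>2 * r \<ge> ln (2 * C / c)" unfolding K_def using r by simp
  show ?thesis
  proof (rule that[OF K0])
    fix s p q :: real assume s: "0 < s" "s \<le> 1" and p: "p \<in> {a\<^sup>2..b\<^sup>2}" and q: "q \<in> {a\<^sup>2..b\<^sup>2}" and d: "K * s \<le> \<bar>p - q\<bar>"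
    define \<beta> where "\<beta> = rate s"
    have b: "\<beta> > 0" using s by (simp add: \<beta>_def)
    define x where "x = sqrt p"
    define y where "y = sqrt q"
    define z where "z = sqrt ((p + q) / 2)"
    have a2: "a\<^sup>2 > 0" using a by simp
    have pq0: "p > 0" "q > 0" using p q a2 unfolding atLeastAtMost_iff by linarith+
    have x: "a \<le> x" "x \<le> b" "p = x\<^sup>2" unfolding x_def using p a b0 pq0 by (auto intro!: real_le_rsqrt real_le_lsqrt)
    have y: "a \<le> y" "y \<le> b" "q = y\<^sup>2" unfolding y_def using q a b0 pq0 by (auto intro!: real_le_rsqrt real_le_lsqrt)
    have z: "a \<le> z" "z \<le> b" "p + q = 2 * z\<^sup>2" unfolding z_def using p q a b0 pq0 by (auto intro!: real_le_rsqrt real_le_lsqrt)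
    have x0: "x > 0" "y > 0" "z > 0" using x y z a by auto
    define E where "E = (\<lambda>x::real. exp (- (2 * \<alpha> * x / s\<^sup>2)))"
    have kp: "c * s * E x \<le> kappa \<alpha> \<beta> (2 * p)" and kq: "c * s * E y \<le> kappa \<alpha> \<beta> (2 * q)" and kz: "kappa \<alpha> \<beta> (p + q) \<le> C * s * E z"
      unfolding x(3) y(3) z(3)[unfolded x(3) y(3)] E_def \<beta>_def by (rule lo[OF s x(1,2)], rule lo[OF s y(1,2)], rule hi[OF s z(1,2)])
    have gap: "r * ((p - q) / s)\<^sup>2 \<le> (2 * \<alpha> / s\<^sup>2) * (z - (x + y) / 2)"
    proof -
      have "(x - y)\<^sup>2 = 4 * (z - (x + y) / 2) * (z + (x + y) / 2)"
      proof -
        have "4 * (z - (x + y) / 2) * (z + (x + y) / 2) = 4 * z\<^sup>2 - (x + y)\<^sup>2" by (simp add: field_simps power2_eq_square)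
        moreover have "2 * z\<^sup>2 = x\<^sup>2 + y\<^sup>2" using z(3) x(3) y(3) by simp
        moreover have "(x - y)\<^sup>2 = 2 * (x\<^sup>2 + y\<^sup>2) - (x + y)\<^sup>2" by (simp add: algebra_simps power2_eq_square)
        ultimately show ?thesis by simp
      qed
      then have zz: "z - (x + y) / 2 = (x - y)\<^sup>2 / (4 * (z + (x + y) / 2))" using x0 by (simp add: field_simps)
      have "(p - q)\<^sup>2 = (x - y)\<^sup>2 * (x + y)\<^sup>2" unfolding x(3) y(3) by (simp add: algebra_simps power2_eq_square)
      also have "\<dots> \<le> (x - y)\<^sup>2 * (2 * b)\<^sup>2" using x y x0 by (intro mult_left_mono power_mono) auto
      finally have "(p - q)\<^sup>2 / (32 * b ^ 3) \<le> (x - y)\<^sup>2 * (2 * b)\<^sup>2 / (32 * b ^ 3)" using b0 by (intro divide_right_mono) auto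
      also have "\<dots> = (x - y)\<^sup>2 * ((2 * b)\<^sup>2 / (32 * b ^ 3))" by simp
      also have "(2 * b)\<^sup>2 / (32 * b ^ 3) = 1 / (8 * b)" using b0 by (simp add: power2_eq_square power3_eq_cube)
      also have "(x - y)\<^sup>2 * (1 / (8 * b)) = (x - y)\<^sup>2 / (8 * b)" by simp
      also have "\<dots> \<le> (x - y)\<^sup>2 / (4 * (z + (x + y) / 2))"
      proof (rule divide_left_mono)
        have "0 < z + (x + y) / 2" "z + (x + y) / 2 \<le> 2 * b" using x0 x(2) y(2) z(2) by (simp_all add: field_simps)
        then show "4 * (z + (x + y) / 2) \<le> 8 * b" by (simp add: field_simps)
        show "0 < (8 * b) * (4 * (z + (x + y) / 2))" using \<open>0 < z + (x + y) / 2\<close> b0 by (intro mult_pos_pos) auto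
      qed simp
      finally have "(p - q)\<^sup>2 / (32 * b ^ 3) \<le> z - (x + y) / 2" unfolding zz .
      then have "(2 * \<alpha> / s\<^sup>2) * ((p - q)\<^sup>2 / (32 * b ^ 3)) \<le> (2 * \<alpha> / s\<^sup>2) * (z - (x + y) / 2)" using al by (intro mult_left_mono) auto
      moreover have "(2 * \<alpha> / s\<^sup>2) * ((p - q)\<^sup>2 / (32 * b ^ 3)) = r * ((p - q) / s)\<^sup>2" by (simp add: r_def power_divide)
      ultimately show ?thesis by simp
    qed
    have "K \<le> \<bar>p - q\<bar> / s" using d s by (simp add: le_divide_eq)
    then have "K\<^sup>2 \<le> (\<bar>p - q\<bar> / s)\<^sup>2" using K0 by (intro power_mono) auto
    then have "K\<^sup>2 \<le> ((p - q) / s)\<^sup>2" by (simp add: power_divide)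
    then have "K\<^sup>2 * r \<le> (2 * \<alpha> / s\<^sup>2) * (z - (x + y) / 2)" 
    proof -
      have "K\<^sup>2 * r \<le> ((p - q) / s)\<^sup>2 * r" using \<open>K\<^sup>2 \<le> ((p - q) / s)\<^sup>2\<close> r by (intro mult_right_mono) auto
      also have "\<dots> = r * ((p - q) / s)\<^sup>2" by (rule mult.commute)
      finally show ?thesis using gap by (rule order_trans)
    qed
    then have g2: "ln (2 * C / c) \<le> (2 * \<alpha> / s\<^sup>2) * (z - (x + y) / 2)" using K2 by linarith
    have sq: "sqrt (kappa \<alpha> \<beta> (2 * p) * kappa \<alpha> \<beta> (2 * q)) \<ge> c * s * exp (- (2 * \<alpha> * ((x + y) / 2) / s\<^sup>2))"
    proof (rule real_le_rsqrt)
      have "(c * s * exp (- (2 * \<alpha> * ((x + y) / 2) / s\<^sup>2)))\<^sup>2 = (c * s * E x) * (c * s * E y)"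
      proof -
        have "(exp (- (2 * \<alpha> * ((x + y) / 2) / s\<^sup>2)))\<^sup>2 = E x * E y"
          by (simp add: E_def power2_eq_square[of "exp _"] exp_add[symmetric] add_divide_distrib distrib_left)
        then show ?thesis by (simp add: power_mult_distrib power2_eq_square)
      qed
      also have "\<dots> \<le> kappa \<alpha> \<beta> (2 * p) * kappa \<alpha> \<beta> (2 * q)" using c s kappa_pos[OF b, of "2 * p" \<alpha>] pq0 by (intro mult_mono kp kq) (auto simp: E_def)
      finally show "(c * s * exp (- (2 * \<alpha> * ((x + y) / 2) / s\<^sup>2)))\<^sup>2 \<le> kappa \<alpha> \<beta> (2 * p) * kappa \<alpha> \<beta> (2 * q)" .
    qed
    have "kappa \<alpha> \<beta> (p + q) \<le> 1/2 * (c * s * exp (- (2 * \<alpha> * ((x + y) / 2) / s\<^sup>2)))"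
    proof -
      have "2 * C / c \<le> exp ((2 * \<alpha> / s\<^sup>2) * (z - (x + y) / 2))" using g2 c C by (subst ln_le_cancel_iff[symmetric]) auto
      then have "2 * C \<le> c * exp ((2 * \<alpha> / s\<^sup>2) * (z - (x + y) / 2))" using c by (simp add: divide_le_eq mult.commute)
      then have "2 * C * (s * E z) \<le> c * exp ((2 * \<alpha> / s\<^sup>2) * (z - (x + y) / 2)) * (s * E z)" using s by (intro mult_right_mono) (auto simp: E_def)
      also have "\<dots> = c * s * (exp ((2 * \<alpha> / s\<^sup>2) * (z - (x + y) / 2)) * E z)" by simp
      also have "exp ((2 * \<alpha> / s\<^sup>2) * (z - (x + y) / 2)) * E z = exp (- (2 * \<alpha> * ((x + y) / 2) / s\<^sup>2))"
      proof -
        have 1: "exp (k * (z - w)) * exp (- (k * z)) = exp (- (k * w))" for k w :: real by (simp add: exp_add[symmetric] algebra_simps)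
        have 2: "2 * \<alpha> * t / s\<^sup>2 = (2 * \<alpha> / s\<^sup>2) * t" for t by simp
        show ?thesis unfolding E_def 2 by (rule 1)
      qed
      finally show ?thesis using kz by simp
    qed
    also have "\<dots> \<le> 1/2 * sqrt (kappa \<alpha> \<beta> (2 * p) * kappa \<alpha> \<beta> (2 * q))" using sq by simp
    finally have rho: "kappa \<alpha> \<beta> (p + q) / sqrt (kappa \<alpha> \<beta> (2 * p) * kappa \<alpha> \<beta> (2 * q)) \<le> 1 / 2"
      using kappa_pos[OF b, of "2 * p" \<alpha>] kappa_pos[OF b, of "2 * q" \<alpha>] pq0 by (simp add: divide_le_eq)
    have "0 \<le> kappa \<alpha> \<beta> (p + q) / sqrt (kappa \<alpha> \<beta> (2 * p) * kappa \<alpha> \<beta> (2 * q))"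
      using kappa_pos[OF b, of "2 * p" \<alpha>] kappa_pos[OF b, of "2 * q" \<alpha>] kappa_pos[OF b, of "p + q" \<alpha>] pq0 by simp
    then have "arccos (1 / 2) \<le> field_angle \<alpha> \<beta> p q" unfolding field_angle_def using rho by (intro arccos_le_arccos) auto
    moreover have "arccos (1 / 2) = pi / 3"
      using arccos_cos[of "pi / 3"] by (simp add: cos_60)
    ultimately show "pi / 3 \<le> field_angle \<alpha> (rate s) p q" by (simp add: \<beta>_def)
  qed
qed

section \<open>Kernels cut off to a window\<close>

text \<open>The square makes the cut-off continuously differentiable, as \<open>smooth_kernel\<close> demands.\<close>

definition bump :: "real \<Rightarrow> real" where "bump v = (max 0 v)\<^sup>2"

lemma bump_deriv: "(bump has_real_derivative 2 * max 0 v) (at v)"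
proof (rule has_real_derivative_quadratic)
  show "(1::real) > 0" by simp
  fix q :: real assume "\<bar>q - v\<bar> < 1"
  show "\<bar>bump q - bump v - 2 * max 0 v * (q - v)\<bar> \<le> 1 * (q - v)\<^sup>2"
  proof (cases "v \<ge> 0"; cases "q \<ge> 0")
    assume "v \<ge> 0" "q \<ge> 0"
    then have "bump q - bump v - 2 * max 0 v * (q - v) = (q - v)\<^sup>2" by (simp add: bump_def algebra_simps power2_eq_square)
    then show ?thesis by simp
  next
    assume v: "v \<ge> 0" "\<not> q \<ge> 0"
    then have "v * q \<le> 0" by (simp add: mult_nonneg_nonpos)
    moreover have "bump q - bump v - 2 * max 0 v * (q - v) = v\<^sup>2 - 2 * (v * q)" using v by (simp add: bump_def algebra_simps power2_eq_square)
    moreover have "(q - v)\<^sup>2 = v\<^sup>2 - 2 * (v * q) + q\<^sup>2" by (simp add: algebra_simps power2_eq_square)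
    moreover have "v\<^sup>2 \<ge> 0" "q\<^sup>2 \<ge> 0" by auto
    ultimately show ?thesis by linarith
  next
    assume v: "\<not> v \<ge> 0" "q \<ge> 0"
    then have "v * q \<le> 0" by (simp add: mult_nonpos_nonneg)
    moreover have "bump q - bump v - 2 * max 0 v * (q - v) = q\<^sup>2" using v by (simp add: bump_def)
    moreover have "(q - v)\<^sup>2 = v\<^sup>2 - 2 * (v * q) + q\<^sup>2" by (simp add: algebra_simps power2_eq_square)
    moreover have "v\<^sup>2 \<ge> 0" "q\<^sup>2 \<ge> 0" by auto
    ultimately show ?thesis by linarith
  next
    assume "\<not> v \<ge> 0" "\<not> q \<ge> 0"
    then show ?thesis by (simp add: bump_def)
  qed
qed

lemma continuous_on_bump [continuous_intros]: "continuous_on S f \<Longrightarrow> continuous_on S (\<lambda>x. bump (f x))"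
  unfolding bump_def by (intro continuous_intros)

lemma bump_one_minus_square: "0 \<le> bump (1 - w\<^sup>2)" "bump (1 - w\<^sup>2) \<le> 1" "1 - bump (1 - w\<^sup>2) \<le> 2 * w\<^sup>2"
proof -
  show "0 \<le> bump (1 - w\<^sup>2)" by (simp add: bump_def)
  have "max 0 (1 - w\<^sup>2) \<le> 1" by simp
  then show "bump (1 - w\<^sup>2) \<le> 1" unfolding bump_def by (intro power_le_one) auto
  show "1 - bump (1 - w\<^sup>2) \<le> 2 * w\<^sup>2"
  proof (cases "w\<^sup>2 \<le> 1")
    case True
    then have "1 - bump (1 - w\<^sup>2) = 2 * w\<^sup>2 - (w\<^sup>2)\<^sup>2" by (simp add: bump_def algebra_simps power2_eq_square)
    then show ?thesis by simp
  next
    case False then show ?thesis by (simp add: bump_def)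
  qed
qed

text \<open>The distance from the peak \<open>z = sqrt p / \<alpha>\<close> of the kernel, in units of the window width \<open>h\<close>.\<close>

definition window_coord :: "real \<Rightarrow> real \<Rightarrow> real \<Rightarrow> real \<Rightarrow> real" where
  "window_coord \<alpha> h p z = (sqrt p - \<alpha> * z) / h"

definition windowed_kernel :: "real \<Rightarrow> real \<Rightarrow> real \<Rightarrow> real \<Rightarrow> real \<Rightarrow> real" where
  "windowed_kernel \<alpha> \<beta> h p z = heat_kernel \<alpha> \<beta> p z * bump (1 - (window_coord \<alpha> h p z)\<^sup>2)"

definition windowed_kernel' :: "real \<Rightarrow> real \<Rightarrow> real \<Rightarrow> real \<Rightarrow> real \<Rightarrow> real" where
  "windowed_kernel' \<alpha> \<beta> h p z = heat_kernel' \<alpha> \<beta> p z * bump (1 - (window_coord \<alpha> h p z)\<^sup>2)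
     + (2 * max 0 (1 - (window_coord \<alpha> h p z)\<^sup>2) * (- (2 * window_coord \<alpha> h p z * (- \<alpha> / h)))) * heat_kernel \<alpha> \<beta> p z"

lemma smooth_kernel_windowed:
  assumes b: "\<beta> > 0" and p: "p > 0" 
  shows "smooth_kernel (windowed_kernel \<alpha> \<beta> h p) (windowed_kernel' \<alpha> \<beta> h p)"
proof -
  note k = smooth_kernel_heat_kernel[OF b p, of \<alpha>, unfolded smooth_kernel_def]
  have cw: "continuous_on {0..1} (window_coord \<alpha> h p)" unfolding window_coord_def[abs_def] divide_inverse by (intro continuous_intros)
  have cb: "continuous_on {0..1} (\<lambda>z. bump (1 - (window_coord \<alpha> h p z)\<^sup>2))" by (intro continuous_intros cw)
  have cm: "continuous_on {0..1} (\<lambda>z. 2 * max 0 (1 - (window_coord \<alpha> h p z)\<^sup>2) * (- (2 * window_coord \<alpha> h p z * (- \<alpha> / h))))"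
    by (intro continuous_intros cw)
  show ?thesis unfolding smooth_kernel_def
  proof (intro conjI allI impI)
    show "continuous_on {0..1} (windowed_kernel \<alpha> \<beta> h p)" unfolding windowed_kernel_def[abs_def] by (rule continuous_on_mult) (use k cb in auto)
    show "continuous_on {0..1} (windowed_kernel' \<alpha> \<beta> h p)" unfolding windowed_kernel'_def[abs_def]
      by (rule continuous_on_add; rule continuous_on_mult) (use k cb cm in auto)
    show "windowed_kernel \<alpha> \<beta> h p 0 = 0" using k by (simp add: windowed_kernel_def)
    fix z :: real assume z: "0 < z" "z < 1"
    have dk: "(heat_kernel \<alpha> \<beta> p has_real_derivative heat_kernel' \<alpha> \<beta> p z) (at z)" using k z by blast
    have dw: "(window_coord \<alpha> h p has_real_derivative (- \<alpha> / h)) (at z)"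
      unfolding window_coord_def[abs_def] divide_inverse by (auto intro!: derivative_eq_intros)
    have d1: "((\<lambda>z. 1 - (window_coord \<alpha> h p z)\<^sup>2) has_real_derivative - (2 * window_coord \<alpha> h p z * (- \<alpha> / h))) (at z)"
      by (auto intro!: derivative_eq_intros dw)
    have d2: "((\<lambda>z. bump (1 - (window_coord \<alpha> h p z)\<^sup>2)) has_real_derivative 2 * max 0 (1 - (window_coord \<alpha> h p z)\<^sup>2) * (- (2 * window_coord \<alpha> h p z * (- \<alpha> / h)))) (at z)"
      by (rule DERIV_chain2[where f=bump and g="\<lambda>z. 1 - (window_coord \<alpha> h p z)\<^sup>2", OF bump_deriv d1])
    show "(windowed_kernel \<alpha> \<beta> h p has_real_derivative windowed_kernel' \<alpha> \<beta> h p z) (at z)"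
      unfolding windowed_kernel_def[abs_def] windowed_kernel'_def by (rule DERIV_mult[OF dk d2])
  qed
qed

lemma windowed_kernels_orthogonal:
  assumes h: "h > 0" and d: "2 * h \<le> \<bar>sqrt p - sqrt q\<bar>"
  shows "kernel_inner (windowed_kernel \<alpha> \<beta> h p) (windowed_kernel \<alpha> \<beta> h q) = 0"
proof -
  have zero: "windowed_kernel \<alpha> \<beta> h p z * windowed_kernel \<alpha> \<beta> h q z = 0" for z
  proof (cases "\<bar>sqrt p - \<alpha> * z\<bar> < h")
    case True
    then have "h \<le> \<bar>sqrt q - \<alpha> * z\<bar>" using d by linarith
    then have "1 \<le> \<bar>window_coord \<alpha> h q z\<bar>" using h by (simp add: window_coord_def)
    then have "1 \<le> (window_coord \<alpha> h q z)\<^sup>2" using abs_le_square_iff[of 1 "window_coord \<alpha> h q z"] by simp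
    then show ?thesis by (simp add: windowed_kernel_def bump_def)
  next
    case False
    then have "1 \<le> \<bar>window_coord \<alpha> h p z\<bar>" using h by (simp add: window_coord_def)
    then have "1 \<le> (window_coord \<alpha> h p z)\<^sup>2" using abs_le_square_iff[of 1 "window_coord \<alpha> h p z"] by simp
    then show ?thesis by (simp add: windowed_kernel_def bump_def)
  qed
  show ?thesis unfolding kernel_inner_def zero by simp
qed

lemma heat_kernel_square:
  assumes b: "\<beta> = rate s" and z: "z \<ge> 0" and p: "p > 0"
  shows "heat_kernel \<alpha> \<beta> p z * heat_kernel \<alpha> \<beta> p z = exp (- (2 * \<alpha> * sqrt p / s\<^sup>2)) * ((1 / z) * exp (- ((sqrt p - \<alpha> * z)\<^sup>2 / (s\<^sup>2 * z))))"
proof -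
  have e: "sqrt z * sqrt z * (1 / z) * (1 / z) = 1 / z" using z by simp
  have "heat_kernel \<alpha> \<beta> p z * heat_kernel \<alpha> \<beta> p z = (sqrt z * sqrt z * (1 / z) * (1 / z)) * (exp (- (\<beta> * p / z)) * exp (- (\<beta> * p / z))) * (exp (- (\<beta> * \<alpha>\<^sup>2 * z)) * exp (- (\<beta> * \<alpha>\<^sup>2 * z)))"
    by (simp only: heat_kernel_def mult_ac)
  also have "exp (- (\<beta> * p / z)) * exp (- (\<beta> * p / z)) = exp (- (\<beta> * (2 * (sqrt p)\<^sup>2) / z))" using p by (simp add: exp_add[symmetric])
  also have "exp (- (\<beta> * \<alpha>\<^sup>2 * z)) * exp (- (\<beta> * \<alpha>\<^sup>2 * z)) = exp (- (2 * \<beta> * \<alpha>\<^sup>2 * z))" by (simp add: exp_add[symmetric])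
  finally show ?thesis unfolding e using complete_the_square[OF b z, of 1 \<alpha> "sqrt p"] by (simp add: mult_ac)
qed

text \<open>The factor \<open>1 - bump (1 - w\<^sup>2)\<close> lost by the cut-off is at most \<open>2 w\<^sup>2\<close>, and the mean of \<open>w\<^sup>2\<close> is
\<open>O(1 / R\<^sup>2)\<close> because the kernel has width \<open>s\<close> and the window width \<open>R s\<close>.\<close>

lemma windowed_kernel_covariance:
  fixes \<alpha> a b :: real
  assumes al: "\<alpha> > 0" and a: "a > 0" and ab: "a < b" "b \<le> \<alpha>"
  obtains G where "G > 0" "\<And>s R p. 0 < s \<Longrightarrow> s \<le> 1 \<Longrightarrow> R > 0 \<Longrightarrow> p \<in> {a\<^sup>2..b\<^sup>2} \<Longrightarrow>
     (1 - G / R\<^sup>2) * kappa \<alpha> (rate s) (2 * p) \<le> kernel_inner (heat_kernel \<alpha> (rate s) p) (windowed_kernel \<alpha> (rate s) (R * s) p)"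
    "\<And>s R p. 0 < s \<Longrightarrow> s \<le> 1 \<Longrightarrow> R > 0 \<Longrightarrow> p \<in> {a\<^sup>2..b\<^sup>2} \<Longrightarrow>
     kernel_inner (windowed_kernel \<alpha> (rate s) (R * s) p) (windowed_kernel \<alpha> (rate s) (R * s) p) \<le> kernel_inner (heat_kernel \<alpha> (rate s) p) (windowed_kernel \<alpha> (rate s) (R * s) p)"
proof -
  obtain c where c: "c > 0" and lo: "\<And>s x. 0 < s \<Longrightarrow> s \<le> 1 \<Longrightarrow> a \<le> x \<Longrightarrow> x \<le> b \<Longrightarrow> c * s * exp (- (2 * \<alpha> * x / s\<^sup>2)) \<le> kappa \<alpha> (rate s) (2 * x\<^sup>2)"
    using kappa_lower[OF al a ab(2)] by blast
  obtain C where C: "C > 0" "\<And>s x z. 0 < s \<Longrightarrow> s \<le> 1 \<Longrightarrow> a \<le> x \<Longrightarrow> 0 < z \<Longrightarrow> z \<le> 1 \<Longrightarrow>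
     (1 / z) ^ 1 * (\<bar>x - \<alpha> * z\<bar> / s) ^ 2 * exp (- ((x - \<alpha> * z)\<^sup>2 / (s\<^sup>2 * z))) \<le> C * exp (- ((x - \<alpha> * z)\<^sup>2 / (2 * s\<^sup>2)))"
    using gauss_kernel_pointwise[OF al a, of 1 2] by blast
  define G where "G = 2 * C * (sqrt (2 * pi) / \<alpha>) / c"
  have b0: "b > 0" using a ab by simp
  show ?thesis
  proof (rule that[of G])
    show "G > 0" unfolding G_def using C(1) c al by simp
  next
    fix s R p :: real assume s: "0 < s" "s \<le> 1" and R: "R > 0" and p: "p \<in> {a\<^sup>2..b\<^sup>2}"
    define \<beta> where "\<beta> = rate s"
    have b: "\<beta> > 0" using s by (simp add: \<beta>_def)
    have "a\<^sup>2 > 0" using a by simp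
    then have p0: "p > 0" using p unfolding atLeastAtMost_iff by linarith
    define x where "x = sqrt p"
    have x: "a \<le> x" "x \<le> b" "p = x\<^sup>2" unfolding x_def using p a b0 p0 by (auto intro!: real_le_rsqrt real_le_lsqrt)
    have k1: "smooth_kernel (heat_kernel \<alpha> \<beta> p) (heat_kernel' \<alpha> \<beta> p)" by (rule smooth_kernel_heat_kernel[OF b p0])
    have k2: "smooth_kernel (windowed_kernel \<alpha> \<beta> (R * s) p) (windowed_kernel' \<alpha> \<beta> (R * s) p)" by (rule smooth_kernel_windowed[OF b p0])
    let ?E = "exp (- (2 * \<alpha> * x / s\<^sup>2))"
    let ?g = "\<lambda>z. exp (- ((x - \<alpha> * z)\<^sup>2 / (2 * s\<^sup>2)))"
    show "kernel_inner (windowed_kernel \<alpha> (rate s) (R * s) p) (windowed_kernel \<alpha> (rate s) (R * s) p) \<le> kernel_inner (heat_kernel \<alpha> (rate s) p) (windowed_kernel \<alpha> (rate s) (R * s) p)"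
      unfolding \<beta>_def[symmetric] kernel_inner_def
    proof (rule integral_le[OF kernel_inner_integrable[OF k2 k2] kernel_inner_integrable[OF k1 k2]])
      fix z :: real assume "z \<in> {0..1}"
      let ?w = "bump (1 - (window_coord \<alpha> (R * s) p z)\<^sup>2)"
      have "(heat_kernel \<alpha> \<beta> p z)\<^sup>2 * ?w * ?w \<le> (heat_kernel \<alpha> \<beta> p z)\<^sup>2 * ?w * 1" by (intro mult_left_mono) (auto simp: bump_one_minus_square)
      then show "windowed_kernel \<alpha> \<beta> (R * s) p z * windowed_kernel \<alpha> \<beta> (R * s) p z \<le> heat_kernel \<alpha> \<beta> p z * windowed_kernel \<alpha> \<beta> (R * s) p z"
        by (simp add: windowed_kernel_def power2_eq_square mult_ac)
    qed
    have "kappa \<alpha> \<beta> (2 * p) - kernel_inner (heat_kernel \<alpha> \<beta> p) (windowed_kernel \<alpha> \<beta> (R * s) p) = integral {0..1} (\<lambda>z. heat_kernel \<alpha> \<beta> p z * heat_kernel \<alpha> \<beta> p z - heat_kernel \<alpha> \<beta> p z * windowed_kernel \<alpha> \<beta> (R * s) p z)"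
      using kernel_inner_heat_kernel[OF b p0 p0, of \<alpha>] unfolding kernel_inner_def
      by (subst Henstock_Kurzweil_Integration.integral_diff[OF kernel_inner_integrable[OF k1 k1] kernel_inner_integrable[OF k1 k2]]) simp
    also have "\<dots> \<le> integral {0..1} (\<lambda>z. (2 / R\<^sup>2 * ?E * C) * ?g z)"
    proof (rule integral_le)
      show "(\<lambda>z. heat_kernel \<alpha> \<beta> p z * heat_kernel \<alpha> \<beta> p z - heat_kernel \<alpha> \<beta> p z * windowed_kernel \<alpha> \<beta> (R * s) p z) integrable_on {0..1}"
        by (rule integrable_diff[OF kernel_inner_integrable[OF k1 k1] kernel_inner_integrable[OF k1 k2]])
      show "(\<lambda>z. (2 / R\<^sup>2 * ?E * C) * ?g z) integrable_on {0..1}"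
        by (rule set_borel_integral_eq_integral(1)[OF set_integrable_mult_right[OF gauss_window_integral(1)[OF al s(1)]]])
      fix z :: real assume z: "z \<in> {0..1}"
      let ?w = "window_coord \<alpha> (R * s) p z"
      have "heat_kernel \<alpha> \<beta> p z * heat_kernel \<alpha> \<beta> p z - heat_kernel \<alpha> \<beta> p z * windowed_kernel \<alpha> \<beta> (R * s) p z = (heat_kernel \<alpha> \<beta> p z * heat_kernel \<alpha> \<beta> p z) * (1 - bump (1 - ?w\<^sup>2))"
        by (simp add: windowed_kernel_def algebra_simps)
      also have "\<dots> \<le> (heat_kernel \<alpha> \<beta> p z * heat_kernel \<alpha> \<beta> p z) * (2 * ?w\<^sup>2)" by (intro mult_left_mono bump_one_minus_square) simp
      also have "\<dots> \<le> (2 / R\<^sup>2 * ?E * C) * ?g z"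
      proof (cases "z = 0")
        case True then show ?thesis using C by (simp add: heat_kernel_def)
      next
        case False
        then have z0: "0 < z" "z \<le> 1" using z by auto
        have w: "?w\<^sup>2 = (1 / R\<^sup>2) * (\<bar>x - \<alpha> * z\<bar> / s)\<^sup>2" by (simp add: window_coord_def x_def power_divide power_mult_distrib)
        have "(heat_kernel \<alpha> \<beta> p z * heat_kernel \<alpha> \<beta> p z) * (2 * ?w\<^sup>2) = (2 / R\<^sup>2 * ?E) * ((1 / z) ^ 1 * (\<bar>x - \<alpha> * z\<bar> / s) ^ 2 * exp (- ((x - \<alpha> * z)\<^sup>2 / (s\<^sup>2 * z))))"
        proof -
          have alg: "(E * (r * g)) * (2 * (q * Y)) = (2 * q * E) * (r ^ 1 * Y * g)" for E r g q Y :: real by simp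
          have q2: "2 / R\<^sup>2 = 2 * (1 / R\<^sup>2)" by simp
          show ?thesis unfolding w heat_kernel_square[OF \<beta>_def less_imp_le[OF z0(1)] p0] x_def[symmetric] q2 by (rule alg)
        qed
        also have "\<dots> \<le> (2 / R\<^sup>2 * ?E) * (C * ?g z)" by (rule mult_left_mono[OF C(2)[OF s x(1) z0]]) simp
        finally show ?thesis by (simp only: mult.assoc)
      qed
      finally show "heat_kernel \<alpha> \<beta> p z * heat_kernel \<alpha> \<beta> p z - heat_kernel \<alpha> \<beta> p z * windowed_kernel \<alpha> \<beta> (R * s) p z \<le> (2 / R\<^sup>2 * ?E * C) * ?g z" .
    qed
    also have "\<dots> = (2 / R\<^sup>2 * ?E * C) * (LBINT z:{0..1}. ?g z)"
      by (subst set_borel_integral_eq_integral(2)[OF gauss_window_integral(1)[OF al s(1)]]) simp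
    also have "\<dots> \<le> (2 / R\<^sup>2 * ?E * C) * (sqrt (2 * pi) / \<alpha> * s)"
      using gauss_window_integral(2)[OF al s(1), of x] C(1) by (intro mult_left_mono) auto
    also have "\<dots> = G / R\<^sup>2 * (c * s * ?E)" using c by (simp add: G_def mult_ac)
    also have "\<dots> \<le> G / R\<^sup>2 * kappa \<alpha> \<beta> (2 * p)"
    proof (rule mult_left_mono)
      show "c * s * ?E \<le> kappa \<alpha> \<beta> (2 * p)" unfolding x(3) \<beta>_def by (rule lo[OF s x(1,2)])
      show "0 \<le> G / R\<^sup>2" unfolding G_def using C(1) c al by simp
    qed
    finally show "(1 - G / R\<^sup>2) * kappa \<alpha> (rate s) (2 * p) \<le> kernel_inner (heat_kernel \<alpha> (rate s) p) (windowed_kernel \<alpha> (rate s) (R * s) p)"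
      unfolding \<beta>_def[symmetric] by (simp add: algebra_simps)
  qed
qed

lemma arccos_tendsto_0: "((\<lambda>R. arccos (1 - G / R\<^sup>2)) \<longlongrightarrow> 0) at_top" if G: "G > 0" for G :: real
proof -
  have lim: "((\<lambda>R::real. 1 - G / R\<^sup>2) \<longlongrightarrow> 1 - 0) at_top"
    by (intro tendsto_intros tendsto_divide_0[OF tendsto_const] filterlim_at_top_imp_at_infinity filterlim_pow_at_top filterlim_ident) simp
  have ev: "\<forall>\<^sub>F R in at_top. 1 - G / R\<^sup>2 \<in> {-1..1}"
    using eventually_ge_at_top[of "max 1 (sqrt G)"]
  proof eventually_elim
    case (elim R)
    then have "sqrt G \<le> R" "R > 0" by auto
    then have "G \<le> R\<^sup>2" using G by (metis real_sqrt_le_iff real_sqrt_abs abs_of_pos)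
    then have "G / R\<^sup>2 \<le> 1" using \<open>R > 0\<close> by simp
    moreover have "0 \<le> G / R\<^sup>2" using G by simp
    ultimately show ?case unfolding atLeastAtMost_iff by linarith
  qed
  have "((\<lambda>R. arccos (1 - G / R\<^sup>2)) \<longlongrightarrow> arccos 1) at_top"
    by (rule continuous_on_tendsto_compose[OF continuous_on_arccos' _ _ ev]) (use lim in auto)
  then show ?thesis by simp
qed

context brownian_motion_01 begin

abbreviation windowed_process :: "real \<Rightarrow> real \<Rightarrow> real \<Rightarrow> real \<Rightarrow> 'a \<Rightarrow> real" where
  "windowed_process \<alpha> \<beta> h p \<omega> \<equiv> wiener_int (\<lambda>s. W s \<omega>) (windowed_kernel' \<alpha> \<beta> h p)"

text \<open>The correlation between the field and its cut-off is at least \<open>1 - G / R\<^sup>2\<close>, hence the angle between them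
tends to 0 as \<open>R\<close> grows.\<close>

lemma windowed_sign_differs:
  fixes \<alpha> a b e :: real
  assumes al: "\<alpha> > 0" and a: "a > 0" and ab: "a < b" "b \<le> \<alpha>" and e: "e > 0"
  obtains R where "R > 0" "\<And>s p. 0 < s \<Longrightarrow> s \<le> 1 \<Longrightarrow> p \<in> {a\<^sup>2..b\<^sup>2} \<Longrightarrow>
     measure (completion M) {\<omega>\<in>space M. crit_process \<alpha> (rate s) p \<omega> * windowed_process \<alpha> (rate s) (R * s) p \<omega> \<le> 0} \<le> e"
proof -
  obtain G where G: "G > 0" and cov: "\<And>s R p. 0 < s \<Longrightarrow> s \<le> 1 \<Longrightarrow> R > 0 \<Longrightarrow> p \<in> {a\<^sup>2..b\<^sup>2} \<Longrightarrow>
     (1 - G / R\<^sup>2) * kappa \<alpha> (rate s) (2 * p) \<le> kernel_inner (heat_kernel \<alpha> (rate s) p) (windowed_kernel \<alpha> (rate s) (R * s) p)"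
    and var: "\<And>s R p. 0 < s \<Longrightarrow> s \<le> 1 \<Longrightarrow> R > 0 \<Longrightarrow> p \<in> {a\<^sup>2..b\<^sup>2} \<Longrightarrow>
     kernel_inner (windowed_kernel \<alpha> (rate s) (R * s) p) (windowed_kernel \<alpha> (rate s) (R * s) p) \<le> kernel_inner (heat_kernel \<alpha> (rate s) p) (windowed_kernel \<alpha> (rate s) (R * s) p)"
    by (rule windowed_kernel_covariance[OF al a ab]) blast
  have "\<forall>\<^sub>F R in at_top. arccos (1 - G / R\<^sup>2) < e * pi" using arccos_tendsto_0[OF G] by (rule order_tendstoD) (use e in simp)
  then have "\<forall>\<^sub>F R in at_top. arccos (1 - G / R\<^sup>2) < e * pi \<and> R > max 1 (sqrt G)"
    using eventually_gt_at_top[of "max 1 (sqrt G)"] by eventually_elim auto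
  then obtain R where R: "arccos (1 - G / R\<^sup>2) < e * pi" "R > max 1 (sqrt G)"
    using eventually_happens'[of "at_top :: real filter"] by auto
  have R0: "R > 0" using R by simp
  have "sqrt G < R" using R by simp
  then have "G < R\<^sup>2" using G R0 by (metis real_sqrt_less_iff real_sqrt_abs abs_of_pos)
  then have t: "0 < 1 - G / R\<^sup>2" "1 - G / R\<^sup>2 \<le> 1" using G R0 by auto
  define u where "u = 1 - G / R\<^sup>2"
  show ?thesis
  proof (rule that[OF R0])
    fix s p :: real assume s: "0 < s" "s \<le> 1" and p: "p \<in> {a\<^sup>2..b\<^sup>2}"
    define \<beta> where "\<beta> = rate s"
    have b: "\<beta> > 0" using s by (simp add: \<beta>_def)
    have "a\<^sup>2 > 0" using a by simp
    then have p0: "p > 0" using p unfolding atLeastAtMost_iff by linarith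
    let ?g = "heat_kernel \<alpha> \<beta> p" and ?h = "windowed_kernel \<alpha> \<beta> (R * s) p"
    have k1: "smooth_kernel ?g (heat_kernel' \<alpha> \<beta> p)" by (rule smooth_kernel_heat_kernel[OF b p0])
    have k2: "smooth_kernel ?h (windowed_kernel' \<alpha> \<beta> (R * s) p)" by (rule smooth_kernel_windowed[OF b p0])
    have kg: "kernel_inner ?g ?g > 0" unfolding crit_process_var[OF b p0] using p0 by (intro kappa_pos[OF b]) simp
    have c: "u * kernel_inner ?g ?g \<le> kernel_inner ?g ?h" using cov[OF s R0 p] unfolding \<beta>_def[symmetric] crit_process_var[OF b p0] u_def .
    have v: "kernel_inner ?h ?h \<le> kernel_inner ?g ?h" using var[OF s R0 p] unfolding \<beta>_def[symmetric] .
    have gh: "kernel_inner ?g ?h > 0" using c mult_pos_pos[OF t(1)[folded u_def] kg] by linarith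
    have cs: "(kernel_inner ?g ?h)\<^sup>2 \<le> kernel_inner ?g ?g * kernel_inner ?h ?h" by (rule kernel_inner_cauchy_schwarz[OF k1 k2 kg])
    have "0 < kernel_inner ?g ?g * kernel_inner ?h ?h" using cs gh zero_less_power[of "kernel_inner ?g ?h" 2] by linarith
    then have kh: "kernel_inner ?h ?h > 0" using kg by (simp add: zero_less_mult_iff)
    have rho: "u \<le> kernel_inner ?g ?h / sqrt (kernel_inner ?g ?g * kernel_inner ?h ?h)"
    proof -
      have "u * (kernel_inner ?g ?g * kernel_inner ?g ?h) \<le> kernel_inner ?g ?h * kernel_inner ?g ?h"
        using mult_right_mono[OF c, of "kernel_inner ?g ?h"] gh by (simp add: mult.assoc)
      moreover have "u * (u * (kernel_inner ?g ?g * kernel_inner ?h ?h)) \<le> u * (1 * (kernel_inner ?g ?g * kernel_inner ?g ?h))"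
        using t kg kh v gh by (intro mult_left_mono mult_mono) (auto simp: u_def)
      ultimately have "u\<^sup>2 * (kernel_inner ?g ?g * kernel_inner ?h ?h) \<le> (kernel_inner ?g ?h)\<^sup>2" by (simp add: power2_eq_square mult.assoc)
      then have "sqrt (u\<^sup>2 * (kernel_inner ?g ?g * kernel_inner ?h ?h)) \<le> sqrt ((kernel_inner ?g ?h)\<^sup>2)" by (rule real_sqrt_le_mono)
      then have "u * sqrt (kernel_inner ?g ?g * kernel_inner ?h ?h) \<le> kernel_inner ?g ?h" using t gh by (simp add: real_sqrt_mult u_def)
      then show ?thesis using kg kh by (simp add: le_divide_eq)
    qed
    have rho1: "kernel_inner ?g ?h / sqrt (kernel_inner ?g ?g * kernel_inner ?h ?h) \<le> 1"
    proof -
      have "kernel_inner ?g ?h \<le> sqrt (kernel_inner ?g ?g * kernel_inner ?h ?h)" using cs by (rule real_le_rsqrt)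
      then show ?thesis using kg kh by (simp add: divide_le_eq)
    qed
    note [measurable] = wiener_int_measurable[OF k1] wiener_int_measurable[OF k2]
    interpret C: prob_space "completion M" by (rule prob_space_completion)
    have ms: "{\<omega>\<in>space (completion M). BM_int (heat_kernel' \<alpha> \<beta> p) \<omega> * BM_int (windowed_kernel' \<alpha> \<beta> (R * s) p) \<omega> \<le> 0} \<in> sets (completion M)"
      "{\<omega>\<in>space (completion M). BM_int (heat_kernel' \<alpha> \<beta> p) \<omega> * BM_int (windowed_kernel' \<alpha> \<beta> (R * s) p) \<omega> < 0} \<in> sets (completion M)" by measurable
    have "measure (completion M) {\<omega>\<in>space M. crit_process \<alpha> \<beta> p \<omega> * windowed_process \<alpha> \<beta> (R * s) p \<omega> \<le> 0} = measure (completion M) {\<omega>\<in>space M. crit_process \<alpha> \<beta> p \<omega> * windowed_process \<alpha> \<beta> (R * s) p \<omega> < 0}"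
    proof (rule C.finite_measure_eq_AE)
      show "AE \<omega> in completion M. (\<omega> \<in> {\<omega>\<in>space M. crit_process \<alpha> \<beta> p \<omega> * windowed_process \<alpha> \<beta> (R * s) p \<omega> \<le> 0}) = (\<omega> \<in> {\<omega>\<in>space M. crit_process \<alpha> \<beta> p \<omega> * windowed_process \<alpha> \<beta> (R * s) p \<omega> < 0})"
        using AE_BM_int_nonzero[OF k1 kg] AE_BM_int_nonzero[OF k2 kh] unfolding crit_field_def by eventually_elim (auto simp: le_less)
    qed (use ms in \<open>auto simp: crit_field_def\<close>)
    also have "\<dots> = arccos (kernel_inner ?g ?h / sqrt (kernel_inner ?g ?g * kernel_inner ?h ?h)) / pi"
      unfolding crit_field_def by (rule BM_int_orthant[OF k1 k2 kg kh])
    also have "\<dots> \<le> arccos u / pi" using rho rho1 t by (intro divide_right_mono arccos_le_arccos) (auto simp: u_def)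
    also have "\<dots> \<le> e" using R(1) by (simp add: u_def divide_le_eq)
    finally show "measure (completion M) {\<omega>\<in>space M. crit_process \<alpha> (rate s) p \<omega> * windowed_process \<alpha> (rate s) (R * s) p \<omega> \<le> 0} \<le> e"
      by (simp add: \<beta>_def)
  qed
qed

lemma windowed_measurable: "\<beta> > 0 \<Longrightarrow> p > 0 \<Longrightarrow> windowed_process \<alpha> \<beta> h p \<in> borel_measurable (completion M)"
  by (rule wiener_int_measurable[OF smooth_kernel_windowed])

lemma windowed_indep:
  assumes b: "\<beta> > 0" and h: "h > 0" and pos: "p > 0" "p' > 0" "q > 0" "q' > 0"
    and far: "2 * h \<le> \<bar>sqrt p - sqrt q\<bar>" "2 * h \<le> \<bar>sqrt p - sqrt q'\<bar>" "2 * h \<le> \<bar>sqrt p' - sqrt q\<bar>" "2 * h \<le> \<bar>sqrt p' - sqrt q'\<bar>"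
  shows "measure (completion M) {\<omega>\<in>space M. windowed_process \<alpha> \<beta> h p \<omega> * windowed_process \<alpha> \<beta> h p' \<omega> < 0 \<and> windowed_process \<alpha> \<beta> h q \<omega> * windowed_process \<alpha> \<beta> h q' \<omega> < 0}
    = measure (completion M) {\<omega>\<in>space M. windowed_process \<alpha> \<beta> h p \<omega> * windowed_process \<alpha> \<beta> h p' \<omega> < 0} * measure (completion M) {\<omega>\<in>space M. windowed_process \<alpha> \<beta> h q \<omega> * windowed_process \<alpha> \<beta> h q' \<omega> < 0}"
  by (rule BM_int_indep_signs) (rule smooth_kernel_windowed[OF b] windowed_kernels_orthogonal[OF h] pos far)+

end

text \<open>A cell contributes equally to both counts if \<open>F\<close> and \<open>G\<close> have the same sign at both of its end points, and
each grid point bounds at most two cells.\<close>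

lemma sign_changes_diff:
  "\<bar>real (sign_changes A B n F) - real (sign_changes A B n G)\<bar> \<le> 2 * (\<Sum>i\<le>n. if F (grid A B n i) * G (grid A B n i) \<le> 0 then 1 else 0)"
proof -
  let ?p = "grid A B n"
  define d :: "nat \<Rightarrow> real" where "d i = (if F (?p i) * G (?p i) \<le> 0 then 1 else 0)" for i
  have sc: "real (sign_changes A B n F) = (\<Sum>i<n. if F (?p i) * F (?p (Suc i)) < 0 then 1 else 0)" for F
    unfolding sign_changes_indicator indicator_def of_bool_def mem_Collect_eq ..
  have "real (sign_changes A B n F) - real (sign_changes A B n G) = (\<Sum>i<n. (if F (?p i) * F (?p (Suc i)) < 0 then 1 else 0) - (if G (?p i) * G (?p (Suc i)) < 0 then 1 else 0))"
    unfolding sc by (simp add: sum_subtractf)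
  also have "\<bar>\<dots>\<bar> \<le> (\<Sum>i<n. d i + d (Suc i))"
  proof (rule order_trans[OF sum_abs sum_mono])
    fix i
    show "\<bar>(if F (?p i) * F (?p (Suc i)) < 0 then 1 else 0) - (if G (?p i) * G (?p (Suc i)) < 0 then 1 else 0 :: real)\<bar> \<le> d i + d (Suc i)"
    proof (cases "F (?p i) * G (?p i) \<le> 0 \<or> F (?p (Suc i)) * G (?p (Suc i)) \<le> 0")
      case True then show ?thesis by (auto simp: d_def)
    next
      case False
      have f0: "\<not> F (?p i) * G (?p i) \<le> 0" and f1: "\<not> F (?p (Suc i)) * G (?p (Suc i)) \<le> 0" using False by blast+
      have same_sign: "0 < x \<longleftrightarrow> 0 < y" "x < 0 \<longleftrightarrow> y < 0" if "\<not> x * y \<le> 0" for x y :: real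
      proof -
        have "0 < x * y" using that by simp
        then have "0 < x \<and> 0 < y \<or> x < 0 \<and> y < 0" by (simp only: zero_less_mult_iff)
        then show "0 < x \<longleftrightarrow> 0 < y" "x < 0 \<longleftrightarrow> y < 0" by auto
      qed
      have "F (?p i) * F (?p (Suc i)) < 0 \<longleftrightarrow> G (?p i) * G (?p (Suc i)) < 0"
        by (simp only: mult_less_0_iff same_sign[OF f0] same_sign[OF f1])
      then show ?thesis by (simp add: d_def)
    qed
  qed
  also have "\<dots> = (\<Sum>i<n. d i) + (\<Sum>i<n. d (Suc i))" by (rule sum.distrib)
  also have "\<dots> \<le> (\<Sum>i\<le>n. d i) + (\<Sum>i\<le>n. d i)"
  proof (rule add_mono)
    show "(\<Sum>i<n. d i) \<le> (\<Sum>i\<le>n. d i)" by (rule sum_mono2) (auto simp: d_def)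
    have "(\<Sum>i<n. d (Suc i)) = (\<Sum>i\<in>Suc ` {..<n}. d i)" by (simp add: sum.reindex)
    also have "\<dots> \<le> (\<Sum>i\<le>n. d i)" by (rule sum_mono2) (auto simp: d_def)
    finally show "(\<Sum>i<n. d (Suc i)) \<le> (\<Sum>i\<le>n. d i)" .
  qed
  finally show ?thesis by (simp add: d_def)
qed

text \<open>At most \<open>2 L\<close> of the covariances in a row of the covariance matrix do not vanish, and each is at most 1.\<close>

lemma (in prob_space) variance_local_dependence:
  fixes E :: "nat \<Rightarrow> 'a set" and m L :: nat
  assumes E: "\<And>i. i < m \<Longrightarrow> E i \<in> events"
    and ind: "\<And>i k. i + L \<le> k \<Longrightarrow> k < m \<Longrightarrow> prob (E i \<inter> E k) = prob (E i) * prob (E k)"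
  shows "expectation (\<lambda>\<omega>. ((\<Sum>i<m. indicator (E i) \<omega>) - (\<Sum>i<m. prob (E i)))\<^sup>2) \<le> 2 * real L * real m"
proof -
  define D where "D i \<omega> = indicator (E i) \<omega> - prob (E i)" for i \<omega>
  have Dm [measurable]: "D i \<in> borel_measurable M" if "i < m" for i unfolding D_def[abs_def] using E[OF that] by measurable
  have D1: "\<bar>D i \<omega>\<bar> \<le> 1" for i \<omega> using prob_le_1[of "E i"] by (auto simp: D_def indicator_def)
  have iD: "integrable M (\<lambda>\<omega>. D i \<omega> * D k \<omega>)" if "i < m" "k < m" for i k
    by (rule integrable_const_bound[where B=1]) (use D1 Dm that in \<open>auto simp: abs_mult intro!: mult_le_one\<close>)
  have ED: "expectation (\<lambda>\<omega>. D i \<omega> * D k \<omega>) = prob (E i \<inter> E k) - prob (E i) * prob (E k)" if ik: "i < m" "k < m" for i k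
  proof -
    have "expectation (\<lambda>\<omega>. D i \<omega> * D k \<omega>) = expectation (\<lambda>\<omega>. indicator (E i \<inter> E k) \<omega> - prob (E k) * indicator (E i) \<omega> - prob (E i) * indicator (E k) \<omega> + prob (E i) * prob (E k))"
      by (intro Bochner_Integration.integral_cong) (auto simp: D_def indicator_def algebra_simps)
    also have "\<dots> = prob (E i \<inter> E k) - prob (E k) * prob (E i) - prob (E i) * prob (E k) + prob (E i) * prob (E k)"
      using E[OF ik(1)] E[OF ik(2)]
      by (simp add: Bochner_Integration.integral_diff Bochner_Integration.integral_add emeasure_eq_measure prob_space)
    finally show ?thesis by simp
  qed
  have cov: "expectation (\<lambda>\<omega>. D i \<omega> * D k \<omega>) \<le> (if k < i + L \<and> i < k + L then 1 else 0)" if ik: "i < m" "k < m" for i k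
  proof (cases "k < i + L \<and> i < k + L")
    case True
    have "prob (E i \<inter> E k) - prob (E i) * prob (E k) \<le> 1" using prob_le_1[of "E i \<inter> E k"] by (smt (verit) measure_nonneg mult_nonneg_nonneg)
    then show ?thesis using True ED[OF ik] by simp
  next
    case False
    then have "prob (E i \<inter> E k) = prob (E i) * prob (E k)"
    proof (cases "k < i + L")
      case True
      then have "k + L \<le> i" using False by simp
      from ind[OF this ik(1)] show ?thesis by (simp add: Int_commute)
    next
      case False
      then show ?thesis using ind[of i k] ik by simp
    qed
    then show ?thesis using False ED[OF ik] by simp
  qed
  have "expectation (\<lambda>\<omega>. ((\<Sum>i<m. indicator (E i) \<omega>) - (\<Sum>i<m. prob (E i)))\<^sup>2) = expectation (\<lambda>\<omega>. \<Sum>i<m. \<Sum>k<m. D i \<omega> * D k \<omega>)"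
    by (intro Bochner_Integration.integral_cong) (simp_all add: D_def power2_eq_square sum_subtractf[symmetric] sum_product)
  also have "\<dots> = (\<Sum>i<m. \<Sum>k<m. expectation (\<lambda>\<omega>. D i \<omega> * D k \<omega>))"
    using iD by (subst Bochner_Integration.integral_sum) (auto intro!: Bochner_Integration.integrable_sum sum.cong Bochner_Integration.integral_sum)
  also have "\<dots> \<le> (\<Sum>i<m. \<Sum>k<m. (if k < i + L \<and> i < k + L then 1 else 0))" using cov by (intro sum_mono) auto
  also have "\<dots> \<le> (\<Sum>i<m. 2 * real L)"
  proof (rule sum_mono)
    fix i
    have "(\<Sum>k<m. (if k < i + L \<and> i < k + L then 1 else 0::real)) = real (card {k\<in>{..<m}. k < i + L \<and> i < k + L})"
      by (simp add: sum.If_cases Int_def)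
    also have "card {k\<in>{..<m}. k < i + L \<and> i < k + L} \<le> card {i - L..<i + L}" by (rule card_mono) auto
    also have "real (card {i - L..<i + L}) \<le> 2 * real L" by simp
    finally show "(\<Sum>k<m. (if k < i + L \<and> i < k + L then 1 else 0::real)) \<le> 2 * real L" by simp
  qed
  also have "\<dots> = 2 * real L * real m" by simp
  finally show ?thesis .
qed

section \<open>Concentration of the number of zeros\<close>

context brownian_motion_01 begin

text \<open>Sign changes on a grid undercount zeros, so their mean distance is the difference of their means, at most \<open>d1\<close>. The
triangle inequality passes from the zeros to the sign changes, to the approximation \<open>Y\<close>, to the mean of
\<open>Y\<close>, and back to \<open>\<mu>\<close>.\<close>

lemma zero_count_mean_deviation:
  fixes Y :: "'a \<Rightarrow> real"
  assumes b: "\<beta> > 0" and AB: "0 < A" "A < B" and m: "m > 0"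
    and mu: "(\<integral>\<^sup>+\<omega>. zero_count \<alpha> \<beta> A B (\<lambda>s. W s \<omega>) \<partial>completion M) = ennreal \<mu>" "\<mu> \<ge> 0"
    and Y: "integrable (completion M) Y"
    and d1: "\<mu> - grid_length \<alpha> \<beta> A B m / pi \<le> d1"
    and d2: "(LINT \<omega>|completion M. \<bar>real (sign_changes A B m (\<lambda>p. crit_process \<alpha> \<beta> p \<omega>)) - Y \<omega>\<bar>) \<le> d2"
    and d3: "(LINT \<omega>|completion M. \<bar>Y \<omega> - (LINT \<omega>|completion M. Y \<omega>)\<bar>) \<le> d3"
  shows "integrable (completion M) (\<lambda>\<omega>. enn2real (zero_count \<alpha> \<beta> A B (\<lambda>s. W s \<omega>)))"
    "(LINT \<omega>|completion M. \<bar>enn2real (zero_count \<alpha> \<beta> A B (\<lambda>s. W s \<omega>)) - \<mu>\<bar>) \<le> 2 * d1 + 2 * d2 + d3"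
    "AE \<omega> in completion M. zero_count \<alpha> \<beta> A B (\<lambda>s. W s \<omega>) = ennreal (enn2real (zero_count \<alpha> \<beta> A B (\<lambda>s. W s \<omega>)))"
proof -
  interpret C: prob_space "completion M" by (rule prob_space_completion)
  have ps: "measure (completion M) (space M) = 1" using C.prob_space by simp
  let ?Z = "\<lambda>\<omega>. zero_count \<alpha> \<beta> A B (\<lambda>s. W s \<omega>)"
  let ?N = "\<lambda>\<omega>. enn2real (?Z \<omega>)"
  let ?S = "\<lambda>\<omega>. real (sign_changes A B m (\<lambda>p. crit_process \<alpha> \<beta> p \<omega>))"
  note [measurable] = zero_count_measurable[OF b AB, of \<alpha>]
  have "AE \<omega> in completion M. ?Z \<omega> \<noteq> \<infinity>" by (rule nn_integral_noteq_infinite) (use mu in auto)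
  then show fin: "AE \<omega> in completion M. ?Z \<omega> = ennreal (?N \<omega>)"
    by eventually_elim (simp add: less_top)
  have nnN: "(\<integral>\<^sup>+\<omega>. ennreal (?N \<omega>) \<partial>completion M) = ennreal \<mu>"
    unfolding mu(1)[symmetric] by (rule nn_integral_cong_AE) (use fin in \<open>eventually_elim, simp\<close>)
  show iN: "integrable (completion M) ?N"
    by (rule integrableI_nn_integral_finite[OF _ _ nnN]) auto
  have EN: "(LINT \<omega>|completion M. ?N \<omega>) = \<mu>"
    by (rule integral_eq_nn_integral[THEN trans]) (auto simp: nnN mu)
  have iS: "integrable (completion M) ?S" by (rule sign_changes_integrable[OF b AB])
  have ES: "(LINT \<omega>|completion M. ?S \<omega>) = grid_length \<alpha> \<beta> A B m / pi" by (rule expectation_sign_changes[OF b AB])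
  have le: "AE \<omega> in completion M. ?S \<omega> \<le> ?N \<omega>"
    using AE_sign_changes_le_zero_count[OF b AB m, of \<alpha>] fin
  proof eventually_elim
    case (elim \<omega>)
    then have "ennreal (?S \<omega>) \<le> ennreal (?N \<omega>)" by (simp add: ennreal_of_nat_eq_real_of_nat)
    then show ?case by simp
  qed
  define EY where "EY = (LINT \<omega>|completion M. Y \<omega>)"
  define l where "l = grid_length \<alpha> \<beta> A B m / pi"
  have YS: "\<bar>EY - l\<bar> \<le> d2"
  proof -
    have "EY - l = (LINT \<omega>|completion M. Y \<omega> - ?S \<omega>)" unfolding EY_def l_def ES[symmetric] using Y iS by simp
    also have "\<bar>\<dots>\<bar> \<le> (LINT \<omega>|completion M. \<bar>Y \<omega> - ?S \<omega>\<bar>)" by (rule integral_abs_bound)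
    also have "\<dots> = (LINT \<omega>|completion M. \<bar>?S \<omega> - Y \<omega>\<bar>)" by (simp add: abs_minus_commute)
    finally show ?thesis using d2 by linarith
  qed
  have l_mu: "l \<le> \<mu>" unfolding l_def ES[symmetric] EN[symmetric] by (rule integral_mono_AE[OF iS iN le])
  have "(LINT \<omega>|completion M. \<bar>?N \<omega> - \<mu>\<bar>) \<le> (LINT \<omega>|completion M. (?N \<omega> - ?S \<omega>) + \<bar>?S \<omega> - Y \<omega>\<bar> + \<bar>Y \<omega> - EY\<bar> + (d2 + (\<mu> - l)))"
  proof (rule integral_mono_AE)
    show "AE \<omega> in completion M. \<bar>?N \<omega> - \<mu>\<bar> \<le> (?N \<omega> - ?S \<omega>) + \<bar>?S \<omega> - Y \<omega>\<bar> + \<bar>Y \<omega> - EY\<bar> + (d2 + (\<mu> - l))"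
      using le by eventually_elim (use YS l_mu in linarith)
  qed (use iN iS Y in auto)
  also have "\<dots> = (\<mu> - l) + (LINT \<omega>|completion M. \<bar>?S \<omega> - Y \<omega>\<bar>) + (LINT \<omega>|completion M. \<bar>Y \<omega> - EY\<bar>) + (d2 + (\<mu> - l))"
    using iN iS Y ps by (simp add: EN ES l_def)
  also have "\<dots> \<le> 2 * d1 + 2 * d2 + d3" using d1 d2 d3 unfolding EY_def l_def by linarith
  finally show "(LINT \<omega>|completion M. \<bar>?N \<omega> - \<mu>\<bar>) \<le> 2 * d1 + 2 * d2 + d3" .
qed

lemma windowed_events:
  assumes b: "\<beta> > 0" and AB: "0 < A" "A < B" and i: "i < m"
  shows "{\<omega>\<in>space M. windowed_process \<alpha> \<beta> h (grid A B m i) \<omega> * windowed_process \<alpha> \<beta> h (grid A B m (Suc i)) \<omega> < 0} \<in> sets (completion M)"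
proof -
  have "grid A B m i > 0" "grid A B m (Suc i) > 0" using i by (auto intro!: grid_pos[OF AB])
  note [measurable] = windowed_measurable[OF b this(1)] windowed_measurable[OF b this(2)]
  have "{\<omega>\<in>space (completion M). windowed_process \<alpha> \<beta> h (grid A B m i) \<omega> * windowed_process \<alpha> \<beta> h (grid A B m (Suc i)) \<omega> < 0} \<in> sets (completion M)" by measurable
  then show ?thesis by simp
qed

lemma sign_changes_windowed_eq:
  assumes "\<omega> \<in> space M"
  shows "real (sign_changes A B m (\<lambda>p. windowed_process \<alpha> \<beta> h p \<omega>)) = (\<Sum>i<m. indicator {\<omega>\<in>space M. windowed_process \<alpha> \<beta> h (grid A B m i) \<omega> * windowed_process \<alpha> \<beta> h (grid A B m (Suc i)) \<omega> < 0} \<omega>)"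
  unfolding sign_changes_indicator using assms by (intro sum.cong) (auto simp: indicator_def)

text \<open>The hypothesis on \<open>L\<close> says that cells with indices at least \<open>L\<close> apart have disjoint windows, since
\<open>sqrt q - sqrt p \<ge> (q - p) / (2 sqrt B)\<close>. The first absolute moment is bounded by the variance through
\<open>\<bar>x\<bar> \<le> (x\<^sup>2 / \<theta> + \<theta>) / 2\<close>, where \<open>\<theta>\<close> is free to be chosen.\<close>

lemma windowed_sign_changes_deviation:
  fixes \<alpha> \<beta> h A B \<theta> :: real and m L :: nat
  assumes b: "\<beta> > 0" and AB: "0 < A" "A < B" and m: "m > 0" and h: "h > 0"
    and L: "4 * sqrt B * h \<le> (real L - 1) * ((B - A) / m)" and th: "\<theta> > 0"
  shows "integrable (completion M) (\<lambda>\<omega>. real (sign_changes A B m (\<lambda>p. windowed_process \<alpha> \<beta> h p \<omega>)))"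
    "(LINT \<omega>|completion M. \<bar>real (sign_changes A B m (\<lambda>p. windowed_process \<alpha> \<beta> h p \<omega>)) - (LINT \<omega>|completion M. real (sign_changes A B m (\<lambda>p. windowed_process \<alpha> \<beta> h p \<omega>)))\<bar>)
      \<le> (2 * real L * real m / \<theta> + \<theta>) / 2"
proof -
  interpret C: prob_space "completion M" by (rule prob_space_completion)
  have ps: "measure (completion M) (space M) = 1" using C.prob_space by simp
  let ?g = "grid A B m"
  let ?E = "\<lambda>i. {\<omega>\<in>space M. windowed_process \<alpha> \<beta> h (?g i) \<omega> * windowed_process \<alpha> \<beta> h (?g (Suc i)) \<omega> < 0}"
  let ?S = "\<lambda>\<omega>. \<Sum>i<m. indicator (?E i) \<omega> :: real"
  let ?Y = "\<lambda>\<omega>. real (sign_changes A B m (\<lambda>p. windowed_process \<alpha> \<beta> h p \<omega>))"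
  have E: "?E i \<in> sets (completion M)" if "i < m" for i by (rule windowed_events[OF b AB that])
  have Sm [measurable]: "?S \<in> borel_measurable (completion M)" using E by (intro borel_measurable_sum borel_measurable_indicator) auto
  have S_le: "\<bar>?S \<omega>\<bar> \<le> m" for \<omega>
  proof -
    have "?S \<omega> \<le> (\<Sum>i<m. 1)" by (intro sum_mono) (auto simp: indicator_def)
    moreover have "?S \<omega> \<ge> 0" by (intro sum_nonneg) auto
    ultimately show ?thesis by simp
  qed
  have iS: "integrable (completion M) ?S" by (rule C.integrable_const_bound[where B="real m"]) (use S_le in auto)
  have eq: "?Y \<omega> = ?S \<omega>" if "\<omega> \<in> space (completion M)" for \<omega> using sign_changes_windowed_eq[of \<omega>] that by simp
  show "integrable (completion M) ?Y" by (rule Bochner_Integration.integrable_cong[OF refl, THEN iffD2, OF _ iS]) (rule eq)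
  have EY: "(LINT \<omega>|completion M. ?Y \<omega>) = (\<Sum>i<m. measure (completion M) (?E i))"
  proof -
    have "(LINT \<omega>|completion M. ?Y \<omega>) = (LINT \<omega>|completion M. ?S \<omega>)" by (rule Bochner_Integration.integral_cong[OF refl eq])
    also have "\<dots> = (\<Sum>i<m. LINT \<omega>|completion M. indicator (?E i) \<omega>)"
      using E by (intro Bochner_Integration.integral_sum) (auto intro!: integrable_real_indicator simp: C.emeasure_eq_measure)
    also have "\<dots> = (\<Sum>i<m. measure (completion M) (?E i))" by (intro sum.cong) (auto intro!: arg_cong[where f="measure (completion M)"])
    finally show ?thesis .
  qed
  define e where "e = (\<Sum>i<m. measure (completion M) (?E i))"
  have ind: "measure (completion M) (?E i \<inter> ?E k) = measure (completion M) (?E i) * measure (completion M) (?E k)" if ik: "i + L \<le> k" "k < m" for i k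
  proof -
    have L1: "L \<ge> 1"
    proof (rule ccontr)
      assume "\<not> 1 \<le> L"
      then have "L = 0" by simp
      have "0 < 4 * sqrt B * h" using AB h by simp
      moreover have "0 < (B - A) / m" using AB m by simp
      moreover have "(real L - 1) * ((B - A) / m) = - ((B - A) / m)" by (simp only: \<open>L = 0\<close> of_nat_0 diff_0 mult_minus1)
      ultimately show False using L by linarith
    qed
    have far: "2 * h \<le> \<bar>sqrt (?g i') - sqrt (?g k')\<bar>" if i': "i' \<le> Suc i" and k': "k \<le> k'" "k' \<le> m" for i' k'
    proof -
      have pos: "?g i' \<in> {A..B}" "?g k' \<in> {A..B}" 
        using grid_in[of A B i' m] grid_in[of A B k' m] ik i' k' L1 AB m by auto
      have "?g k' - ?g i' = (B - A) / m * (real k' - real i')" by (simp add: grid_def right_diff_distrib)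
      moreover have "real L - 1 \<le> real k' - real i'" using ik i' k' by linarith
      then have "(B - A) / m * (real L - 1) \<le> (B - A) / m * (real k' - real i')" using AB by (intro mult_left_mono) auto
      ultimately have "4 * sqrt B * h \<le> ?g k' - ?g i'" using L by (simp add: mult.commute)
      moreover have "?g k' - ?g i' = (sqrt (?g k') - sqrt (?g i')) * (sqrt (?g k') + sqrt (?g i'))"
      proof -
        have "sqrt (?g k') * sqrt (?g k') = ?g k'" "sqrt (?g i') * sqrt (?g i') = ?g i'" using pos AB by auto
        then show ?thesis by (simp add: algebra_simps)
      qed
      moreover have "(sqrt (?g k') - sqrt (?g i')) * (sqrt (?g k') + sqrt (?g i')) \<le> \<bar>sqrt (?g k') - sqrt (?g i')\<bar> * (2 * sqrt B)"
      proof (rule mult_mono)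
        have "sqrt (?g k') \<le> sqrt B" "sqrt (?g i') \<le> sqrt B" using pos by auto
        then show "sqrt (?g k') + sqrt (?g i') \<le> 2 * sqrt B" by linarith
        show "0 \<le> sqrt (?g k') + sqrt (?g i')" using pos AB by auto
      qed auto
      ultimately have "(2 * sqrt B) * (2 * h) \<le> (2 * sqrt B) * \<bar>sqrt (?g k') - sqrt (?g i')\<bar>" by (simp add: mult_ac)
      then have "2 * h \<le> \<bar>sqrt (?g k') - sqrt (?g i')\<bar>" using AB by (subst (asm) mult_le_cancel_left_pos) auto
      then show ?thesis by (simp add: abs_minus_commute)
    qed
    have p: "?g i > 0" "?g (Suc i) > 0" "?g k > 0" "?g (Suc k) > 0" using ik L1 m by (auto intro!: grid_pos[OF AB])
    have "?E i \<inter> ?E k = {\<omega>\<in>space M. windowed_process \<alpha> \<beta> h (?g i) \<omega> * windowed_process \<alpha> \<beta> h (?g (Suc i)) \<omega> < 0 \<and> windowed_process \<alpha> \<beta> h (?g k) \<omega> * windowed_process \<alpha> \<beta> h (?g (Suc k)) \<omega> < 0}"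
      by auto
    then show ?thesis using windowed_indep[OF b h p, of \<alpha>] far ik by simp
  qed
  have var: "(LINT \<omega>|completion M. (?S \<omega> - e)\<^sup>2) \<le> 2 * real L * real m"
    unfolding e_def by (rule C.variance_local_dependence[OF E ind])
  have iV: "integrable (completion M) (\<lambda>\<omega>. (?S \<omega> - e)\<^sup>2)"
  proof (rule C.integrable_const_bound[where B="(real m + \<bar>e\<bar>)\<^sup>2"])
    show "AE \<omega> in completion M. norm ((?S \<omega> - e)\<^sup>2) \<le> (real m + \<bar>e\<bar>)\<^sup>2"
    proof (rule AE_I2)
      fix \<omega>
      have "\<bar>?S \<omega> - e\<bar> \<le> real m + \<bar>e\<bar>" using S_le[of \<omega>] by linarith
      then show "norm ((?S \<omega> - e)\<^sup>2) \<le> (real m + \<bar>e\<bar>)\<^sup>2" by (simp add: abs_le_square_iff[symmetric])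
    qed
  qed measurable
  have "(LINT \<omega>|completion M. \<bar>?Y \<omega> - e\<bar>) = (LINT \<omega>|completion M. \<bar>?S \<omega> - e\<bar>)"
    by (rule Bochner_Integration.integral_cong) (use eq in auto)
  also have "\<dots> \<le> (LINT \<omega>|completion M. ((?S \<omega> - e)\<^sup>2 / \<theta> + \<theta>) / 2)"
  proof (rule integral_mono)
    show "integrable (completion M) (\<lambda>\<omega>. ((?S \<omega> - e)\<^sup>2 / \<theta> + \<theta>) / 2)" using iV by auto
    fix \<omega>
    have amgm: "\<bar>x\<bar> \<le> (x\<^sup>2 / \<theta> + \<theta>) / 2" for x :: real
    proof -
      have "0 \<le> (\<bar>x\<bar> - \<theta>)\<^sup>2" by simp
      also have "(\<bar>x\<bar> - \<theta>)\<^sup>2 = x\<^sup>2 + \<theta>\<^sup>2 - 2 * \<bar>x\<bar> * \<theta>" by (simp add: power2_diff)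
      finally have "2 * \<bar>x\<bar> * \<theta> \<le> x\<^sup>2 + \<theta>\<^sup>2" by simp
      then show ?thesis using th by (simp add: field_simps power2_eq_square)
    qed
    show "\<bar>?S \<omega> - e\<bar> \<le> ((?S \<omega> - e)\<^sup>2 / \<theta> + \<theta>) / 2" by (rule amgm)
  qed (use iS in auto)
  also have "\<dots> = ((LINT \<omega>|completion M. (?S \<omega> - e)\<^sup>2) / \<theta> + \<theta>) / 2" using iV ps by simp
  also have "\<dots> \<le> (2 * real L * real m / \<theta> + \<theta>) / 2" using var th by (simp add: divide_right_mono)
  finally show "(LINT \<omega>|completion M. \<bar>?Y \<omega> - (LINT \<omega>|completion M. ?Y \<omega>)\<bar>) \<le> (2 * real L * real m / \<theta> + \<theta>) / 2"
    unfolding EY e_def .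
qed

lemma windowed_sign_changes_close:
  fixes \<alpha> \<beta> h A B e :: real and m :: nat
  assumes b: "\<beta> > 0" and AB: "0 < A" "A < B" and m: "m > 0"
    and e: "\<And>p. p \<in> {A..B} \<Longrightarrow> measure (completion M) {\<omega>\<in>space M. crit_process \<alpha> \<beta> p \<omega> * windowed_process \<alpha> \<beta> h p \<omega> \<le> 0} \<le> e"
  shows "(LINT \<omega>|completion M. \<bar>real (sign_changes A B m (\<lambda>p. crit_process \<alpha> \<beta> p \<omega>)) - real (sign_changes A B m (\<lambda>p. windowed_process \<alpha> \<beta> h p \<omega>))\<bar>) \<le> 2 * ((real m + 1) * e)"
proof -
  interpret C: prob_space "completion M" by (rule prob_space_completion)
  let ?g = "grid A B m"
  define D where "D i = {\<omega>\<in>space M. crit_process \<alpha> \<beta> (?g i) \<omega> * windowed_process \<alpha> \<beta> h (?g i) \<omega> \<le> 0}" for i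
  have D: "D i \<in> sets (completion M)" if "i \<le> m" for i
  proof -
    have "?g i > 0" using that m by (intro grid_pos[OF AB])
    note [measurable] = crit_process_measurable[OF b this] windowed_measurable[OF b this]
    have "{\<omega>\<in>space (completion M). crit_process \<alpha> \<beta> (?g i) \<omega> * windowed_process \<alpha> \<beta> h (?g i) \<omega> \<le> 0} \<in> sets (completion M)" by measurable
    then show ?thesis by (simp add: D_def)
  qed
  have iD: "integrable (completion M) (\<lambda>\<omega>. indicator (D i) \<omega> :: real)" if "i \<le> m" for i
    using D[OF that] by (intro integrable_real_indicator) (auto simp: C.emeasure_eq_measure)
  have iDs: "integrable (completion M) (\<lambda>\<omega>. 2 * (\<Sum>i\<le>m. indicator (D i) \<omega> :: real))"
    using iD by (intro integrable_mult_right Bochner_Integration.integrable_sum) auto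
  have "(LINT \<omega>|completion M. \<bar>real (sign_changes A B m (\<lambda>p. crit_process \<alpha> \<beta> p \<omega>)) - real (sign_changes A B m (\<lambda>p. windowed_process \<alpha> \<beta> h p \<omega>))\<bar>)
     \<le> (LINT \<omega>|completion M. 2 * (\<Sum>i\<le>m. indicator (D i) \<omega>))"
  proof (rule integral_mono'[OF iDs])
    fix \<omega> assume "\<omega> \<in> space (completion M)"
    then have w: "\<omega> \<in> space M" by simp
    have "(\<Sum>i\<le>m. indicator (D i) \<omega>) = (\<Sum>i\<le>m. if crit_process \<alpha> \<beta> (?g i) \<omega> * windowed_process \<alpha> \<beta> h (?g i) \<omega> \<le> 0 then 1 else 0 :: real)"
      using w by (intro sum.cong) (auto simp: D_def indicator_def)
    then show "\<bar>real (sign_changes A B m (\<lambda>p. crit_process \<alpha> \<beta> p \<omega>)) - real (sign_changes A B m (\<lambda>p. windowed_process \<alpha> \<beta> h p \<omega>))\<bar> \<le> 2 * (\<Sum>i\<le>m. indicator (D i) \<omega>)"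
      using sign_changes_diff[of A B m "\<lambda>p. crit_process \<alpha> \<beta> p \<omega>" "\<lambda>p. windowed_process \<alpha> \<beta> h p \<omega>"] by simp
  next
    fix \<omega> show "0 \<le> 2 * (\<Sum>i\<le>m. indicator (D i) \<omega> :: real)" by (simp add: sum_nonneg)
  qed
  also have "\<dots> = 2 * (\<Sum>i\<le>m. LINT \<omega>|completion M. indicator (D i) \<omega>)"
    using iD by (subst integral_mult_right_zero, subst Bochner_Integration.integral_sum) auto
  also have "\<dots> = 2 * (\<Sum>i\<le>m. measure (completion M) (D i))"
    by (auto simp: D_def intro!: sum.cong arg_cong[where f="measure (completion M)"])
  also have "\<dots> \<le> 2 * (\<Sum>i\<le>m. e)"
  proof (intro mult_left_mono sum_mono)
    fix i assume "i \<in> {..m}"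
    then show "measure (completion M) (D i) \<le> e" unfolding D_def using AB m by (intro e grid_in) auto
  qed simp
  also have "\<dots> = 2 * ((real m + 1) * e)" by simp
  finally show ?thesis .
qed

end

text \<open>In a grid of mesh at least \<open>K s\<close> every side of the polygon has length at least \<open>pi / 3\<close>.\<close>

lemma grid_length_lower:
  fixes \<alpha> a b :: real
  assumes al: "\<alpha> > 0" and a: "a > 0" and ab: "a < b" "b \<le> \<alpha>"
  obtains c s0 where "c > 0" "s0 > 0" "s0 \<le> 1" "\<And>s. 0 < s \<Longrightarrow> s \<le> s0 \<Longrightarrow> \<exists>m>0. c / s \<le> grid_length \<alpha> (rate s) (a\<^sup>2) (b\<^sup>2) m / pi"
proof -
  obtain K where K: "K > 0" and far: "\<And>s p q. 0 < s \<Longrightarrow> s \<le> 1 \<Longrightarrow> p \<in> {a\<^sup>2..b\<^sup>2} \<Longrightarrow> q \<in> {a\<^sup>2..b\<^sup>2} \<Longrightarrow> K * s \<le> \<bar>p - q\<bar> \<Longrightarrow>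
     pi / 3 \<le> field_angle \<alpha> (rate s) p q"
    using correlation_decay[OF al a ab] by blast
  define l where "l = b\<^sup>2 - a\<^sup>2"
  have ab2: "a\<^sup>2 < b\<^sup>2" using a ab by (intro power_strict_mono) auto
  then have l: "l > 0" by (simp add: l_def)
  \<comment> \<open>\<open>m\<close> is at least half of \<open>l / (K s)\<close>, which costs a factor 2 besides the 3 of \<open>pi / 3\<close>\<close>
  show ?thesis
  proof (rule that[of "l / (6 * K)" "min 1 (l / K)"])
    show "l / (6 * K) > 0" "min 1 (l / K) > 0" "min 1 (l / K) \<le> 1" using l K by auto
    fix s :: real assume s: "0 < s" "s \<le> min 1 (l / K)"
    define m where "m = nat \<lfloor>l / (K * s)\<rfloor>"
    have ge1: "1 \<le> l / (K * s)" using s K l by (simp add: field_simps)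
    then have m1: "m \<ge> 1" unfolding m_def by (simp add: le_nat_floor)
    have m_le: "real m \<le> l / (K * s)" unfolding m_def using ge1 by (intro of_nat_floor) simp
    have m_ge: "l / (K * s) \<le> 2 * real m"
    proof -
      have "l / (K * s) < real m + 1" unfolding m_def using ge1 by linarith
      then show ?thesis using m1 by simp
    qed
    have step: "K * s \<le> (b\<^sup>2 - a\<^sup>2) / m" using m_le m1 s K by (simp add: l_def field_simps)
    have "(\<Sum>i<m. pi / 3) \<le> grid_length \<alpha> (rate s) (a\<^sup>2) (b\<^sup>2) m"
      unfolding grid_length_def
    proof (rule sum_mono)
      fix i assume i: "i \<in> {..<m}"
      show "pi / 3 \<le> field_angle \<alpha> (rate s) (grid (a\<^sup>2) (b\<^sup>2) m i) (grid (a\<^sup>2) (b\<^sup>2) m (Suc i))"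
        using s i m1 ab2 step by (intro far grid_in) (auto simp: grid_Suc)
    qed
    then have "real m / 3 \<le> grid_length \<alpha> (rate s) (a\<^sup>2) (b\<^sup>2) m / pi" by (simp add: field_simps)
    moreover have "l / (6 * K) / s \<le> real m / 3" using m_ge s K by (simp add: field_simps)
    ultimately show "\<exists>m>0. l / (6 * K) / s \<le> grid_length \<alpha> (rate s) (a\<^sup>2) (b\<^sup>2) m / pi"
      using m1 by (intro exI[of _ m]) auto
  qed
qed

lemma conga_sigma_pos:
  assumes "0 < \<alpha>" "\<alpha> < 1" "t > 0" shows "conga_sigma \<alpha> t > 0"
  using assms by (simp add: conga_sigma_def)

lemma conga_sigma_tendsto_0: "((\<lambda>t. conga_sigma \<alpha> t) \<longlongrightarrow> 0) at_top"
  unfolding conga_sigma_def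
  by (intro tendsto_divide_0[OF tendsto_const] filterlim_at_top_imp_at_infinity sqrt_at_top)

context brownian_motion_01 begin

text \<open>First \<open>\<eta>\<close> fixes the mesh \<open>\<eta> s\<close> of the coarse grid, then \<open>R\<close> the width of the windows, then \<open>L\<close> the range of
dependence in cells. None of them depends on \<open>s\<close>. Last, \<open>s\<close> is small enough for the deviation of order
\<open>s powr (-1/2)\<close> to be below \<open>\<delta> / s\<close>.\<close>

lemma zero_count_concentration:
  fixes \<alpha> a b \<delta> :: real
  assumes al: "\<alpha> > 0" and a: "a > 0" and ab: "a < b" "b \<le> \<alpha>" and d: "\<delta> > 0"
  obtains s0 where "s0 > 0" "s0 \<le> 1" "\<And>s. 0 < s \<Longrightarrow> s \<le> s0 \<Longrightarrow> \<exists>\<mu>\<ge>0.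
      (\<integral>\<^sup>+\<omega>. zero_count \<alpha> (rate s) (a\<^sup>2) (b\<^sup>2) (\<lambda>s. W s \<omega>) \<partial>completion M) = ennreal \<mu> \<and>
      integrable (completion M) (\<lambda>\<omega>. enn2real (zero_count \<alpha> (rate s) (a\<^sup>2) (b\<^sup>2) (\<lambda>s. W s \<omega>))) \<and>
      (AE \<omega> in completion M. zero_count \<alpha> (rate s) (a\<^sup>2) (b\<^sup>2) (\<lambda>s. W s \<omega>) = ennreal (enn2real (zero_count \<alpha> (rate s) (a\<^sup>2) (b\<^sup>2) (\<lambda>s. W s \<omega>)))) \<and>
      (LINT \<omega>|completion M. \<bar>enn2real (zero_count \<alpha> (rate s) (a\<^sup>2) (b\<^sup>2) (\<lambda>s. W s \<omega>)) - \<mu>\<bar>) \<le> 7 * \<delta> / s"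
proof -
  define A where "A = a\<^sup>2"
  define B where "B = b\<^sup>2"
  have AB: "0 < A" "A < B" using a ab by (auto simp: A_def B_def intro!: power_strict_mono)
  have b0: "b > 0" using a ab by simp
  have sqB: "sqrt B = b" using b0 by (simp add: B_def)
  define l where "l = B - A"
  have l: "l > 0" using AB by (simp add: l_def)
  obtain V T where V: "V \<ge> 0" "T \<ge> 0" and refine: "\<And>s m k. 0 < s \<Longrightarrow> s \<le> 1 \<Longrightarrow> m > 0 \<Longrightarrow> k > 0 \<Longrightarrow>
     grid_length \<alpha> (rate s) (a\<^sup>2) (b\<^sup>2) (m * k) \<le> grid_length \<alpha> (rate s) (a\<^sup>2) (b\<^sup>2) m
       + real m * (2 * ((b\<^sup>2 - a\<^sup>2) / (m * s)) * sqrt (2 * T * ((b\<^sup>2 - a\<^sup>2) / (m * s))) + ((b\<^sup>2 - a\<^sup>2) / (m * s) * sqrt V) ^ 3 / 4)"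
    by (rule grid_length_refine[OF al a ab]) blast
  define f where "f y = l * (2 * sqrt (2 * T * y) + y\<^sup>2 * sqrt V ^ 3 / 4)" for y
  have "(f \<longlongrightarrow> l * (2 * sqrt (2 * T * 0) + 0\<^sup>2 * sqrt V ^ 3 / 4)) (at_right 0)"
    unfolding f_def by (intro tendsto_intros) auto
  then have "(f \<longlongrightarrow> 0) (at_right 0)" by simp
  then have "\<forall>\<^sub>F y in at_right 0. f y < \<delta>" using d by (rule order_tendstoD)
  then obtain \<eta> where eta: "\<eta> > 0" "\<And>y. 0 < y \<Longrightarrow> y < \<eta> \<Longrightarrow> f y < \<delta>" by (auto simp: eventually_at_right_field)
  define Q where "Q = 2 * l / \<eta> + 1"
  have Q: "Q > 0" using l eta by (simp add: Q_def add_pos_pos)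
  obtain R where R: "R > 0" and close: "\<And>s p. 0 < s \<Longrightarrow> s \<le> 1 \<Longrightarrow> p \<in> {a\<^sup>2..b\<^sup>2} \<Longrightarrow>
     measure (completion M) {\<omega>\<in>space M. crit_process \<alpha> (rate s) p \<omega> * windowed_process \<alpha> (rate s) (R * s) p \<omega> \<le> 0} \<le> \<delta> / (2 * Q)"
    using windowed_sign_differs[OF al a ab, of "\<delta> / (2 * Q)"] d Q by auto
  define L where "L = nat \<lceil>4 * b * R * Q / l\<rceil> + 1"
  have L: "4 * b * R * Q / l \<le> real L - 1" unfolding L_def by simp linarith
  define s0 where "s0 = min 1 (\<delta>\<^sup>2 / (2 * real L * Q))"
  have L0: "real L > 0" by (simp add: L_def)
  show ?thesis
  proof (rule that[of s0])
    show "s0 > 0" "s0 \<le> 1" unfolding s0_def using d L0 Q by auto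
    fix s :: real assume s: "0 < s" "s \<le> s0"
    then have s1: "s \<le> 1" and s2: "s \<le> \<delta>\<^sup>2 / (2 * real L * Q)" by (auto simp: s0_def)
    define \<beta> where "\<beta> = rate s"
    have b: "\<beta> > 0" using s by (simp add: \<beta>_def)
    \<comment> \<open>the factor 2 makes the mesh strictly smaller than \<open>\<eta> s\<close>\<close>
    define m where "m = nat \<lceil>2 * l / (\<eta> * s)\<rceil>"
    have pos: "2 * l / (\<eta> * s) > 0" using l eta s by simp
    have m_ge: "2 * l / (\<eta> * s) \<le> real m" unfolding m_def by linarith
    then have m0: "m > 0" using pos by (metis gr_zeroI of_nat_0 less_le_not_le)
    have m_le: "real m \<le> Q / s"
    proof -
      have "real m \<le> 2 * l / (\<eta> * s) + 1" unfolding m_def using pos by linarith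
      also have "1 \<le> 1 / s" using s s1 by simp
      finally have "real m \<le> 2 * l / (\<eta> * s) + 1 / s" by simp
      also have "\<dots> = Q / s" by (simp add: Q_def add_divide_distrib)
      finally show ?thesis .
    qed
    define y where "y = l / (m * s)"
    have y0: "y > 0" using l m0 s by (simp add: y_def)
    have y1: "y < \<eta>"
    proof -
      have "2 * l \<le> real m * (\<eta> * s)" using m_ge eta s by (simp add: divide_le_eq)
      then have "l < real m * (\<eta> * s)" using l by linarith
      then show ?thesis using m0 s by (simp add: y_def divide_less_eq mult_ac)
    qed
    have ref: "grid_length \<alpha> \<beta> A B (m * k) / pi \<le> grid_length \<alpha> \<beta> A B m / pi + \<delta> / s" if k: "k > 0" for k
    proof -
      have "real m * (2 * y * sqrt (2 * T * y) + (y * sqrt V) ^ 3 / 4) = (real m * y) * (2 * sqrt (2 * T * y) + y\<^sup>2 * sqrt V ^ 3 / 4)"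
        by (simp add: algebra_simps power_mult_distrib power3_eq_cube power2_eq_square)
      also have "real m * y = l / s" using m0 by (simp add: y_def)
      also have "l / s * (2 * sqrt (2 * T * y) + y\<^sup>2 * sqrt V ^ 3 / 4) = f y / s" by (simp add: f_def)
      also have "\<dots> \<le> \<delta> / s" using eta(2)[OF y0 y1] s by (intro divide_right_mono) auto
      finally have "grid_length \<alpha> \<beta> A B (m * k) \<le> grid_length \<alpha> \<beta> A B m + \<delta> / s"
        using refine[OF s(1) s1 m0 k] unfolding A_def[symmetric] B_def[symmetric] l_def[symmetric] \<beta>_def[symmetric] y_def[symmetric] by linarith
      then have "grid_length \<alpha> \<beta> A B (m * k) / pi \<le> (grid_length \<alpha> \<beta> A B m + \<delta> / s) / pi" by (intro divide_right_mono) auto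
      also have "\<dots> = grid_length \<alpha> \<beta> A B m / pi + (\<delta> / s) / pi" by (simp add: add_divide_distrib)
      also have "(\<delta> / s) / pi \<le> \<delta> / s"
      proof -
        have "(\<delta> / s) / pi \<le> (\<delta> / s) / 1" using d s pi_gt3 by (intro divide_left_mono) auto
        then show ?thesis by simp
      qed
      finally show ?thesis by simp
    qed
    let ?Z = "\<lambda>\<omega>. zero_count \<alpha> \<beta> A B (\<lambda>s. W s \<omega>)"
    have le: "(\<integral>\<^sup>+\<omega>. ?Z \<omega> \<partial>completion M) \<le> ennreal (grid_length \<alpha> \<beta> A B m / pi + \<delta> / s)"
      by (rule expectation_zero_count_le[OF b AB m0 ref])
    define \<mu> where "\<mu> = enn2real (\<integral>\<^sup>+\<omega>. ?Z \<omega> \<partial>completion M)"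
    have mu: "(\<integral>\<^sup>+\<omega>. ?Z \<omega> \<partial>completion M) = ennreal \<mu>" "\<mu> \<ge> 0"
    proof -
      have "(\<integral>\<^sup>+\<omega>. ?Z \<omega> \<partial>completion M) < top" by (rule le_less_trans[OF le]) simp
      then show "(\<integral>\<^sup>+\<omega>. ?Z \<omega> \<partial>completion M) = ennreal \<mu>" unfolding \<mu>_def by simp
      show "\<mu> \<ge> 0" unfolding \<mu>_def by simp
    qed
    have gl0: "0 \<le> grid_length \<alpha> \<beta> A B m / pi"
      unfolding expectation_sign_changes[OF b AB, symmetric] by simp
    have d1: "\<mu> - grid_length \<alpha> \<beta> A B m / pi \<le> \<delta> / s"
    proof -
      have "\<mu> \<le> grid_length \<alpha> \<beta> A B m / pi + \<delta> / s" using le gl0 d s unfolding mu(1) by (subst (asm) ennreal_le_iff) auto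
      then show ?thesis by simp
    qed
    let ?Y = "\<lambda>\<omega>. real (sign_changes A B m (\<lambda>p. windowed_process \<alpha> \<beta> (R * s) p \<omega>))"
    have Rs: "R * s > 0" using R s by simp
    have LL: "4 * sqrt B * (R * s) \<le> (real L - 1) * ((B - A) / m)"
    proof -
      have "4 * b * (R * s) = (4 * b * R * Q / l) * (l / (Q / s))" using l Q s by simp
      also have "\<dots> \<le> (real L - 1) * (l / m)"
      proof (rule mult_mono[OF L])
        show "l / (Q / s) \<le> l / m" using m_le m0 l Q s by (intro divide_left_mono) auto
        show "0 \<le> real L - 1" by (simp add: L_def)
        show "0 \<le> l / (Q / s)" using l Q s by simp
      qed
      finally show ?thesis unfolding sqB l_def .
    qed
    have th: "\<delta> / s > 0" using d s by simp
    have d2: "(LINT \<omega>|completion M. \<bar>real (sign_changes A B m (\<lambda>p. crit_process \<alpha> \<beta> p \<omega>)) - ?Y \<omega>\<bar>) \<le> 2 * (\<delta> / s)"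
    proof -
      have "(LINT \<omega>|completion M. \<bar>real (sign_changes A B m (\<lambda>p. crit_process \<alpha> \<beta> p \<omega>)) - ?Y \<omega>\<bar>) \<le> 2 * ((real m + 1) * (\<delta> / (2 * Q)))"
        by (rule windowed_sign_changes_close[OF b AB m0]) (use close[OF s(1) s1] in \<open>simp add: A_def B_def \<beta>_def\<close>)
      also have "\<dots> \<le> 2 * ((2 * (Q / s)) * (\<delta> / (2 * Q)))" using m_le m0 d Q by (intro mult_left_mono mult_right_mono) auto
      also have "\<dots> = 2 * (\<delta> / s)" using Q by simp
      finally show ?thesis .
    qed
    have d3: "(LINT \<omega>|completion M. \<bar>?Y \<omega> - (LINT \<omega>|completion M. ?Y \<omega>)\<bar>) \<le> \<delta> / s"
    proof -
      have "(LINT \<omega>|completion M. \<bar>?Y \<omega> - (LINT \<omega>|completion M. ?Y \<omega>)\<bar>) \<le> (2 * real L * real m / (\<delta> / s) + \<delta> / s) / 2"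
        by (rule windowed_sign_changes_deviation(2)[OF b AB m0 Rs LL th])
      also have "\<dots> \<le> \<delta> / s"
      proof -
        have "2 * real L * real m \<le> 2 * real L * (Q / s)" using m_le by (intro mult_left_mono) auto
        also have "\<dots> \<le> (\<delta> / s) * (\<delta> / s)"
        proof -
          have "s * (2 * real L * Q) \<le> \<delta>\<^sup>2" using s2 L0 Q by (simp add: le_divide_eq)
          then have "s * (2 * real L * Q) / (s * s) \<le> \<delta>\<^sup>2 / (s * s)" by (intro divide_right_mono) auto
          then show ?thesis using s by (simp add: power2_eq_square)
        qed
        finally have "2 * real L * real m / (\<delta> / s) \<le> \<delta> / s" using th by (subst divide_le_eq) simp
        moreover have "(u + v) / 2 \<le> v" if "u \<le> v" for u v :: real using that by simp
        ultimately show ?thesis by blast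
      qed
      finally show ?thesis .
    qed
    note dev = zero_count_mean_deviation[OF b AB m0 mu windowed_sign_changes_deviation(1)[OF b AB m0 Rs LL th] d1 d2 d3]
    have "2 * (\<delta> / s) + 2 * (2 * (\<delta> / s)) + \<delta> / s = 7 * \<delta> / s" by (simp add: add_divide_distrib[symmetric])
    then show "\<exists>\<mu>\<ge>0.
      (\<integral>\<^sup>+\<omega>. zero_count \<alpha> (rate s) (a\<^sup>2) (b\<^sup>2) (\<lambda>s. W s \<omega>) \<partial>completion M) = ennreal \<mu> \<and>
      integrable (completion M) (\<lambda>\<omega>. enn2real (zero_count \<alpha> (rate s) (a\<^sup>2) (b\<^sup>2) (\<lambda>s. W s \<omega>))) \<and>
      (AE \<omega> in completion M. zero_count \<alpha> (rate s) (a\<^sup>2) (b\<^sup>2) (\<lambda>s. W s \<omega>) = ennreal (enn2real (zero_count \<alpha> (rate s) (a\<^sup>2) (b\<^sup>2) (\<lambda>s. W s \<omega>)))) \<and>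
      (LINT \<omega>|completion M. \<bar>enn2real (zero_count \<alpha> (rate s) (a\<^sup>2) (b\<^sup>2) (\<lambda>s. W s \<omega>)) - \<mu>\<bar>) \<le> 7 * \<delta> / s"
      using mu dev unfolding A_def B_def \<beta>_def by (intro exI[of _ \<mu>] conjI) auto
  qed
qed

lemma AE_num_crit_eq_zero_count:
  assumes s: "s = conga_sigma \<alpha> t" "s > 0" and a: "0 < a" "a \<le> b"
  shows "AE \<omega> in completion M. num_crit \<alpha> (\<lambda>s. W s \<omega>) t {a..b} = zero_count \<alpha> (rate s) (a\<^sup>2) (b\<^sup>2) (\<lambda>s. W s \<omega>)"
  using BM_continuous[THEN AE_completion]
  by eventually_elim (unfold zero_count_def, rule num_crit_eq_zeros[OF s refl _ a])

text \<open>Markov's inequality; the absolute value is taken in the extended reals, where \<open>Z\<close> almost surely has a finite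
value.\<close>

lemma ratio_deviation_prob:
  fixes Z :: "'a \<Rightarrow> ennreal"
  assumes Z [measurable]: "Z \<in> borel_measurable (completion M)" and mu: "\<mu> > 0" and e: "\<epsilon> > 0"
    and i: "integrable (completion M) (\<lambda>\<omega>. enn2real (Z \<omega>))"
    and fin: "AE \<omega> in completion M. Z \<omega> = ennreal (enn2real (Z \<omega>))"
    and dev: "(LINT \<omega>|completion M. \<bar>enn2real (Z \<omega>) - \<mu>\<bar>) \<le> d"
  shows "measure (completion M) {\<omega>\<in>space (completion M). \<bar>enn2ereal (Z \<omega> / ennreal \<mu>) - ereal 1\<bar> > ereal \<epsilon>} \<le> d / (\<epsilon> * \<mu>)"
proof -
  interpret C: prob_space "completion M" by (rule prob_space_completion)
  have em: "\<epsilon> * \<mu> > 0" using e mu by simp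
  have S: "{\<omega>\<in>space (completion M). \<epsilon> * \<mu> \<le> \<bar>enn2real (Z \<omega>) - \<mu>\<bar>} \<in> sets (completion M)" by measurable
  have "measure (completion M) {\<omega>\<in>space (completion M). \<bar>enn2ereal (Z \<omega> / ennreal \<mu>) - ereal 1\<bar> > ereal \<epsilon>}
     \<le> measure (completion M) {\<omega>\<in>space (completion M). \<epsilon> * \<mu> \<le> \<bar>enn2real (Z \<omega>) - \<mu>\<bar>}"
  proof (rule C.finite_measure_mono_AE[OF _ S])
    show "AE \<omega> in completion M. \<omega> \<in> {\<omega>\<in>space (completion M). \<bar>enn2ereal (Z \<omega> / ennreal \<mu>) - ereal 1\<bar> > ereal \<epsilon>} \<longrightarrow>
       \<omega> \<in> {\<omega>\<in>space (completion M). \<epsilon> * \<mu> \<le> \<bar>enn2real (Z \<omega>) - \<mu>\<bar>}"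
      using fin
    proof eventually_elim
      case (elim \<omega>)
      define n where "n = enn2real (Z \<omega>)"
      have n0: "n \<ge> 0" by (simp add: n_def)
      have "Z \<omega> / ennreal \<mu> = ennreal (n / \<mu>)" using elim divide_ennreal[OF n0 mu] by (simp add: n_def)
      then have q: "enn2ereal (Z \<omega> / ennreal \<mu>) = ereal (n / \<mu>)" using n0 mu by simp
      show ?case
      proof
        assume w: "\<omega> \<in> {\<omega>\<in>space (completion M). \<bar>enn2ereal (Z \<omega> / ennreal \<mu>) - ereal 1\<bar> > ereal \<epsilon>}"
        then have "\<epsilon> < \<bar>n / \<mu> - 1\<bar>" unfolding mem_Collect_eq q by simp
        also have "\<bar>n / \<mu> - 1\<bar> = \<bar>n - \<mu>\<bar> / \<mu>"
        proof -
          have "n / \<mu> - 1 = (n - \<mu>) / \<mu>" using mu by (simp add: field_simps)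
          then show ?thesis using mu by simp
        qed
        finally have "\<epsilon> * \<mu> \<le> \<bar>n - \<mu>\<bar>" using mu by (simp add: less_divide_eq)
        then show "\<omega> \<in> {\<omega>\<in>space (completion M). \<epsilon> * \<mu> \<le> \<bar>enn2real (Z \<omega>) - \<mu>\<bar>}" using w by (simp add: n_def)
      qed
    qed
  qed
  also have "\<dots> \<le> (LINT \<omega>|completion M. \<bar>enn2real (Z \<omega>) - \<mu>\<bar>) / (\<epsilon> * \<mu>)"
    by (rule integral_Markov_inequality_measure[where A="{}"]) (use i em in auto)
  also have "\<dots> \<le> d / (\<epsilon> * \<mu>)" using dev em by (intro divide_right_mono) auto
  finally show ?thesis .
qed

end

theorem lemma11:
  fixes M :: "'a measure" and W :: "real \<Rightarrow> 'a \<Rightarrow> real" and \<alpha> a b :: real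
  assumes "0 < \<alpha>" "\<alpha> < 1"
    and "brownian_motion_01 M W"
    and "a < b" "{a..b} \<subseteq> {0<..\<alpha>}"
  shows "tendsto_in_prob (completion M)
           (\<lambda>t \<omega>. num_crit \<alpha> (\<lambda>s. W s \<omega>) t {a..b}
                  / (\<integral>\<^sup>+\<omega>'. num_crit \<alpha> (\<lambda>s. W s \<omega>') t {a..b} \<partial>completion M))
           1 at_top"
proof -
  interpret brownian_motion_01 M W by fact
  interpret C: prob_space "completion M" by (rule prob_space_completion)
  note al = \<open>0 < \<alpha>\<close>
  have "a \<in> {a..b}" "b \<in> {a..b}" using assms(4) by auto
  then have ab: "0 < a" "a < b" "b \<le> \<alpha>" using assms(4) subsetD[OF assms(5)] by auto
  have AB: "0 < a\<^sup>2" "a\<^sup>2 < b\<^sup>2" using ab by (auto intro!: power_strict_mono)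
  let ?s = "\<lambda>t. conga_sigma \<alpha> t"
  let ?N = "\<lambda>t \<omega>. num_crit \<alpha> (\<lambda>s. W s \<omega>) t {a..b}"
  let ?Z = "\<lambda>t \<omega>. zero_count \<alpha> (rate (?s t)) (a\<^sup>2) (b\<^sup>2) (\<lambda>s. W s \<omega>)"
  have ae: "AE \<omega> in completion M. ?N t \<omega> = ?Z t \<omega>" if "t > 0" for t
    by (rule AE_num_crit_eq_zero_count[OF refl]) (use conga_sigma_pos assms(1,2) that ab in auto)
  have Zm: "?Z t \<in> borel_measurable (completion M)" if "t > 0" for t
    by (rule zero_count_measurable) (use conga_sigma_pos[OF assms(1,2) that] AB in auto)
  have Nm: "?N t \<in> borel_measurable (completion M)" if t: "t > 0" for t
    by (rule measurable_completion_AE_eq[OF Zm[OF t]]) (use ae[OF t] in \<open>auto elim: eventually_mono\<close>)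
  have EN: "(\<integral>\<^sup>+\<omega>. ?N t \<omega> \<partial>completion M) = (\<integral>\<^sup>+\<omega>. ?Z t \<omega> \<partial>completion M)" if t: "t > 0" for t
    by (rule nn_integral_cong_AE[OF ae[OF t]])
  obtain c s1 where c: "c > 0" "s1 > 0" "s1 \<le> 1" and low: "\<And>s. 0 < s \<Longrightarrow> s \<le> s1 \<Longrightarrow> \<exists>m>0. c / s \<le> grid_length \<alpha> (rate s) (a\<^sup>2) (b\<^sup>2) m / pi"
    by (rule grid_length_lower[OF al ab]) blast
  have small: "\<forall>\<^sub>F t in at_top. t > 0 \<and> ?s t \<le> r" if "r > 0" for r
  proof -
    have "\<forall>\<^sub>F t in at_top. ?s t < r" by (rule order_tendstoD(2)[OF conga_sigma_tendsto_0 that])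
    then show ?thesis using eventually_gt_at_top[of 0] by eventually_elim auto
  qed
  show ?thesis unfolding tendsto_in_prob_def
  proof (intro conjI allI impI)
    show "\<forall>\<^sub>F t in at_top. (\<lambda>\<omega>. ?N t \<omega> / (\<integral>\<^sup>+\<omega>'. ?N t \<omega>' \<partial>completion M)) \<in> borel_measurable (completion M)"
      using eventually_gt_at_top[of 0]
    proof eventually_elim
      case (elim t)
      note [measurable] = Nm[OF elim]
      show ?case by measurable
    qed
    fix \<epsilon> :: real assume e: "\<epsilon> > 0"
    let ?P = "\<lambda>t. measure (completion M) {\<omega>\<in>space (completion M). \<bar>enn2ereal (?N t \<omega> / (\<integral>\<^sup>+\<omega>'. ?N t \<omega>' \<partial>completion M)) - ereal 1\<bar> > ereal \<epsilon>}"
    show "(?P \<longlongrightarrow> 0) at_top"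
    proof (rule order_tendstoI)
      fix r :: real assume "r < 0"
      then show "\<forall>\<^sub>F t in at_top. r < ?P t" by (intro always_eventually allI) (rule less_le_trans[OF _ measure_nonneg])
    next
      fix r :: real assume r: "0 < r"
      \<comment> \<open>the mean deviation \<open>7 \<delta> / s\<close> against the mean \<open>c / s\<close> then gives \<open>r / 2\<close> in Markov's inequality\<close>
      define \<delta> where "\<delta> = r * \<epsilon> * c / 14"
      have d: "\<delta> > 0" using r e c by (simp add: \<delta>_def)
      obtain s0 where s0: "s0 > 0" "s0 \<le> 1" and conc: "\<And>s. 0 < s \<Longrightarrow> s \<le> s0 \<Longrightarrow> \<exists>\<mu>\<ge>0.
        (\<integral>\<^sup>+\<omega>. zero_count \<alpha> (rate s) (a\<^sup>2) (b\<^sup>2) (\<lambda>s. W s \<omega>) \<partial>completion M) = ennreal \<mu> \<and>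
        integrable (completion M) (\<lambda>\<omega>. enn2real (zero_count \<alpha> (rate s) (a\<^sup>2) (b\<^sup>2) (\<lambda>s. W s \<omega>))) \<and>
        (AE \<omega> in completion M. zero_count \<alpha> (rate s) (a\<^sup>2) (b\<^sup>2) (\<lambda>s. W s \<omega>) = ennreal (enn2real (zero_count \<alpha> (rate s) (a\<^sup>2) (b\<^sup>2) (\<lambda>s. W s \<omega>)))) \<and>
        (LINT \<omega>|completion M. \<bar>enn2real (zero_count \<alpha> (rate s) (a\<^sup>2) (b\<^sup>2) (\<lambda>s. W s \<omega>)) - \<mu>\<bar>) \<le> 7 * \<delta> / s"
        by (rule zero_count_concentration[OF al ab d]) blast
      have "min s0 s1 > 0" using s0 c by simp
      from small[OF this] show "\<forall>\<^sub>F t in at_top. ?P t < r"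
      proof eventually_elim
        case (elim t)
        then have t: "t > 0" and ts: "?s t \<le> s0" "?s t \<le> s1" by auto
        have s: "?s t > 0" by (rule conga_sigma_pos[OF assms(1,2) t])
        obtain \<mu> where mu: "\<mu> \<ge> 0" "(\<integral>\<^sup>+\<omega>. ?Z t \<omega> \<partial>completion M) = ennreal \<mu>"
          and i: "integrable (completion M) (\<lambda>\<omega>. enn2real (?Z t \<omega>))"
          and fin: "AE \<omega> in completion M. ?Z t \<omega> = ennreal (enn2real (?Z t \<omega>))"
          and dev: "(LINT \<omega>|completion M. \<bar>enn2real (?Z t \<omega>) - \<mu>\<bar>) \<le> 7 * \<delta> / ?s t"
          using conc[OF s ts(1)] by blast
        obtain m where m: "m > 0" "c / ?s t \<le> grid_length \<alpha> (rate (?s t)) (a\<^sup>2) (b\<^sup>2) m / pi" using low[OF s ts(2)] by blast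
        have "ennreal (c / ?s t) \<le> ennreal (grid_length \<alpha> (rate (?s t)) (a\<^sup>2) (b\<^sup>2) m / pi)" by (rule ennreal_leI[OF m(2)])
        also have "\<dots> \<le> ennreal \<mu>" unfolding mu(2)[symmetric] by (rule expectation_zero_count_ge[OF _ AB m(1)]) (use s in simp)
        finally have mul: "c / ?s t \<le> \<mu>" using mu(1) by (simp add: ennreal_le_iff)
        then have mu0: "\<mu> > 0" using c s by (meson divide_pos_pos less_le_trans)
        have "?P t = measure (completion M) {\<omega>\<in>space (completion M). \<bar>enn2ereal (?Z t \<omega> / ennreal \<mu>) - ereal 1\<bar> > ereal \<epsilon>}"
          unfolding EN[OF t] mu(2)
        proof (rule C.finite_measure_eq_AE)
          show "AE \<omega> in completion M. (\<omega> \<in> {\<omega>\<in>space (completion M). \<bar>enn2ereal (?N t \<omega> / ennreal \<mu>) - ereal 1\<bar> > ereal \<epsilon>}) =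
             (\<omega> \<in> {\<omega>\<in>space (completion M). \<bar>enn2ereal (?Z t \<omega> / ennreal \<mu>) - ereal 1\<bar> > ereal \<epsilon>})"
            using ae[OF t] by eventually_elim simp
          note [measurable] = Nm[OF t] Zm[OF t]
          show "{\<omega>\<in>space (completion M). \<bar>enn2ereal (?N t \<omega> / ennreal \<mu>) - ereal 1\<bar> > ereal \<epsilon>} \<in> sets (completion M)"
            "{\<omega>\<in>space (completion M). \<bar>enn2ereal (?Z t \<omega> / ennreal \<mu>) - ereal 1\<bar> > ereal \<epsilon>} \<in> sets (completion M)"
            by measurable
        qed
        also have "\<dots> \<le> (7 * \<delta> / ?s t) / (\<epsilon> * \<mu>)" by (rule ratio_deviation_prob[OF Zm[OF t] mu0 e i fin dev])
        also have "\<dots> \<le> (7 * \<delta> / ?s t) / (\<epsilon> * (c / ?s t))"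
          using mul mu0 e c s d by (intro divide_left_mono mult_left_mono mult_pos_pos) auto
        also have "\<dots> = r / 2" using s e c by (simp add: \<delta>_def)
        also have "\<dots> < r" using r by simp
        finally show ?case .
      qed
    qed
  qed
qed

end
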